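(* As $n\to\infty$, $$f_{\mathcal{OP}}(n,P_5)=\frac{17}{4}n^2+\Theta(n),$$ that is, $f_{\mathcal{OP}}(n,P_5)-\frac{17}{4}n^2=\Theta(n)$.
   Context: $P_k$ denotes the path on $k$ vertices. For graphs $H$ and $G$, $\mathcal{N}(H,G)$ denotes the number of subgraphs of $G$ isomorphic to $H$. The generalized outerplanar Turán number of $H$ is $f_{\mathcal{OP}}(n,H)=\max\{\mathcal{N}(H,G): G \text{ is an } n\text{-vertex outerplanar graph}\}$. *)

theory Defs
  imports "HOL-Analysis.Analysis" "HOL-Library.Landau_Symbols"
begin

type_synonym 'a graph = "'a set \<times> 'a set set"

abbreviation verts :: "'a graph \<Rightarrow> 'a set" where "verts \<equiv> fst"
abbreviation edges :: "'a graph \<Rightarrow> 'a set set" where "edges \<equiv> snd"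

definition simple_graph :: "'a graph \<Rightarrow> bool" where
  "simple_graph G \<longleftrightarrow> finite (verts G) \<and> (\<forall>e\<in>edges G. e \<subseteq> verts G \<and> card e = 2)"

definition subgraph :: "'a graph \<Rightarrow> 'a graph \<Rightarrow> bool" where
  "subgraph S G \<longleftrightarrow> simple_graph S \<and> verts S \<subseteq> verts G \<and> edges S \<subseteq> edges G"

definition graph_iso :: "'a graph \<Rightarrow> 'b graph \<Rightarrow> bool" where
  "graph_iso G H \<longleftrightarrow>
     (\<exists>f. bij_betw f (verts G) (verts H) \<and>
          (\<forall>u\<in>verts G. \<forall>v\<in>verts G. {u, v} \<in> edges G \<longleftrightarrow> {f u, f v} \<in> edges H))"

definition path_graph :: "nat \<Rightarrow> nat graph" where
  "path_graph k = ({..<k}, {{i, Suc i} |i. Suc i < k})"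

definition num_copies :: "'b graph \<Rightarrow> 'a graph \<Rightarrow> nat" where
  "num_copies H G = card {S. subgraph S G \<and> graph_iso S H}"

text \<open>
  A plane drawing places the vertices at distinct points of the plane and represents every edge
  by a Jordan arc joining its two end points, such that an arc contains no other vertex and two
  arcs meet only in common end vertices.
\<close>

definition plane_drawing ::
    "'a graph \<Rightarrow> ('a \<Rightarrow> complex) \<Rightarrow> ('a set \<Rightarrow> real \<Rightarrow> complex) \<Rightarrow> bool" where
  "plane_drawing G p \<gamma> \<longleftrightarrow>
     inj_on p (verts G) \<and>
     (\<forall>e\<in>edges G. arc (\<gamma> e) \<and> {pathstart (\<gamma> e), pathfinish (\<gamma> e)} = p ` e \<and>
                    path_image (\<gamma> e) \<inter> p ` verts G = p ` e) \<and>
     (\<forall>e\<in>edges G. \<forall>e'\<in>edges G. e \<noteq> e' \<longrightarrow>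
        path_image (\<gamma> e) \<inter> path_image (\<gamma> e') \<subseteq> p ` (e \<inter> e'))"

definition drawing_points ::
    "'a graph \<Rightarrow> ('a \<Rightarrow> complex) \<Rightarrow> ('a set \<Rightarrow> real \<Rightarrow> complex) \<Rightarrow> complex set" where
  "drawing_points G p \<gamma> = p ` verts G \<union> (\<Union>e\<in>edges G. path_image (\<gamma> e))"

text \<open>
  The drawing is a compact subset of the plane, so \<^const>\<open>outside\<close> of it is its unique unbounded
  face.
\<close>

definition outerplanar :: "'a graph \<Rightarrow> bool" where
  "outerplanar G \<longleftrightarrow> simple_graph G \<and>
     (\<exists>p \<gamma>. plane_drawing G p \<gamma> \<and>
            p ` verts G \<subseteq> frontier (outside (drawing_points G p \<gamma>)))"

text \<open>
  Labelling the vertices by natural numbers is no restriction: every finite graph is isomorphic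
  to such a graph, and \<^const>\<open>outerplanar\<close> and \<^const>\<open>num_copies\<close> are isomorphism invariant.
\<close>

definition outerplanar_turan :: "nat \<Rightarrow> 'b graph \<Rightarrow> nat" where
  "outerplanar_turan n H =
     Max {num_copies H G |G :: nat graph. outerplanar G \<and> card (verts G) = n}"

text \<open>The maximum is taken over a finite nonempty set.\<close>

lemma num_copies_le:
  assumes "simple_graph G"
  shows "num_copies H G \<le> 2 ^ card (verts G) * 2 ^ 2 ^ card (verts G)"
proof -
  have fin: "finite (verts G)"
    using assms by (simp add: simple_graph_def)
  have "{S. subgraph S G \<and> graph_iso S H} \<subseteq> Pow (verts G) \<times> Pow (Pow (verts G))"
    using assms by (fastforce simp: subgraph_def simple_graph_def)
  then have "num_copies H G \<le> card (Pow (verts G) \<times> Pow (Pow (verts G)))"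
    unfolding num_copies_def using fin by (intro card_mono) auto
  also have "\<dots> = 2 ^ card (verts G) * 2 ^ 2 ^ card (verts G)"
    using fin by (simp add: card_cartesian_product card_Pow)
  finally show ?thesis .
qed

lemma finite_num_copies_outerplanar:
  "finite {num_copies H G |G :: nat graph. outerplanar G \<and> card (verts G) = n}"
proof (rule finite_subset)
  show "{num_copies H G |G :: nat graph. outerplanar G \<and> card (verts G) = n}
          \<subseteq> {..2 ^ n * 2 ^ 2 ^ n}"
    using num_copies_le by (fastforce simp: outerplanar_def)
qed simp

lemma outerplanar_edgeless: "outerplanar ({..<n} :: nat set, {})"
proof -
  let ?p = "of_nat :: nat \<Rightarrow> complex"
  have fin: "finite (?p ` {..<n})"
    by simp
  have conn: "connected (- ?p ` {..<n})"
    by (intro path_connected_imp_connected path_connected_complement_countable)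
       (auto simp: countable_finite)
  have "inside (?p ` {..<n}) = {}"
    using conn fin finite_imp_bounded by (intro inside_bounded_complement_connected_empty) auto
  then have "outside (?p ` {..<n}) = - ?p ` {..<n}"
    by (metis sup_bot.left_neutral inside_Un_outside)
  then have "frontier (outside (?p ` {..<n})) = ?p ` {..<n}"
    using fin by (simp add: frontier_def closure_complement interior_complement
        finite_imp_closed empty_interior_finite)
  then show ?thesis
    unfolding outerplanar_def
    by (intro conjI exI[of _ ?p])
       (auto simp: simple_graph_def plane_drawing_def drawing_points_def inj_on_def)
qed

lemma num_copies_outerplanar_nonempty:
  "{num_copies H G |G :: nat graph. outerplanar G \<and> card (verts G) = n} \<noteq> {}"
  using outerplanar_edgeless[of n] by fastforce

end

theory Submission
  imports Defs "HOL-Complex_Analysis.Complex_Analysis"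
begin

text \<open>
  An outerplanar graph is the same as a graph with a noncrossing order of its vertices.  For the
  direction from drawings to orders one removes a vertex of degree at most two, which exists since
  a drawing with all vertices on the outer face contains no subdivision of \<open>K\<^sub>4\<close>, and puts it back
  next to its neighbours, which is possible since there is no subdivision of \<open>K\<^sub>2\<^sub>,\<^sub>3\<close> either.
  Conversely, the order is realised by chords of a parabola.

  A path on five vertices is counted by its two orderings, so \<open>17/2 n\<^sup>2\<close> is the target.  Let \<open>h\<close> be a
  vertex of maximum degree \<open>d\<close> in an edge-maximal graph.  If no edge avoids both \<open>h\<close> and its
  neighbours, then up to \<open>O(n)\<close> all paths have \<open>h\<close> in the second, third or fourth place; there are at most
  \<open>2n\<close> walks of length two and \<open>2d + 6(n - 1 - d)\<close> walks of length three starting at \<open>h\<close>, which gives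
  \<open>(2n)\<^sup>2 + 2d (6n - 4d)\<close> paths, and the maximum at \<open>d = 3n/4\<close> is \<open>17/2 n\<^sup>2\<close>.  Otherwise some vertex lies on at most
  \<open>50/3 n + O(1) < 17 n - O(1)\<close> ordered paths and is deleted by induction.  The linear terms in both
  cases are negative, which is the lower half of the \<open>\<Theta>(n)\<close> claim.
\<close>

section \<open>Noncrossing vertex orders\<close>

text \<open>Deleting \<open>e\<close> may cost 17n ordered paths, the increment of 17/2 n^2, which
  leaves little room. A vertex at the start of a fan at \<open>a\<close> below a chord
  \<open>a a'\<close> costs about 2 w3 + 4 w2 + 4 deg a + 2 deg a', where w2 and w3 count the walks
  of length two and three from \<open>a\<close>. The bound w3 + 2 w2 <= 8n alone would still allow
  18n, when deg a is near n/2. Hence each walk bound carries a refund for the degree of a second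
  vertex \<open>h\<close>: w2 + deg h <= 2n + O(1) and w3 + 2 w2 + 2 deg h <= 8n + O(1). As
  \<open>h\<close> has maximum degree and two vertices have at most two common neighbours, deg a +
  deg a' + deg h <= n + 6, and the worst case has all three degrees near n/3: this is 16 + 2/3 =
  50/3.

  When the d neighbours of the hub leave k independent non-neighbours, the count has quadratic part
  8 d^2 + 20 d k + 4 k^2 = 17/2 (d + k)^2 - (d - 3k)^2 / 2. The square vanishes at the optimum, so
  the sign of the linear term rests on exact savings: walks paired with themselves and vertices
  already used by a walk are subtracted.\<close>

definition noncrossing :: "('a \<Rightarrow> nat) \<Rightarrow> ('a \<times> 'a) set \<Rightarrow> bool" where
  "noncrossing p E \<longleftrightarrow>
     (\<forall>i j k l. (i, j) \<in> E \<longrightarrow> (k, l) \<in> E \<longrightarrow> \<not> (p i < p k \<and> p k < p j \<and> p j < p l))"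

locale sgraph =
  fixes V :: "'a set" and E :: "('a \<times> 'a) set"
  assumes finite_V: "finite V" and E_sub: "E \<subseteq> V \<times> V" and sym_E: "sym E" and irrefl_E: "irrefl E"
begin

lemma E_sym: "(u, v) \<in> E \<Longrightarrow> (v, u) \<in> E" using sym_E by (auto dest: symD)
lemma E_irrefl: "(u, u) \<notin> E" using irrefl_E by (auto simp: irrefl_def)
lemma E_V: "(u, v) \<in> E \<Longrightarrow> u \<in> V" "(u, v) \<in> E \<Longrightarrow> v \<in> V" using E_sub by auto

end

locale ordered_outer = sgraph V E for V :: "'a set" and E +
  fixes p :: "'a \<Rightarrow> nat"
  assumes inj_p: "inj_on p V" and noncrossing: "noncrossing p E"
begin

lemma no_cross: "(i, j) \<in> E \<Longrightarrow> (k, l) \<in> E \<Longrightarrow> p i < p k \<Longrightarrow> p k < p j \<Longrightarrow> p j < p l \<Longrightarrow> False"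
  using noncrossing by (auto simp: noncrossing_def)

lemma p_eq: "u \<in> V \<Longrightarrow> v \<in> V \<Longrightarrow> p u = p v \<Longrightarrow> u = v"
  using inj_p by (auto dest: inj_onD)

text \<open>Crossing depends only on the cyclic order, so the order can be cut open at any vertex.
  The last conjunct expresses the new order by the old one; it later identifies the two sides of an
  edge after rotating from one of its ends to the other.\<close>

lemma rotate:
  assumes "a \<in> V"
  shows "\<exists>q. ordered_outer V E q \<and> (\<forall>v\<in>V. v \<noteq> a \<longrightarrow> q a < q v) \<and>
    (\<forall>u\<in>V. \<forall>v\<in>V. q u < q v \<longleftrightarrow> (if p u < p a \<longleftrightarrow> p v < p a then p u < p v else p v < p a))"
proof -
  obtain M where M: "\<And>v. v \<in> V \<Longrightarrow> p v < M"
    using finite_nat_set_iff_bounded[of "p ` V"] finite_V by auto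
  define q where "q v = (if p v < p a then p v + M else p v)" for v
  have less: "q u < q v \<longleftrightarrow> (if p u < p a \<longleftrightarrow> p v < p a then p u < p v else p v < p a)"
    if "u \<in> V" "v \<in> V" for u v
    using M[OF that(1)] M[OF that(2)] by (auto simp: q_def)
  have "ordered_outer V E q"
  proof (unfold_locales)
    show "inj_on q V"
    proof (rule inj_onI)
      fix x y assume xy: "x \<in> V" "y \<in> V" "q x = q y"
      then have "p x = p y" using M[of x] M[of y] by (auto simp: q_def split: if_splits)
      then show "x = y" using xy p_eq by blast
    qed
    show "noncrossing q E"
      unfolding noncrossing_def
    proof (intro allI impI notI, elim conjE)
      fix i j k l assume e: "(i, j) \<in> E" "(k, l) \<in> E" and c: "q i < q k" "q k < q j" "q j < q l"
      have V: "i \<in> V" "j \<in> V" "k \<in> V" "l \<in> V" using e E_V by auto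
      \<comment> \<open>A rotation can exchange the ends of a chord and the roles of the two chords,
        hence all eight arrangements of the pair.\<close>
      show False
        using c e no_cross[OF e] no_cross[OF E_sym[OF e(1)] e(2)] no_cross[OF e(1) E_sym[OF e(2)]]
          no_cross[OF E_sym[OF e(1)] E_sym[OF e(2)]] no_cross[OF e(2) e(1)]
          no_cross[OF E_sym[OF e(2)] e(1)] no_cross[OF e(2) E_sym[OF e(1)]]
          no_cross[OF E_sym[OF e(2)] E_sym[OF e(1)]]
        by (auto simp: less V split: if_splits)
    qed
  qed
  moreover have "q a < q v" if "v \<in> V" "v \<noteq> a" for v
  proof -
    have "p v \<noteq> p a" using that assms p_eq[of v a] by blast
    then show ?thesis using that M[of v] M[of a] assms by (auto simp: q_def)
  qed
  ultimately show ?thesis using less by blast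
qed

text \<open>Mirror images allow the fan argument to be carried out at one end of a chord
  only.\<close>

lemma reflect:
  shows "\<exists>q. ordered_outer V E q \<and> (\<forall>u\<in>V. \<forall>v\<in>V. q u < q v \<longleftrightarrow> p v < p u)"
proof -
  obtain M where M: "\<And>v. v \<in> V \<Longrightarrow> p v < M"
    using finite_nat_set_iff_bounded[of "p ` V"] finite_V by auto
  define q where "q v = M - p v" for v
  have less: "q u < q v \<longleftrightarrow> p v < p u" if "u \<in> V" "v \<in> V" for u v
    using M[OF that(1)] M[OF that(2)] by (auto simp: q_def)
  have "ordered_outer V E q"
  proof (unfold_locales)
    show "inj_on q V"
    proof (rule inj_onI)
      fix x y assume xy: "x \<in> V" "y \<in> V" "q x = q y"
      then have "p x = p y" using M[of x] M[of y] by (auto simp: q_def)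
      then show "x = y" using xy p_eq by blast
    qed
    show "noncrossing q E"
      unfolding noncrossing_def
    proof (intro allI impI notI, elim conjE)
      fix i j k l assume e: "(i, j) \<in> E" "(k, l) \<in> E" and c: "q i < q k" "q k < q j" "q j < q l"
      have V: "i \<in> V" "j \<in> V" "k \<in> V" "l \<in> V" using e E_V by auto
      show False
        using c no_cross[OF E_sym[OF e(2)] E_sym[OF e(1)]] by (auto simp: less V)
    qed
  qed
  then show ?thesis using less by blast
qed

end

section \<open>Attaching a vertex of degree at most two to a noncrossing order\<close>

definition outer :: "'a set \<Rightarrow> ('a \<times> 'a) set \<Rightarrow> bool" where
  "outer V E \<longleftrightarrow> (\<exists>p. ordered_outer V E p)"

lemma outer_subset:
  assumes "outer V E" "V' \<subseteq> V" "E' \<subseteq> E \<inter> V' \<times> V'" "sym E'"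
  shows "outer V' E'"
proof -
  obtain p where "ordered_outer V E p" using assms by (auto simp: outer_def)
  then interpret ordered_outer V E p .
  have nc: "noncrossing p E'"
    unfolding noncrossing_def
  proof (intro allI impI notI, elim conjE)
    fix i j k l assume "(i, j) \<in> E'" "(k, l) \<in> E'" "p i < p k" "p k < p j" "p j < p l"
    then show False using no_cross[of i j k l] assms(3) by blast
  qed
  have "irrefl E'" using assms(3) irrefl_E by (auto simp: irrefl_def)
  moreover have "finite V'" using assms(2) finite_V finite_subset by blast
  moreover have "inj_on p V'" using inj_on_subset[OF inj_p assms(2)] .
  ultimately have "ordered_outer V' E' p"
    using assms(3,4) nc by unfold_locales blast+
  then show ?thesis by (auto simp: outer_def)
qed

text \<open>Doubling all positions opens a gap right after \<open>u\<close>; an edge between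
  consecutive positions crosses nothing.\<close>

lemma outer_add_leaf:
  assumes "outer V E" "e \<notin> V" "u \<in> V"
  shows "outer (insert e V) (E \<union> {(u, e), (e, u)})"
proof -
  obtain p where "ordered_outer V E p" using assms by (auto simp: outer_def)
  then interpret ordered_outer V E p .
  define q where "q v = (if v = e then 2 * p u + 1 else 2 * p v)" for v
  have e: "(e, x) \<notin> E" "(x, e) \<notin> E" for x using assms E_V by auto
  have "ordered_outer (insert e V) (E \<union> {(u, e), (e, u)}) q"
  proof unfold_locales
    show "inj_on q (insert e V)"
      using inj_p assms(2) by (auto simp: inj_on_def q_def) presburger+
    show "noncrossing q (E \<union> {(u, e), (e, u)})"
      unfolding noncrossing_def
    proof (intro allI impI notI, elim conjE)
      fix i j k l assume ed: "(i, j) \<in> E \<union> {(u, e), (e, u)}" "(k, l) \<in> E \<union> {(u, e), (e, u)}"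
        and c: "q i < q k" "q k < q j" "q j < q l"
      show False
      proof (cases "(i, j) \<in> E \<and> (k, l) \<in> E")
        case True
        then have "i \<noteq> e" "j \<noteq> e" "k \<noteq> e" "l \<noteq> e" using e by auto
        with c no_cross True show False by (auto simp: q_def)
      next
        case False
        with ed c e show False by (auto simp: q_def split: if_splits)
      qed
    qed
  qed (use finite_V E_sub assms sym_E irrefl_E in \<open>auto simp: sym_def irrefl_def\<close>)
  then show ?thesis by (auto simp: outer_def)
qed

lemma outer_add_isolated:
  assumes "outer V E" "e \<notin> V"
  shows "outer (insert e V) E"
proof (cases "V = {}")
  case True
  then have "E = {}" using assms by (auto simp: outer_def ordered_outer_def sgraph_def)
  then have "ordered_outer (insert e V) E (\<lambda>_. 0)"
    using True by unfold_locales (auto simp: sym_def irrefl_def noncrossing_def)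
  then show ?thesis by (auto simp: outer_def)
next
  case False
  then obtain u where "u \<in> V" by auto
  have "sym E" "E \<subseteq> V \<times> V" using assms by (auto simp: outer_def ordered_outer_def sgraph_def)
  then show ?thesis
    using outer_subset[OF outer_add_leaf[OF assms \<open>u \<in> V\<close>], of "insert e V" E] by auto
qed

text \<open>If no path through the part \<open>X\<close> of the boundary between \<open>u\<close> and \<open>v\<close> joins \<open>u\<close> to \<open>v\<close>, then
  \<open>X\<close> splits into a block hanging on \<open>u\<close> and a block hanging on \<open>v\<close>.  Moving these to the other
  side makes \<open>u\<close> and \<open>v\<close> neighbours on the boundary, and \<open>e\<close> fits in between.\<close>

lemma (in ordered_outer) outer_add_ear:
  assumes root: "\<forall>x\<in>V. x \<noteq> u \<longrightarrow> p u < p x" and uv: "(u, v) \<in> E" and e: "e \<notin> V"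
    and X: "X = {x \<in> V. p u < p x \<and> p x < p v}"
    and sep: "\<And>t. (u, t) \<in> (E \<inter> (insert u X) \<times> (insert u X))\<^sup>* \<Longrightarrow> (t, v) \<in> E \<Longrightarrow> t = u"
  shows "outer (insert e V) (E \<union> {(u, e), (e, u), (v, e), (e, v)})"
proof -
  \<comment> \<open>\<open>C\<close> is what \<open>u\<close> reaches within \<open>X\<close>. The
    cut between the two blocks is placed at the last vertex of \<open>C\<close>, so that vertices
    enclosed under edges of \<open>C\<close> move along with it in \<open>Xu\<close>.\<close>
  define R where "R = (E \<inter> (insert u X) \<times> (insert u X))\<^sup>*"
  define C where "C = {t. (u, t) \<in> R}"
  have V: "u \<in> V" "v \<in> V" "u \<noteq> v" using uv E_V E_irrefl by auto
  have CX: "C \<subseteq> insert u X"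
  proof
    fix t assume "t \<in> C"
    then have "(u, t) \<in> R" by (simp add: C_def)
    then show "t \<in> insert u X" unfolding R_def by (cases rule: rtranclE) auto
  qed
  have "finite (insert u X)" using X finite_V by simp
  then have finC: "finite C" by (rule finite_subset[OF CX])
  have uC: "u \<in> C" by (simp add: C_def R_def)
  have step: "y \<in> C" if "x \<in> C" "(x, y) \<in> E" "y \<in> X" for x y
    using that CX unfolding C_def R_def by (auto intro: rtrancl_into_rtrancl)
  define m where "m = Max (p ` C)"
  have m: "\<And>x. x \<in> C \<Longrightarrow> p x \<le> m" using finC by (simp add: m_def)
  have "m \<in> p ` C" unfolding m_def by (rule Max_in) (use finC uC in auto)
  then obtain w where w: "w \<in> C" "p w = m" by force
  define Xu where "Xu = {x \<in> X. p x \<le> m}"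
  \<comment> \<open>A walk from \<open>u\<close> to the last vertex of \<open>C\<close> starts
    before \<open>x\<close> and ends after it, so one of its edges passes over
    \<open>x\<close>.\<close>
  have straddle: "\<exists>s t. s \<in> C \<and> t \<in> C \<and> (s, t) \<in> E \<and> p s < p x \<and> p x < p t"
    if x: "x \<in> X" "x \<notin> C" "p x < m" for x
  proof (rule ccontr)
    assume neg: "\<not> ?thesis"
    have "(u, t) \<in> R \<Longrightarrow> p t < p x" for t
      unfolding R_def
    proof (induction rule: rtrancl_induct)
      case base then show ?case using x X by auto
    next
      case (step y z)
      then have "y \<in> C" "z \<in> C" using CX by (auto simp: C_def R_def intro: rtrancl_into_rtrancl)
      moreover have "z \<in> V" using step E_V by auto
      moreover have "x \<in> V" using x X by blast
      moreover have "(y, z) \<in> E" using step by blast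
      ultimately have "\<not> p x < p z" "p z \<noteq> p x"
        using neg step.IH p_eq[of z x] x(2) by blast+
      then show ?case by simp
    qed
    from this[of w] show False using w x by (auto simp: C_def)
  qed
  \<comment> \<open>Only \<open>uv\<close> joins the two blocks: an edge leaving \<open>C\<close>
    would extend \<open>C\<close> beyond its last vertex or reach \<open>v\<close> against
    \<open>sep\<close>, and an edge leaving a vertex enclosed by \<open>C\<close> would cross the
    edge above it.\<close>
  have sepA: "x = u \<and> y = v"
    if "(x, y) \<in> E" "x \<in> insert u Xu" "y = v \<or> y \<in> X - Xu" for x y
  proof (cases "x \<in> C")
    case True
    then show ?thesis using that step[OF True that(1)] sep[of x] m[of y]
      by (auto simp: C_def R_def Xu_def)
  next
    case False
    then have xX: "x \<in> X" "p x \<le> m" "x \<in> V" using that uC X by (auto simp: Xu_def)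
    then have "p x < m" using w False p_eq[of x w] CX V X by fastforce
    then obtain s t where st: "s \<in> C" "t \<in> C" "(s, t) \<in> E" "p s < p x" "p x < p t"
      using straddle xX False by blast
    have "p t \<le> m" using m st by simp
    moreover have "m < p y"
    proof -
      have "p w < p v" using w(1) CX X V root by auto
      then show ?thesis using that w by (auto simp: Xu_def not_le)
    qed
    ultimately show ?thesis using no_cross[OF st(3) that(1)] st by simp
  qed
  have sepB: False if "(x, y) \<in> E" "x \<in> X" "p v < p y" for x y
    using that no_cross[OF uv that(1)] X by auto
  obtain M where M: "\<And>x. x \<in> V \<Longrightarrow> p x < M"
    using finite_nat_set_iff_bounded[of "p ` V"] finite_V by auto
  \<comment> \<open>The new cyclic order is \<open>u\<close>, \<open>e\<close>, \<open>v\<close>,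
    the block of \<open>v\<close>, the former far side, and finally the block of \<open>u\<close>,
    which is thereby cyclically next to \<open>u\<close>. The offset \<open>M\<close> moves
    \<open>Xu\<close> behind everything else.\<close>
  define q where "q x = (if x = u then 0 else if x = e then 1 else if x = v then 2
     else if x \<in> Xu then 3 + M + p x else 3 + p x)" for x
  define T1 T2 T3 where "T1 = insert u Xu" and "T2 = insert v (X - Xu)"
    and "T3 = {x \<in> V. x = u \<or> p v \<le> p x}"
  have VT: "x \<in> T1 \<or> x \<in> T2 \<or> x \<in> T3" if "x \<in> V" for x
    using that root X by (cases "x \<in> X") (auto simp: T1_def T2_def T3_def not_less)
  \<comment> \<open>On each of the three groups the new order is the old one up to rotation, so
    edges of one group stay noncrossing; edges of different groups lie over separate arcs that share
    at most \<open>u\<close> or \<open>v\<close>.\<close>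
  have ty: "x \<in> T1 \<and> y \<in> T1 \<or> x \<in> T2 \<and> y \<in> T2 \<or> x \<in> T3 \<and> y \<in> T3" if xy: "(x, y) \<in> E" for x y
  proof -
    have "x \<in> V" "y \<in> V" using xy E_V by auto
    moreover have "x = v \<and> y = u \<or> x = u \<and> y = v" if "x \<in> T1 \<and> y \<in> T2 \<or> x \<in> T2 \<and> y \<in> T1"
      using that sepA[OF xy] sepA[OF E_sym[OF xy]] by (auto simp: T1_def T2_def)
    moreover have "x = u \<or> x = v" if "x \<in> T1 \<union> T2" "y \<in> T3" "y \<noteq> u" "y \<noteq> v"
      using that sepB[OF xy] p_eq[of y v] V by (force simp: T1_def T2_def T3_def Xu_def)
    moreover have "y = u \<or> y = v" if "y \<in> T1 \<union> T2" "x \<in> T3" "x \<noteq> u" "x \<noteq> v"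
      using that sepB[OF E_sym[OF xy]] p_eq[of x v] V by (force simp: T1_def T2_def T3_def Xu_def)
    moreover have "u \<in> T1 \<inter> T3" "v \<in> T2 \<inter> T3" using V by (auto simp: T1_def T2_def T3_def)
    ultimately show ?thesis using VT by blast
  qed
  have XV: "x \<in> V" "x \<noteq> e" "p x < M" "p u < p x" "p x < p v" "x \<noteq> u" "x \<noteq> v" if "x \<in> X" for x
    using that X e M by auto
  have q1: "q x = (if x = u then 0 else 3 + M + p x)" if "x \<in> T1" for x
    using that XV[of x] by (auto simp: q_def T1_def Xu_def)
  have q2: "q x = (if x = v then 2 else 3 + p x)" if "x \<in> T2" for x
    using that XV[of x] V e by (auto simp: q_def T2_def)
  have q3: "q x = (if x = u then 0 else if x = v then 2 else 3 + p x)" if "x \<in> T3" for x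
    using that XV[of x] V e by (auto simp: q_def T3_def Xu_def)
  have nc: False if ed: "(i, j) \<in> E" "(k, l) \<in> E" and c: "q i < q k" "q k < q j" "q j < q l" for i j k l
  proof -
    have pT1: "x = u \<or> p u < p x \<and> p x < p v \<and> p x < M" if "x \<in> T1" for x using that XV[of x] by (auto simp: T1_def Xu_def)
    have pT2: "x = v \<or> p u < p x \<and> p x < p v \<and> p x < M" if "x \<in> T2" for x using that XV[of x] by (auto simp: T2_def)
    have pT3: "x = u \<or> x = v \<or> p v < p x \<and> p x < M" if "x \<in> T3" for x
      using that V M[of x] p_eq[of v x] by (auto simp: T3_def)
    have uvp: "p u < p v" "p v < M" using root V M by auto
    note nx = no_cross[OF ed] no_cross[OF E_sym[OF ed(1)] ed(2)] no_cross[OF ed(1) E_sym[OF ed(2)]]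
          no_cross[OF E_sym[OF ed(1)] E_sym[OF ed(2)]] no_cross[OF ed(2) ed(1)]
          no_cross[OF E_sym[OF ed(2)] ed(1)] no_cross[OF ed(2) E_sym[OF ed(1)]]
          no_cross[OF E_sym[OF ed(2)] E_sym[OF ed(1)]]
    consider "i \<in> T1" "j \<in> T1" | "i \<in> T2" "j \<in> T2" | "i \<in> T3" "j \<in> T3" using ty[OF ed(1)] by blast
    then show False
    proof cases
      case 1
      consider "k \<in> T1" "l \<in> T1" | "k \<in> T2" "l \<in> T2" | "k \<in> T3" "l \<in> T3" using ty[OF ed(2)] by blast
      then show False
        by cases (use 1 c nx uvp pT1[of i] pT1[of j] pT1[of k] pT1[of l] pT2[of k] pT2[of l] pT3[of k] pT3[of l] in
            \<open>auto simp: q1 q2 q3 split: if_splits\<close>)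
    next
      case 2
      consider "k \<in> T1" "l \<in> T1" | "k \<in> T2" "l \<in> T2" | "k \<in> T3" "l \<in> T3" using ty[OF ed(2)] by blast
      then show False
        by cases (use 2 c nx uvp pT2[of i] pT2[of j] pT1[of k] pT1[of l] pT2[of k] pT2[of l] pT3[of k] pT3[of l] in
            \<open>auto simp: q1 q2 q3 split: if_splits\<close>)
    next
      case 3
      consider "k \<in> T1" "l \<in> T1" | "k \<in> T2" "l \<in> T2" | "k \<in> T3" "l \<in> T3" using ty[OF ed(2)] by blast
      then show False
        by cases (use 3 c nx uvp pT3[of i] pT3[of j] pT1[of k] pT1[of l] pT2[of k] pT2[of l] pT3[of k] pT3[of l] in
            \<open>auto simp: q1 q2 q3 split: if_splits\<close>)
    qed
  qed
  have "ordered_outer (insert e V) (E \<union> {(u, e), (e, u), (v, e), (e, v)}) q"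
  proof unfold_locales
    show "inj_on q (insert e V)"
    proof (rule inj_onI)
      fix x y assume xy: "x \<in> insert e V" "y \<in> insert e V" "q x = q y"
      then show "x = y"
        using V e p_eq[of x y] M[of x] M[of y] by (auto simp: q_def split: if_splits)
    qed
    show "noncrossing q (E \<union> {(u, e), (e, u), (v, e), (e, v)})"
      unfolding noncrossing_def
    proof (intro allI impI notI, elim conjE)
      fix i j k l assume ed: "(i, j) \<in> E \<union> {(u, e), (e, u), (v, e), (e, v)}"
        "(k, l) \<in> E \<union> {(u, e), (e, u), (v, e), (e, v)}"
        and c: "q i < q k" "q k < q j" "q j < q l"
      have quev: "q u = 0" "q e = 1" "q v = 2" using V e by (auto simp: q_def)
      have q1: "q x \<noteq> 1" if "x \<in> V" for x using that e V by (auto simp: q_def)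
      show False
      proof (cases "(i, j) \<in> E \<and> (k, l) \<in> E")
        case True then show False using nc c by blast
      next
        case False
        have "i \<noteq> e \<Longrightarrow> q i \<noteq> 1" "j \<noteq> e \<Longrightarrow> q j \<noteq> 1" "k \<noteq> e \<Longrightarrow> q k \<noteq> 1" "l \<noteq> e \<Longrightarrow> q l \<noteq> 1"
          using ed q1 E_V V by auto
        with False ed c quev show False by auto
      qed
    qed
  qed (use finite_V E_sub V e sym_E irrefl_E in \<open>auto simp: sym_def irrefl_def\<close>)
  then show ?thesis by (auto simp: outer_def)
qed

section \<open>Counting paths through a vertex\<close>

definition nb :: "('a \<times> 'a) set \<Rightarrow> 'a \<Rightarrow> 'a set" where
  "nb E v = {u. (v, u) \<in> E}"

definition dg :: "('a \<times> 'a) set \<Rightarrow> 'a \<Rightarrow> nat" where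
  "dg E v = card (nb E v)"

definition walks2 :: "('a \<times> 'a) set \<Rightarrow> 'a \<Rightarrow> ('a \<times> 'a) set" where
  "walks2 E a = {(y, z). (a, y) \<in> E \<and> (y, z) \<in> E \<and> z \<noteq> a}"

definition walks3 :: "('a \<times> 'a) set \<Rightarrow> 'a \<Rightarrow> ('a \<times> 'a \<times> 'a) set" where
  "walks3 E a = {(y, b, z). (a, y) \<in> E \<and> (y, b) \<in> E \<and> (b, z) \<in> E \<and> b \<noteq> a \<and> z \<noteq> a \<and> z \<noteq> y}"

definition paths5 :: "('a \<times> 'a) set \<Rightarrow> ('a \<times> 'a \<times> 'a \<times> 'a \<times> 'a) set" where
  "paths5 E = {(v1, v2, v3, v4, v5). (v1, v2) \<in> E \<and> (v2, v3) \<in> E \<and> (v3, v4) \<in> E \<and> (v4, v5) \<in> E \<and>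
     distinct [v1, v2, v3, v4, v5]}"

definition del :: "('a \<times> 'a) set \<Rightarrow> 'a \<Rightarrow> ('a \<times> 'a) set" where
  "del E e = {(u, v) \<in> E. u \<noteq> e \<and> v \<noteq> e}"

definition through1 :: "('a \<times> 'a) set \<Rightarrow> 'a \<Rightarrow> ('a \<times> 'a \<times> 'a \<times> 'a) set" where
  "through1 E e = {(b, c, d, f). (e, b, c, d, f) \<in> paths5 E}"

definition through2 :: "('a \<times> 'a) set \<Rightarrow> 'a \<Rightarrow> ('a \<times> 'a \<times> 'a \<times> 'a) set" where
  "through2 E e = {(a, c, d, f). (a, e, c, d, f) \<in> paths5 E}"

definition through3 :: "('a \<times> 'a) set \<Rightarrow> 'a \<Rightarrow> ('a \<times> 'a \<times> 'a \<times> 'a) set" where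
  "through3 E e = {(a, b, d, f). (a, b, e, d, f) \<in> paths5 E}"

lemma mem_nb [simp]: "u \<in> nb E v \<longleftrightarrow> (v, u) \<in> E" by (simp add: nb_def)

lemma card_Sigma_le:
  assumes "finite A" "card A \<le> m" "\<And>x. x \<in> A \<Longrightarrow> card (B x) \<le> k" "\<And>x. x \<in> A \<Longrightarrow> finite (B x)"
  shows "card (Sigma A B) \<le> m * k"
proof -
  have "card (Sigma A B) = (\<Sum>x\<in>A. card (B x))" using assms by (simp add: card_SigmaI)
  also have "\<dots> \<le> card A * k" using sum_bounded_above[of A "\<lambda>x. card (B x)" k] assms by simp
  also have "\<dots> \<le> m * k" using assms by simp
  finally show ?thesis .
qed

context sgraph
begin

lemma nb_V: "nb E v \<subseteq> V" using E_V by auto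
lemma finite_nb [simp]: "finite (nb E v)" using nb_V finite_V finite_subset by blast

lemma paths5_V: "paths5 E \<subseteq> V \<times> V \<times> V \<times> V \<times> V" using E_V by (auto simp: paths5_def)
lemma finite_paths5: "finite (paths5 E)" using finite_subset[OF paths5_V] finite_V by simp

lemma walks2_Sigma: "walks2 E a = (SIGMA y : nb E a. nb E y - {a})"
  by (auto simp: walks2_def)

lemma finite_walks2 [simp]: "finite (walks2 E a)" by (simp add: walks2_Sigma)

lemma finite_walks3 [simp]: "finite (walks3 E a)"
proof (rule finite_subset)
  show "walks3 E a \<subseteq> V \<times> V \<times> V" using E_V by (auto simp: walks3_def)
qed (simp add: finite_V)

lemma finite_through [simp]: "finite (through1 E e)" "finite (through2 E e)" "finite (through3 E e)"
proof -
  have "through1 E e \<subseteq> V \<times> V \<times> V \<times> V" "through2 E e \<subseteq> V \<times> V \<times> V \<times> V"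
    "through3 E e \<subseteq> V \<times> V \<times> V \<times> V"
    using paths5_V by (auto simp: through1_def through2_def through3_def dest!: subsetD[OF paths5_V])
  then show "finite (through1 E e)" "finite (through2 E e)" "finite (through3 E e)"
    using finite_V by (auto elim: finite_subset)
qed

lemma paths5_rev: "(a, b, c, d, e) \<in> paths5 E \<Longrightarrow> (e, d, c, b, a) \<in> paths5 E"
  using E_sym by (auto simp: paths5_def)

text \<open>A path through \<open>e\<close> has it in one of five places, and reversal identifies
  the fifth with the first and the fourth with the second. What is added to the first summand is the
  price of deleting \<open>e\<close>.\<close>

lemma card_paths5_del:
  "card (paths5 E) \<le> card (paths5 (del E e)) + 2 * card (through1 E e) + 2 * card (through2 E e)
     + card (through3 E e)"
proof -
  let ?f1 = "\<lambda>(b, c, d, f). (e, b, c, d, f)" and ?f2 = "\<lambda>(a, c, d, f). (a, e, c, d, f)"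
    and ?f3 = "\<lambda>(a, b, d, f). (a, b, e, d, f)" and ?f4 = "\<lambda>(a, c, d, f). (f, d, c, e, a)"
    and ?f5 = "\<lambda>(b, c, d, f). (f, d, c, b, e)"
  have "paths5 E \<subseteq> paths5 (del E e) \<union> (?f1 ` through1 E e \<union> ?f2 ` through2 E e \<union> ?f3 ` through3 E e
      \<union> ?f4 ` through2 E e \<union> ?f5 ` through1 E e)"
  proof
    fix x assume x: "x \<in> paths5 E"
    obtain a b c d f where [simp]: "x = (a, b, c, d, f)" by (cases x) auto
    consider "a = e" | "b = e" | "c = e" | "d = e" | "f = e" | "e \<notin> {a, b, c, d, f}" by auto
    then show "x \<in> paths5 (del E e) \<union> (?f1 ` through1 E e \<union> ?f2 ` through2 E e \<union> ?f3 ` through3 E e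
      \<union> ?f4 ` through2 E e \<union> ?f5 ` through1 E e)"
    proof cases
      case 1
      then have "(b, c, d, f) \<in> through1 E e" "x = ?f1 (b, c, d, f)" using x by (auto simp: through1_def)
      then show ?thesis by blast
    next
      case 2
      then have "(a, c, d, f) \<in> through2 E e" "x = ?f2 (a, c, d, f)" using x by (auto simp: through2_def)
      then show ?thesis by blast
    next
      case 3
      then have "(a, b, d, f) \<in> through3 E e" "x = ?f3 (a, b, d, f)" using x by (auto simp: through3_def)
      then show ?thesis by blast
    next
      case 4
      then have "(f, c, b, a) \<in> through2 E e" "x = ?f4 (f, c, b, a)"
        using paths5_rev[of a b c d f] x by (auto simp: through2_def)
      then show ?thesis by blast
    next
      case 5
      then have "(d, c, b, a) \<in> through1 E e" "x = ?f5 (d, c, b, a)"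
        using paths5_rev[of a b c d f] x by (auto simp: through1_def)
      then show ?thesis by blast
    next
      case 6
      then have "x \<in> paths5 (del E e)" using x by (auto simp: paths5_def del_def)
      then show ?thesis by blast
    qed
  qed
  moreover have "finite (paths5 (del E e))"
    by (rule finite_subset[OF _ finite_paths5]) (auto simp: paths5_def del_def)
  ultimately have "card (paths5 E) \<le> card (paths5 (del E e) \<union> (?f1 ` through1 E e \<union> ?f2 ` through2 E e \<union> ?f3 ` through3 E e
      \<union> ?f4 ` through2 E e \<union> ?f5 ` through1 E e))"
    by (intro card_mono) auto
  also have "\<dots> \<le> card (paths5 (del E e)) + (card (?f1 ` through1 E e) + card (?f2 ` through2 E e)
     + card (?f3 ` through3 E e) + card (?f4 ` through2 E e) + card (?f5 ` through1 E e))"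
    by (intro order_trans[OF card_Un_le] add_mono order_refl)
  also have "\<dots> \<le> card (paths5 (del E e)) + (card (through1 E e) + card (through2 E e)
     + card (through3 E e) + card (through2 E e) + card (through1 E e))"
    by (intro add_mono card_image_le order_refl) auto
  finally show ?thesis by simp
qed

text \<open>A vertex \<open>e\<close> of degree two inside a part \<open>U\<close> of bounded degree, which is attached to the
  rest of the graph by the few vertices in \<open>H\<close> only.\<close>

lemma through_ear:
  assumes U: "\<And>s. s \<in> U \<Longrightarrow> nb E s \<subseteq> U \<union> H" "\<And>s. s \<in> U \<Longrightarrow> dg E s \<le> B"
    and P: "nb E e \<subseteq> P" "P \<subseteq> U" "card P \<le> 2" "finite P" and H: "finite H"
  shows "card (through1 E e) + card (through2 E e) \<le>
      (\<Sum>a\<in>H. card (P \<inter> nb E a) * card (walks2 E a)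
        + (card (P \<inter> nb E a) + (\<Sum>s\<in>P. card (nb E s \<inter> nb E a \<inter> U))) * dg E a) + 4 * (B + 1) ^ 3"
    and "card (through3 E e) \<le> 4 * (B + 1) ^ 3"
proof -
  have t1: "card (through1 E e) \<le> (\<Sum>a\<in>H. card (P \<inter> nb E a) * card (walks2 E a)
        + (\<Sum>s\<in>P. card (nb E s \<inter> nb E a \<inter> U)) * dg E a) + 2 * (B * (B * B))"
  proof -
    let ?A = "\<lambda>a. (P \<inter> nb E a) \<times> walks2 E a"
    let ?B = "\<lambda>a. (SIGMA s : P. nb E s \<inter> nb E a \<inter> U) \<times> nb E a"
    let ?C = "(SIGMA s : P. SIGMA t : nb E s. SIGMA r : nb E t \<inter> U. nb E r)"
    let ?fA = "\<lambda>a (s, (t, r)). (s, a, t, r)" and ?fB = "\<lambda>a ((s, t), r). (s, t, a, r)"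
    let ?C' = "(SIGMA s : P. SIGMA t : nb E s \<inter> U. SIGMA r : nb E t \<inter> U. nb E r)"
    have "through1 E e \<subseteq> (\<Union>a\<in>H. ?fA a ` ?A a \<union> ?fB a ` ?B a) \<union> ?C'"
    proof
      fix x assume x: "x \<in> through1 E e"
      obtain s t r q where [simp]: "x = (s, t, r, q)" by (cases x) auto
      have E: "(e, s) \<in> E" "(s, t) \<in> E" "(t, r) \<in> E" "(r, q) \<in> E" and d: "q \<noteq> t"
        using x by (auto simp: through1_def paths5_def)
      then have s: "s \<in> P" "s \<in> U" using P by auto
      then have "t \<in> U \<or> t \<in> H" using U(1)[of s] E by auto
      moreover have "r \<in> U \<or> r \<in> H" if "t \<in> U" using U(1)[of t] E that by auto
      \<comment> \<open>The first vertex of \<open>H\<close> on the path decides: right after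
        \<open>s\<close> it is continued by a walk of length two; one step later the vertex before
        it is a common neighbour and its successor costs a degree; otherwise every choice is bounded
        by \<open>B\<close>.\<close>
      ultimately consider "t \<in> H" | "t \<in> U" "r \<in> H" | "t \<in> U" "r \<in> U" by blast
      then show "x \<in> (\<Union>a\<in>H. ?fA a ` ?A a \<union> ?fB a ` ?B a) \<union> ?C'"
      proof cases
        case 1
        have "(s, (r, q)) \<in> ?A t" using s E d E_sym by (auto simp: walks2_def)
        then have "x \<in> ?fA t ` ?A t" by force
        with 1 show ?thesis by blast
      next
        case 2
        have "((s, t), q) \<in> ?B r" using 2 s E E_sym by auto
        then have "x \<in> ?fB r ` ?B r" by force
        with 2 show ?thesis by blast
      next
        case 3
        then have "x \<in> ?C'" using s E by auto
        then show ?thesis by blast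
      qed
    qed
    moreover have "finite ((\<Union>a\<in>H. ?fA a ` ?A a \<union> ?fB a ` ?B a) \<union> ?C')"
      using H P by (auto intro!: finite_SigmaI)
    ultimately have "card (through1 E e) \<le> card ((\<Union>a\<in>H. ?fA a ` ?A a \<union> ?fB a ` ?B a) \<union> ?C')"
      by (rule card_mono[rotated])
    also have "\<dots> \<le> card (\<Union>a\<in>H. ?fA a ` ?A a \<union> ?fB a ` ?B a) + card ?C'" by (rule card_Un_le)
    also have "card (\<Union>a\<in>H. ?fA a ` ?A a \<union> ?fB a ` ?B a) \<le> (\<Sum>a\<in>H. card (?fA a ` ?A a \<union> ?fB a ` ?B a))"
      by (rule card_UN_le[OF H])
    also have "\<dots> \<le> (\<Sum>a\<in>H. card (P \<inter> nb E a) * card (walks2 E a)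
        + (\<Sum>s\<in>P. card (nb E s \<inter> nb E a \<inter> U)) * dg E a)"
    proof (rule sum_mono)
      fix a assume "a \<in> H"
      have "card (?fA a ` ?A a \<union> ?fB a ` ?B a) \<le> card (?A a) + card (?B a)"
        by (rule order_trans[OF card_Un_le]) (intro add_mono card_image_le; use P in auto)
      also have "\<dots> = card (P \<inter> nb E a) * card (walks2 E a)
        + (\<Sum>s\<in>P. card (nb E s \<inter> nb E a \<inter> U)) * dg E a"
        using P by (simp add: card_cartesian_product card_SigmaI dg_def)
      finally show "card (?fA a ` ?A a \<union> ?fB a ` ?B a) \<le> card (P \<inter> nb E a) * card (walks2 E a)
        + (\<Sum>s\<in>P. card (nb E s \<inter> nb E a \<inter> U)) * dg E a" .
    qed
    also have "card ?C' \<le> 2 * (B * (B * B))"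
    proof (intro card_Sigma_le)
      show "card (nb E s \<inter> U) \<le> B" if "s \<in> P" for s
        using order_trans[OF card_mono[of "nb E s" "nb E s \<inter> U"]] U(2)[of s] P that by (auto simp: dg_def)
      show "card (nb E t \<inter> U) \<le> B" if "t \<in> nb E s \<inter> U" for s t
        using order_trans[OF card_mono[of "nb E t" "nb E t \<inter> U"]] U(2)[of t] that by (auto simp: dg_def)
      show "card (nb E r) \<le> B" if "r \<in> nb E t \<inter> U" for t r using U(2)[of r] that by (auto simp: dg_def)
    qed (use P in auto)
    finally show ?thesis by simp
  qed
  have t2: "card (through2 E e) \<le> (\<Sum>a\<in>H. card (P \<inter> nb E a) * dg E a) + 2 * (2 * (B * B))"
  proof -
    let ?A = "\<lambda>a. (P \<inter> nb E a) \<times> nb E a" and ?fA = "\<lambda>a (s, r). (THE t. t \<in> P - {s}, s, a, r)"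
    let ?C = "(SIGMA t : P. SIGMA s : P. SIGMA r : nb E s \<inter> U. nb E r)"
    have "through2 E e \<subseteq> (\<Union>a\<in>H. ?fA a ` ?A a) \<union> ?C"
    proof
      fix x assume x: "x \<in> through2 E e"
      obtain t s r q where [simp]: "x = (t, s, r, q)" by (cases x) auto
      have E: "(t, e) \<in> E" "(e, s) \<in> E" "(s, r) \<in> E" "(r, q) \<in> E" and d: "t \<noteq> s"
        using x by (auto simp: through2_def paths5_def)
      then have s: "s \<in> P" "s \<in> U" "t \<in> P" using P E_sym by auto
      then have "r \<in> U \<or> r \<in> H" using U(1)[of s] E by auto
      then show "x \<in> (\<Union>a\<in>H. ?fA a ` ?A a) \<union> ?C"
      proof
        assume "r \<in> U" then have "x \<in> ?C" using s E by auto
        then show ?thesis by blast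
      next
        assume r: "r \<in> H"
        \<comment> \<open>With \<open>e\<close> in second place the first vertex of the path is the
          other element of \<open>P\<close>, so it adds no factor.\<close>
        have "{t, s} = P" by (rule card_seteq) (use P s d in auto)
        then have "(THE t. t \<in> P - {s}) = t" using d by (intro the_equality) auto
        moreover have "(s, q) \<in> ?A r" using s E E_sym by auto
        ultimately have "x \<in> ?fA r ` ?A r" by force
        with r show ?thesis by blast
      qed
    qed
    moreover have "finite ((\<Union>a\<in>H. ?fA a ` ?A a) \<union> ?C)"
      using H P by (auto intro!: finite_SigmaI)
    ultimately have "card (through2 E e) \<le> card ((\<Union>a\<in>H. ?fA a ` ?A a) \<union> ?C)" by (rule card_mono[rotated])
    also have "\<dots> \<le> card (\<Union>a\<in>H. ?fA a ` ?A a) + card ?C" by (rule card_Un_le)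
    also have "card (\<Union>a\<in>H. ?fA a ` ?A a) \<le> (\<Sum>a\<in>H. card (?fA a ` ?A a))" by (rule card_UN_le[OF H])
    also have "\<dots> \<le> (\<Sum>a\<in>H. card (P \<inter> nb E a) * dg E a)"
      by (intro sum_mono order_trans[OF card_image_le]) (use P in \<open>auto simp: card_cartesian_product dg_def\<close>)
    also have "card ?C \<le> 2 * (2 * (B * B))"
    proof (intro card_Sigma_le)
      show "card (nb E s \<inter> U) \<le> B" if "s \<in> P" for s
        using order_trans[OF card_mono[of "nb E s" "nb E s \<inter> U"]] U(2)[of s] P that by (auto simp: dg_def)
      show "card (nb E r) \<le> B" if "r \<in> nb E t \<inter> U" for t r using U(2)[of r] that by (auto simp: dg_def)
    qed (use P in auto)
    finally show ?thesis by simp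
  qed
  have "2 * (B * (B * B)) + 2 * (2 * (B * B)) \<le> 4 * (B + 1) ^ 3"
    by (simp add: power3_eq_cube algebra_simps)
  with t1 t2 show "card (through1 E e) + card (through2 E e) \<le>
      (\<Sum>a\<in>H. card (P \<inter> nb E a) * card (walks2 E a)
        + (card (P \<inter> nb E a) + (\<Sum>s\<in>P. card (nb E s \<inter> nb E a \<inter> U))) * dg E a) + 4 * (B + 1) ^ 3"
    by (simp add: sum.distrib add_mult_distrib)
  let ?D = "(SIGMA s : P. SIGMA r : P. nb E s \<times> nb E r)"
  have "through3 E e \<subseteq> (\<lambda>(s, r, t, q). (t, s, r, q)) ` ?D"
  proof
    fix x assume x: "x \<in> through3 E e"
    obtain t s r q where [simp]: "x = (t, s, r, q)" by (cases x) auto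
    have "(s, r, t, q) \<in> ?D" using x P E_sym by (auto simp: through3_def paths5_def)
    then show "x \<in> (\<lambda>(s, r, t, q). (t, s, r, q)) ` ?D" by force
  qed
  then have "card (through3 E e) \<le> card ?D"
    by (rule surj_card_le[rotated]) (use P in auto)
  also have "\<dots> \<le> 2 * (2 * (B * B))"
  proof (intro card_Sigma_le)
    show "card (nb E s) \<le> B" if "s \<in> P" for s using U(2)[of s] P that by (auto simp: dg_def)
    then show "card (nb E s) \<le> B" if "s \<in> P" for s using that .
  qed (use P in auto)
  also have "\<dots> \<le> 4 * (B + 1) ^ 3" by (simp add: power3_eq_cube algebra_simps)
  finally show "card (through3 E e) \<le> 4 * (B + 1) ^ 3" .
qed

text \<open>Here \<open>e\<close>, \<open>u\<close>, \<open>w\<close> begin a fan at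
  \<open>a\<close>. A path from \<open>e\<close> enters \<open>a\<close> at once, or after
  \<open>u\<close>, or moves along \<open>u\<close> and \<open>w\<close> and then has few
  continuations. Doubling the first two bounds makes 2 w3 + 4 w2 the leading part of the loss, which
  is why w3 + 2 w2 is the quantity estimated later.\<close>

lemma through_fan:
  assumes e: "nb E e \<subseteq> {a, u}" and u: "nb E u \<subseteq> {a, e, w}" and w: "nb E w \<subseteq> W \<union> {a, a'}"
    and B: "dg E w \<le> B" "\<And>s. s \<in> W \<Longrightarrow> dg E s \<le> B"
  shows "card (through1 E e) \<le> card (walks3 E a) + card (walks2 E a) + dg E a + dg E a' + B * B"
    and "card (through2 E e) \<le> card (walks2 E a) + B"
    and "card (through3 E e) \<le> 2 * dg E a"
proof -
  let ?A = "(\<lambda>(t, r, q). (a, t, r, q)) ` walks3 E a" and ?B = "(\<lambda>(r, q). (u, a, r, q)) ` walks2 E a"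
    and ?C = "\<lambda>h. (\<lambda>q. (u, w, h, q)) ` nb E h" and ?D = "(\<lambda>(r, q). (u, w, r, q)) ` (SIGMA r : nb E w \<inter> W. nb E r)"
  have "through1 E e \<subseteq> ?A \<union> ?B \<union> ?C a \<union> ?C a' \<union> ?D"
  proof
    fix x assume x: "x \<in> through1 E e"
    obtain s t r q where [simp]: "x = (s, t, r, q)" by (cases x) auto
    have E: "(e, s) \<in> E" "(s, t) \<in> E" "(t, r) \<in> E" "(r, q) \<in> E" and d: "distinct [e, s, t, r, q]"
      using x by (auto simp: through1_def paths5_def)
    have "s \<in> {a, u}" "s = u \<Longrightarrow> t \<in> {a, e, w}" using E e u by auto
    then consider "s = a" | "s = u" "t = a" | "s = u" "t = w" using d by auto
    then show "x \<in> ?A \<union> ?B \<union> ?C a \<union> ?C a' \<union> ?D"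
    proof cases
      case 1
      then have "(t, r, q) \<in> walks3 E a" using E d by (auto simp: walks3_def)
      then have "x \<in> ?A" using 1 by force
      then show ?thesis by blast
    next
      case 2
      then have "(r, q) \<in> walks2 E a" using E d by (auto simp: walks2_def)
      then have "x \<in> ?B" using 2 by force
      then show ?thesis by blast
    next
      case 3
      have "r \<in> W \<union> {a, a'}" using E w 3 by auto
      then consider "r = a" | "r = a'" | "r \<in> W" by auto
      then show ?thesis
      proof cases
        case 1 then have "x \<in> ?C a" using 3 E by force
        then show ?thesis by blast
      next
        case 2 then have "x \<in> ?C a'" using 3 E by force
        then show ?thesis by blast
      next
        case r: 3
        then have "(r, q) \<in> (SIGMA r : nb E w \<inter> W. nb E r)" using 3 E by auto
        then have "x \<in> ?D" using 3 by force
        then show ?thesis by blast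
      qed
    qed
  qed
  then have "card (through1 E e) \<le> card (?A \<union> ?B \<union> ?C a \<union> ?C a' \<union> ?D)" by (rule card_mono[rotated]) simp
  also have "\<dots> \<le> card ?A + card ?B + card (?C a) + card (?C a') + card ?D"
    by (intro order_trans[OF card_Un_le] add_mono order_refl)
  also have "\<dots> \<le> card (walks3 E a) + card (walks2 E a) + card (nb E a) + card (nb E a')
      + card (SIGMA r : nb E w \<inter> W. nb E r)"
    by (intro add_mono card_image_le) auto
  also have "card (SIGMA r : nb E w \<inter> W. nb E r) \<le> B * B"
  proof (intro card_Sigma_le)
    show "card (nb E w \<inter> W) \<le> B"
      using order_trans[OF card_mono[of "nb E w" "nb E w \<inter> W"]] B by (auto simp: dg_def)
  qed (use B in \<open>auto simp: dg_def\<close>)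
  finally show "card (through1 E e) \<le> card (walks3 E a) + card (walks2 E a) + dg E a + dg E a' + B * B"
    by (simp add: dg_def)
next
  let ?A = "(\<lambda>(r, q). (u, a, r, q)) ` walks2 E a" and ?B = "(\<lambda>q. (a, u, w, q)) ` nb E w"
  have "through2 E e \<subseteq> ?A \<union> ?B"
  proof
    fix x assume x: "x \<in> through2 E e"
    obtain s t r q where [simp]: "x = (s, t, r, q)" by (cases x) auto
    have E: "(e, s) \<in> E" "(e, t) \<in> E" "(t, r) \<in> E" "(r, q) \<in> E" and d: "distinct [s, e, t, r, q]"
      using x E_sym by (auto simp: through2_def paths5_def)
    have "s \<in> {a, u}" "t \<in> {a, u}" "t = u \<Longrightarrow> r \<in> {a, e, w}" using E e u by auto
    then consider "t = a" "s = u" | "t = u" "s = a" "r = w" using d by auto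
    then show "x \<in> ?A \<union> ?B"
    proof cases
      case 1
      then have "(r, q) \<in> walks2 E a" using E d by (auto simp: walks2_def)
      then have "x \<in> ?A" using 1 by force
      then show ?thesis by blast
    next
      case 2 then have "x \<in> ?B" using E by force
      then show ?thesis by blast
    qed
  qed
  then have "card (through2 E e) \<le> card (?A \<union> ?B)" by (rule card_mono[rotated]) simp
  also have "\<dots> \<le> card ?A + card ?B" by (rule card_Un_le)
  also have "\<dots> \<le> card (walks2 E a) + card (nb E w)" by (intro add_mono card_image_le) auto
  finally show "card (through2 E e) \<le> card (walks2 E a) + B" using B(1) by (simp add: dg_def)
next
  let ?A = "(\<lambda>s. (s, a, u, w)) ` nb E a" and ?B = "(\<lambda>q. (w, u, a, q)) ` nb E a"
  have "through3 E e \<subseteq> ?A \<union> ?B"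
  proof
    fix x assume x: "x \<in> through3 E e"
    obtain s t r q where [simp]: "x = (s, t, r, q)" by (cases x) auto
    have E: "(t, s) \<in> E" "(e, t) \<in> E" "(e, r) \<in> E" "(r, q) \<in> E" and d: "distinct [s, t, e, r, q]"
      using x E_sym by (auto simp: through3_def paths5_def)
    have "t \<in> {a, u}" "r \<in> {a, u}" "r = u \<Longrightarrow> q \<in> {a, e, w}" "t = u \<Longrightarrow> s \<in> {a, e, w}"
      using E e u by auto
    then consider "t = a" "r = u" "q = w" | "t = u" "r = a" "s = w" using d by auto
    then show "x \<in> ?A \<union> ?B" by cases (use E in force)+
  qed
  then have "card (through3 E e) \<le> card (?A \<union> ?B)" by (rule card_mono[rotated]) simp
  also have "\<dots> \<le> card ?A + card ?B" by (rule card_Un_le)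
  also have "\<dots> \<le> card (nb E a) + card (nb E a)" by (intro add_mono card_image_le) auto
  finally show "card (through3 E e) \<le> 2 * dg E a" by (simp add: dg_def)
qed

end

lemma card_le_1I: "(\<And>x y. x \<in> S \<Longrightarrow> y \<in> S \<Longrightarrow> x = y) \<Longrightarrow> card S \<le> 1"
  by (cases "finite S") (auto simp: card_le_Suc0_iff_eq)

lemma card_offdiag_le:
  assumes "finite K" "card K \<le> 2"
  shows "card {(y, z). y \<in> K \<and> z \<in> K \<and> y \<noteq> z} \<le> (if card K = 2 then 2 else 0)"
proof (cases "card K = 2")
  case True
  then obtain u v where "K = {u, v}" by (auto simp: card_2_iff)
  then have "{(y, z). y \<in> K \<and> z \<in> K \<and> y \<noteq> z} \<subseteq> {(u, v), (v, u)}" by auto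
  from card_mono[OF _ this] show ?thesis using True by (simp add: card_insert_if split: if_splits)
next
  case False
  then have "card K \<le> Suc 0" using assms by simp
  then have eq: "{(y, z). y \<in> K \<and> z \<in> K \<and> y \<noteq> z} = {}" using assms by (auto simp: card_le_Suc0_iff_eq)
  show ?thesis unfolding eq by simp
qed

section \<open>Short walks from the first vertex\<close>

text \<open>With \<open>a\<close> in first position every neighbour \<open>y\<close> of
  \<open>a\<close> acts as a wall: an edge that avoids \<open>a\<close> and passes over
  \<open>y\<close> would cross \<open>a y\<close>. Most arguments below exhibit such an
  edge.\<close>

locale rooted = ordered_outer V E p for V :: "'a set" and E p +
  fixes a
  assumes a_V: "a \<in> V" and root: "\<And>v. v \<in> V \<Longrightarrow> v \<noteq> a \<Longrightarrow> p a < p v"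
begin

definition out :: "'a set" where "out = V - insert a (nb E a)"

lemma p_root: "(a, y) \<in> E \<Longrightarrow> p a < p y" using root E_V E_irrefl by metis
lemma p_out: "z \<in> out \<Longrightarrow> p a < p z" using root by (auto simp: out_def)
lemma out_V: "z \<in> out \<Longrightarrow> z \<in> V" by (auto simp: out_def)
lemma out_notin: "z \<in> out \<Longrightarrow> (a, z) \<notin> E" by (auto simp: out_def)
lemma finite_out: "finite out" using finite_V by (simp add: out_def)

lemma p_neq: "(u, v) \<in> E \<Longrightarrow> p u \<noteq> p v" using p_eq E_V E_irrefl by metis
lemma p_lt: "(u, v) \<in> E \<Longrightarrow> \<not> p u < p v \<Longrightarrow> p v < p u" using p_neq by (metis linorder_neqE_nat)
lemma p_neq': "u \<in> V \<Longrightarrow> v \<in> V \<Longrightarrow> u \<noteq> v \<Longrightarrow> p u < p v \<or> p v < p u" using p_eq by (metis linorder_neqE_nat)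

text \<open>The edge to \<open>z\<close> from the earlier of two such neighbours would pass over the
  later one.\<close>

lemma lower_unique:
  assumes "(a, y) \<in> E" "(a, y') \<in> E" "(y, z) \<in> E" "(y', z) \<in> E" "p y < p z" "p y' < p z"
  shows "y = y'"
  using assms p_neq'[of y y'] no_cross[of a y y' z] no_cross[of a y' y z] p_root E_V by metis

lemma upper_unique:
  assumes "(a, y) \<in> E" "(a, y') \<in> E" "(y, z) \<in> E" "(y', z) \<in> E" "p z < p y" "p z < p y'" "z \<noteq> a"
  shows "y = y'"
  using assms p_neq'[of y y'] no_cross[of a y z y'] no_cross[of a y' z y] E_sym root[of z] E_V by metis

lemma common_cases:
  "nb E a \<inter> nb E z = {y \<in> nb E a \<inter> nb E z. p y < p z} \<union> {y \<in> nb E a \<inter> nb E z. p z < p y}"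
  using p_lt[of z] by auto

lemma card_common_parts:
  assumes "z \<noteq> a"
  shows "card {y \<in> nb E a \<inter> nb E z. p y < p z} \<le> 1" "card {y \<in> nb E a \<inter> nb E z. p z < p y} \<le> 1"
proof -
  show "card {y \<in> nb E a \<inter> nb E z. p y < p z} \<le> 1"
    by (rule card_le_1I) (use lower_unique[of _ _ z] E_sym in auto)
  show "card {y \<in> nb E a \<inter> nb E z. p z < p y} \<le> 1"
    by (rule card_le_1I) (use upper_unique[of _ _ z] assms E_sym in auto)
qed

lemma card_common_root: "z \<noteq> a \<Longrightarrow> card (nb E a \<inter> nb E z) \<le> 2"
  by (subst common_cases) (use card_common_parts[of z] card_Un_le in \<open>fastforce intro: order_trans\<close>)

text \<open>The two common neighbours lie on either side of \<open>z\<close>, by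
  \<open>card_common_parts\<close>. Apexes are exactly the vertices of \<open>out\<close> that
  contribute more than one to a sum of codegrees with \<open>a\<close>.\<close>

definition apex :: "'a set" where "apex = {z \<in> out. card (nb E a \<inter> nb E z) = 2}"

lemma apex_V: "z \<in> apex \<Longrightarrow> z \<in> V" using out_V by (simp add: apex_def)

lemma apexE:
  assumes "z \<in> apex"
  obtains y y' where "(a, y) \<in> E" "(a, y') \<in> E" "(y, z) \<in> E" "(z, y') \<in> E" "p y < p z" "p z < p y'"
proof -
  let ?L = "{y \<in> nb E a \<inter> nb E z. p y < p z}" and ?U = "{y \<in> nb E a \<inter> nb E z. p z < p y}"
  have "z \<noteq> a" "card (nb E a \<inter> nb E z) = 2" using assms by (auto simp: apex_def out_def)
  moreover have "card (nb E a \<inter> nb E z) \<le> card ?L + card ?U" by (subst common_cases) (rule card_Un_le)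
  ultimately have "card ?L = 1" "card ?U = 1" using card_common_parts[of z] by linarith+
  then obtain y y' where "?L = {y}" "?U = {y'}" unfolding card_1_singleton_iff One_nat_def by blast
  then have "y \<in> ?L" "y' \<in> ?U" by (simp_all only: singletonI)
  then have "(a, y) \<in> E" "(z, y) \<in> E" "p y < p z" "(a, y') \<in> E" "(z, y') \<in> E" "p z < p y'" by simp_all
  then show ?thesis using that[of y y'] E_sym by blast
qed

lemma no_root_nb_between:
  assumes "(a, y) \<in> E" "(a, s) \<in> E" "(y, z) \<in> E" "p y < p s" "p s < p z"
  shows False
  using no_cross[OF assms(2,3)] p_root[OF assms(1)] assms by blast

lemma no_root_nb_between':
  assumes "(a, s) \<in> E" "(z, y') \<in> E" "p z < p s" "p s < p y'" "z \<in> V" "z \<noteq> a"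
  shows False
  using no_cross[OF assms(1,2)] root[of z] assms by blast

text \<open>Since neighbours of \<open>a\<close> are walls, the interval of \<open>z1\<close> is
  closed off before that of \<open>z2\<close> opens. This disjointness is behind all counts of
  apexes.\<close>

lemma apex_separated:
  assumes "p z1 < p z2" "z1 \<in> out" "z2 \<in> out"
    and 1: "(a, y1) \<in> E" "(z1, y1) \<in> E" "p z1 < p y1"
    and 2: "(a, y2) \<in> E" "(y2, z2) \<in> E" "p y2 < p z2"
  shows "p y1 \<le> p y2"
proof -
  have V: "y1 \<in> V" "y2 \<in> V" "z1 \<in> V" "z2 \<in> V" "z1 \<noteq> a"
    using E_V(2)[OF 1(1)] E_V(2)[OF 2(1)] assms(2,3) by (auto simp: out_def)
  have ne: "y1 \<noteq> z2" "y2 \<noteq> z1" using out_notin[OF assms(2)] out_notin[OF assms(3)] 1 2 by metis+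
  have "\<not> p z2 < p y1"
  proof
    assume c: "p z2 < p y1"
    show False
    proof (cases "p z1 < p y2")
      case True
      then show False using no_root_nb_between'[OF 2(1) 1(2)] c 2 V by simp
    next
      case False
      then have "p y2 < p z1" using ne p_neq'[of y2 z1] V by auto
      then show False using no_cross[OF 2(2) 1(2)] assms(1) c by blast
    qed
  qed
  then have "p y1 < p z2" using ne V p_neq'[of y1 z2] by auto
  then show ?thesis using no_root_nb_between[OF 2(1) 1(1) 2(2)] by (meson not_le_imp_less)
qed

text \<open>Between two apexes lies a neighbour of \<open>a\<close>. If both were adjacent to
  \<open>h\<close> and on the same side of it, the edge from \<open>h\<close> to the farther one
  would pass over that wall; so there is at most one on each side.\<close>

lemma apex_nb_card:
  shows "card (apex \<inter> nb E h) \<le> 2"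
proof -
  have "card {z \<in> apex \<inter> nb E h. p z < p h} \<le> 1"
  proof (rule card_le_1I)
    have False if z: "z1 \<in> apex" "z2 \<in> apex" "(h, z1) \<in> E" "(h, z2) \<in> E" "p z2 < p h" "p z1 < p z2" for z1 z2
    proof -
      obtain y1 y1' where 1: "(a, y1') \<in> E" "(z1, y1') \<in> E" "p z1 < p y1'" using apexE[OF z(1)] by metis
      obtain y2 y2' where 2: "(a, y2) \<in> E" "(y2, z2) \<in> E" "p y2 < p z2" using apexE[OF z(2)] by metis
      have "p y1' \<le> p y2" using apex_separated[OF z(6) _ _ 1 2] z by (auto simp: apex_def)
      then have "p y1' < p h" using 2 z by simp
      then show False using no_cross[OF 1(1) E_sym[OF z(3)]] 1(3) p_out[of z1] z(1) by (auto simp: apex_def)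
    qed
    note F = this
    show "x = y" if "x \<in> {z \<in> apex \<inter> nb E h. p z < p h}" "y \<in> {z \<in> apex \<inter> nb E h. p z < p h}" for x y
    proof (rule ccontr)
      assume "x \<noteq> y"
      then have "p x < p y \<or> p y < p x" using that p_neq'[of x y] apex_V by simp
      then show False using that F[of x y] F[of y x] by auto
    qed 
  qed
  moreover have "card {z \<in> apex \<inter> nb E h. p h < p z} \<le> 1"
  proof (rule card_le_1I)
    have False if z: "z1 \<in> apex" "z2 \<in> apex" "(h, z1) \<in> E" "(h, z2) \<in> E" "p h < p z1" "p z1 < p z2" for z1 z2
    proof -
      obtain y1 y1' where 1: "(a, y1') \<in> E" "(z1, y1') \<in> E" "p z1 < p y1'" using apexE[OF z(1)] by metis
      obtain y2 y2' where 2: "(a, y2) \<in> E" "(y2, z2) \<in> E" "p y2 < p z2" using apexE[OF z(2)] by metis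
      have "p y1' \<le> p y2" using apex_separated[OF z(6) _ _ 1 2] z by (auto simp: apex_def)
      moreover have "h \<noteq> a" using z by (auto simp: apex_def out_def)
      ultimately show False using no_cross[OF 2(1) z(4)] 1(3) 2(3) root[of h] E_V[OF z(3)] z(5) by simp
    qed
    note F = this
    show "x = y" if "x \<in> {z \<in> apex \<inter> nb E h. p h < p z}" "y \<in> {z \<in> apex \<inter> nb E h. p h < p z}" for x y
    proof (rule ccontr)
      assume "x \<noteq> y"
      then have "p x < p y \<or> p y < p x" using that p_neq'[of x y] apex_V by simp
      then show False using that F[of x y] F[of y x] by auto
    qed
  qed
  moreover have "apex \<inter> nb E h \<subseteq> {z \<in> apex \<inter> nb E h. p z < p h} \<union> {z \<in> apex \<inter> nb E h. p h < p z}"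
    using p_lt[of h] by auto
  then have "card (apex \<inter> nb E h) \<le> card ({z \<in> apex \<inter> nb E h. p z < p h} \<union> {z \<in> apex \<inter> nb E h. p h < p z})"
    by (rule card_mono[rotated]) (rule finite_subset[of _ "nb E h"], auto)
  moreover note card_Un_le[of "{z \<in> apex \<inter> nb E h. p z < p h}" "{z \<in> apex \<inter> nb E h. p h < p z}"]
  ultimately show ?thesis by linarith
qed

text \<open>An apex is determined by its neighbour in \<open>nb E a\<close> on the left, as the
  interval of the next apex opens only after the right one.\<close>

lemma apex_card: "card apex \<le> dg E a"
proof -
  have "\<exists>y. (a, y) \<in> E \<and> (y, z) \<in> E \<and> p y < p z" if "z \<in> apex" for z using apexE[OF that] by metis
  then obtain f where f: "\<And>z. z \<in> apex \<Longrightarrow> (a, f z) \<in> E \<and> (f z, z) \<in> E \<and> p (f z) < p z" by metis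
  have "inj_on f apex"
  proof (rule inj_onI, rule ccontr)
    have False if z: "z1 \<in> apex" "z2 \<in> apex" "f z1 = f z2" "p z1 < p z2" for z1 z2
    proof -
      obtain y where 1: "(a, y) \<in> E" "(z1, y) \<in> E" "p z1 < p y" using apexE[OF z(1)] by metis
      have "p y \<le> p (f z2)" using apex_separated[OF z(4) _ _ 1, of "f z2"] f[of z2] z by (auto simp: apex_def)
      then show False using f[of z1] z 1 by simp
    qed
    then show False if "x \<in> apex" "y \<in> apex" "f x = f y" "x \<noteq> y" for x y
      using that p_neq'[of x y] apex_V by metis
  qed
  then show ?thesis unfolding dg_def
    by (rule card_inj_on_le) (use f in auto)
qed

lemma card_walks2: "card (walks2 E a) = (\<Sum>z\<in>V - {a}. card (nb E a \<inter> nb E z))"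
proof -
  have "walks2 E a = (\<lambda>(z, y). (y, z)) ` (SIGMA z : V - {a}. nb E a \<inter> nb E z)"
  proof (intro set_eqI iffI)
    fix x assume "x \<in> walks2 E a"
    then obtain y z where x: "x = (y, z)" "(a, y) \<in> E" "(y, z) \<in> E" "z \<noteq> a" by (auto simp: walks2_def)
    then have "(z, y) \<in> (SIGMA z : V - {a}. nb E a \<inter> nb E z)" using E_sym E_V(2) by auto
    then show "x \<in> (\<lambda>(z, y). (y, z)) ` (SIGMA z : V - {a}. nb E a \<inter> nb E z)" using x(1) by force
  next
    fix x assume "x \<in> (\<lambda>(z, y). (y, z)) ` (SIGMA z : V - {a}. nb E a \<inter> nb E z)"
    then show "x \<in> walks2 E a" using E_sym by (auto simp: walks2_def)
  qed
  moreover have "inj_on (\<lambda>(z, y). (y, z)) (SIGMA z : V - {a}. nb E a \<inter> nb E z)" by (auto simp: inj_on_def)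
  ultimately show ?thesis using finite_V by (simp add: card_image card_SigmaI)
qed

text \<open>The sum of codegrees has \<open>card V - 1\<close> terms of size at most two. Of the
  neighbours of \<open>h\<close> other than \<open>a\<close>, at most two neighbours of
  \<open>a\<close> and at most two apexes can reach the value two; each of the others lowers the sum
  by one, which is the refund.\<close>

lemma walks2_bound:
  assumes "h \<noteq> a"
  shows "card (walks2 E a) + dg E h \<le> 2 * card V + 3"
proof -
  define T where "T = {z \<in> nb E h - {a}. 2 \<le> card (nb E a \<inter> nb E z)}"
  have "T \<subseteq> (nb E a \<inter> nb E h) \<union> (apex \<inter> nb E h)"
  proof
    fix z assume z: "z \<in> T"
    then have "card (nb E a \<inter> nb E z) = 2" "z \<in> V" "z \<noteq> a" "(h, z) \<in> E"
      using card_common_root[of z] E_V(2)[of h z] by (auto simp: T_def)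
    then show "z \<in> (nb E a \<inter> nb E h) \<union> (apex \<inter> nb E h)" by (auto simp: apex_def out_def)
  qed
  then have "card T \<le> card ((nb E a \<inter> nb E h) \<union> (apex \<inter> nb E h))" by (rule card_mono[rotated]) simp
  also have "\<dots> \<le> 2 + 2"
    using card_Un_le[of "nb E a \<inter> nb E h" "apex \<inter> nb E h"] card_common_root[OF assms] apex_nb_card[of h] by linarith
  finally have T: "card T \<le> 4" by simp
  define S where "S = nb E h - {a} - T"
  have S: "S \<subseteq> V - {a}" using nb_V[of h] by (auto simp: S_def)
  have finT: "finite T" by (rule finite_subset[of _ "nb E h"]) (auto simp: T_def)
  have "dg E h \<le> card (S \<union> T \<union> {a})" unfolding dg_def by (rule card_mono) (auto simp: S_def finT)
  also have "\<dots> \<le> card S + card T + 1" by (intro order_trans[OF card_Un_le] add_mono) auto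
  finally have dS: "dg E h \<le> card S + 5" using T by simp
  have "card (walks2 E a) + card S = (\<Sum>z\<in>V - {a}. card (nb E a \<inter> nb E z) + (if z \<in> S then 1 else 0))"
    using S finite_V by (simp add: card_walks2 sum.distrib sum.If_cases Int_absorb1)
  also have "\<dots> \<le> (\<Sum>z\<in>V - {a}. 2)"
    using card_common_root by (intro sum_mono) (auto simp: S_def T_def)
  also have "\<dots> = 2 * (card V - 1)" using a_V finite_V by simp
  finally show ?thesis using dS card_gt_0_iff[of V] a_V finite_V by (cases "card V") auto
qed

end

context ordered_outer
begin

lemma rootedE:
  assumes "a \<in> V"
  obtains q where "rooted V E q a"
proof -
  obtain q where "ordered_outer V E q" "\<forall>v\<in>V. v \<noteq> a \<longrightarrow> q a < q v" using rotate[OF assms] by blast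
  then have "rooted V E q a" using assms by (simp add: rooted_def rooted_axioms_def)
  then show ?thesis using that by blast
qed

lemma card_common: "u \<noteq> v \<Longrightarrow> card (nb E u \<inter> nb E v) \<le> 2"
proof (cases "u \<in> V")
  case True
  assume "u \<noteq> v"
  then show ?thesis using rootedE[OF True] rooted.card_common_root by metis
next
  case False
  then have "nb E u = {}" using E_V(1) by auto
  then show ?thesis by simp
qed

text \<open>Inclusion-exclusion, with two common neighbours lost for each of the three
  pairs.\<close>

lemma sum_three_degrees:
  assumes "u \<noteq> v" "u \<noteq> w" "v \<noteq> w"
  shows "dg E u + dg E v + dg E w \<le> card V + 6"
proof -
  have c: "card (nb E x \<union> nb E y) + card (nb E x \<inter> nb E y) = dg E x + dg E y" for x y
    by (simp add: card_Un_Int[symmetric] dg_def)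
  have "card (nb E u \<union> nb E v \<union> nb E w) + card ((nb E u \<union> nb E v) \<inter> nb E w) = card (nb E u \<union> nb E v) + dg E w"
    by (simp add: card_Un_Int[symmetric] dg_def)
  moreover have "card ((nb E u \<union> nb E v) \<inter> nb E w) \<le> card (nb E u \<inter> nb E w) + card (nb E v \<inter> nb E w)"
    by (metis Int_Un_distrib2 card_Un_le)
  moreover have "card (nb E u \<union> nb E v \<union> nb E w) \<le> card V"
    by (rule card_mono[OF finite_V]) (use nb_V in auto)
  ultimately show ?thesis
    using c[of u v] card_common[OF assms(1)] card_common[OF assms(2)] card_common[OF assms(3)] by linarith
qed

lemma walks2_le:
  assumes "a \<in> V" "h \<noteq> a"
  shows "card (walks2 E a) + dg E h \<le> 2 * card V + 3"
  using rootedE[OF assms(1)] rooted.walks2_bound assms(2) by metis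

end

section \<open>Walks of length three from the root\<close>

context rooted
begin

lemma pos_eqI: "u \<in> V \<Longrightarrow> v \<in> V \<Longrightarrow> (p u < p v \<Longrightarrow> False) \<Longrightarrow> (p v < p u \<Longrightarrow> False) \<Longrightarrow> u = v"
  using p_neq' by blast

text \<open>These are the walks \<open>a\<close>, \<open>s\<close>, \<open>b\<close>,
  \<open>z\<close> that end with two vertices of \<open>out\<close>. The end \<open>z\<close> is
  listed first because it determines the walk once the sides of \<open>z\<close> on which
  \<open>s\<close> and \<open>b\<close> lie are fixed; \<open>R\<close> stands for one of these four
  patterns.\<close>

definition trips :: "(nat \<Rightarrow> nat \<Rightarrow> nat \<Rightarrow> bool) \<Rightarrow> ('a \<times> 'a \<times> 'a) set" where
  "trips R = {(z, s, b). z \<in> out \<and> b \<in> out \<and> (a, s) \<in> E \<and> (s, b) \<in> E \<and> (b, z) \<in> E \<and> R (p z) (p s) (p b)}"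

lemma out_nb_neq: "z \<in> out \<Longrightarrow> (a, s) \<in> E \<Longrightarrow> z \<noteq> s" using out_notin by blast

lemma out_nb_lt: "z \<in> out \<Longrightarrow> (a, s) \<in> E \<Longrightarrow> \<not> p z < p s \<Longrightarrow> p s < p z"
  using p_neq'[of z s] out_nb_neq out_V E_V(2) by blast

lemma trips_inj:
  assumes s: "\<And>z s b s' b'. (z, s, b) \<in> trips R \<Longrightarrow> (z, s', b') \<in> trips R \<Longrightarrow> p s < p s' \<Longrightarrow> False"
    and b: "\<And>z s b b'. (z, s, b) \<in> trips R \<Longrightarrow> (z, s, b') \<in> trips R \<Longrightarrow> p b < p b' \<Longrightarrow> False"
  shows "inj_on fst (trips R)"
proof (rule inj_onI)
  have V: "s \<in> V" "b \<in> V" if "(z, s, b) \<in> trips R" for z s b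
    using that E_V(2) out_V by (auto simp: trips_def)
  fix x y assume xy: "x \<in> trips R" "y \<in> trips R" "fst x = fst y"
  obtain z s1 b1 s2 b2 where [simp]: "x = (z, s1, b1)" "y = (z, s2, b2)"
    using xy(3) by (cases x; cases y) auto
  have "s1 = s2" using s[of z s1 b1 s2 b2] s[of z s2 b2 s1 b1] xy V by (intro pos_eqI) auto
  moreover from this have "b1 = b2" using b[of z s1 b1 b2] b[of z s1 b2 b1] xy V by (intro pos_eqI) auto
  ultimately show "x = y" by simp
qed

lemma finite_trips: "finite (trips R)"
proof (rule finite_subset)
  show "trips R \<subseteq> V \<times> V \<times> V" using out_V E_V(2) by (auto simp: trips_def)
qed (simp add: finite_V)

text \<open>Injectivity allows one walk per end, and every vertex known not to be an end improves
  the bound by one. The sets \<open>F\<close> supplied below are the source of the savings.\<close>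

lemma trips_bound:
  assumes "inj_on fst (trips R)" and F: "F \<subseteq> out" "\<And>z s b. (z, s, b) \<in> trips R \<Longrightarrow> z \<notin> F"
  shows "card (trips R) + card F \<le> card out"
proof -
  have "card (trips R) = card (fst ` trips R)" using assms(1) by (simp add: card_image)
  moreover have "fst ` trips R \<subseteq> out - F" using F(2) by (force simp: trips_def)
  then have "card (fst ` trips R) \<le> card (out - F)" using finite_out by (intro card_mono) auto
  moreover have "card (out - F) = card out - card F" "card F \<le> card out"
    using F(1) finite_out by (auto simp: card_Diff_subset finite_subset card_mono)
  ultimately show ?thesis by linarith
qed

lemma trips_at_card:
  assumes "inj_on fst (trips R)"
  shows "card {x \<in> trips R. fst x = h} \<le> 1"
  by (rule card_le_1I) (use assms in \<open>auto dest: inj_onD\<close>)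

lemma trips1_lt:
  assumes "(z, s, b) \<in> trips (\<lambda>z s b. b < z \<and> s < z)"
  shows "p s < p b"
proof -
  have f: "b \<in> out" "(a, s) \<in> E" "(b, z) \<in> E" "p s < p z"
    using assms by (auto simp: trips_def)
  show ?thesis
  proof (rule out_nb_lt[OF f(1,2)], rule notI)
    assume "p b < p s" then show False using no_cross[OF f(2,3)] p_out[OF f(1)] f(4) by blast
  qed
qed

text \<open>If \<open>s\<close> comes before \<open>s'\<close>, the walk from \<open>s\<close> over
  \<open>b\<close> to \<open>z\<close> has to pass over the wall \<open>s'\<close>; for equal
  \<open>s\<close>, two choices of \<open>b\<close> make an edge at \<open>s\<close> cross an edge
  at \<open>z\<close>. The other three patterns are analogous.\<close>

lemma trips1: "inj_on fst (trips (\<lambda>z s b. b < z \<and> s < z))"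
proof (rule trips_inj)
  fix z s b s' b'
  assume 1: "(z, s, b) \<in> trips (\<lambda>z s b. b < z \<and> s < z)" and 2: "(z, s', b') \<in> trips (\<lambda>z s b. b < z \<and> s < z)"
    and lt: "p s < p s'"
  have f: "b \<in> out" "(a, s) \<in> E" "(s, b) \<in> E" "(b, z) \<in> E" "(a, s') \<in> E" "p s' < p z"
    using 1 2 by (auto simp: trips_def)
  show False
  proof (cases "p b < p s'")
    case True
    then show False using no_cross[OF f(5,4)] p_out[OF f(1)] f(6) by blast
  next
    case False
    then have "p s' < p b" using out_nb_lt f by blast
    then show False using no_cross[OF f(5,3)] p_root[OF f(2)] lt by blast
  qed
next
  fix z s b b'
  assume 1: "(z, s, b) \<in> trips (\<lambda>z s b. b < z \<and> s < z)" and 2: "(z, s, b') \<in> trips (\<lambda>z s b. b < z \<and> s < z)"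
    and lt: "p b < p b'"
  have f: "b \<in> out" "(a, s) \<in> E" "(s, b') \<in> E" "(b, z) \<in> E" "p b' < p z" "p s < p z"
    using 1 2 by (auto simp: trips_def)
  have "p s < p b"
  proof (rule out_nb_lt[OF f(1,2)], rule notI)
    assume "p b < p s" then show False using no_cross[OF f(2,4)] p_out[OF f(1)] f(6) by blast
  qed
  then show False using no_cross[OF f(3,4)] lt f(5) by blast
qed

lemma trips2: "inj_on fst (trips (\<lambda>z s b. z < b \<and> s < z))"
proof (rule trips_inj)
  fix z s b s' b'
  assume 1: "(z, s, b) \<in> trips (\<lambda>z s b. z < b \<and> s < z)" and 2: "(z, s', b') \<in> trips (\<lambda>z s b. z < b \<and> s < z)"
    and lt: "p s < p s'"
  then have f: "(a, s) \<in> E" "(s, b) \<in> E" "(a, s') \<in> E" "p s' < p z" "p z < p b"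
    by (auto simp: trips_def)
  show False using no_cross[OF f(3,2)] p_root[OF f(1)] lt f by simp
next
  fix z s b b'
  assume 1: "(z, s, b) \<in> trips (\<lambda>z s b. z < b \<and> s < z)" and 2: "(z, s, b') \<in> trips (\<lambda>z s b. z < b \<and> s < z)"
    and lt: "p b < p b'"
  then have f: "(s, b) \<in> E" "(b', z) \<in> E" "p z < p b" "p s < p z"
    by (auto simp: trips_def)
  show False using no_cross[OF f(1) E_sym[OF f(2)]] lt f by simp
qed

lemma trips3: "inj_on fst (trips (\<lambda>z s b. b < z \<and> z < s))"
proof (rule trips_inj)
  fix z s b s' b'
  assume 1: "(z, s, b) \<in> trips (\<lambda>z s b. b < z \<and> z < s)" and 2: "(z, s', b') \<in> trips (\<lambda>z s b. b < z \<and> z < s)"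
    and lt: "p s < p s'"
  then have f: "(a, s) \<in> E" "(s', b') \<in> E" "b' \<in> out" "p b' < p z" "p z < p s"
    by (auto simp: trips_def)
  show False using no_cross[OF f(1) E_sym[OF f(2)]] p_out[OF f(3)] lt f by simp
next
  fix z s b b'
  assume 1: "(z, s, b) \<in> trips (\<lambda>z s b. b < z \<and> z < s)" and 2: "(z, s, b') \<in> trips (\<lambda>z s b. b < z \<and> z < s)"
    and lt: "p b < p b'"
  then have f: "(b, z) \<in> E" "(s, b') \<in> E" "p b' < p z" "p z < p s"
    by (auto simp: trips_def)
  show False using no_cross[OF f(1) E_sym[OF f(2)]] lt f by simp
qed

lemma trips4_lt:
  assumes "(z, s, b) \<in> trips (\<lambda>z s b. z < b \<and> z < s)"
  shows "p b < p s"
proof (rule ccontr)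
  have f: "(a, s) \<in> E" "(b, z) \<in> E" "b \<in> out" "z \<in> out" "p z < p b" "p z < p s"
    using assms by (auto simp: trips_def)
  assume "\<not> p b < p s"
  then have "p s < p b" using out_nb_lt f by blast
  then show False using no_cross[OF f(1) E_sym[OF f(2)]] p_out[OF f(4)] f by simp
qed

lemma trips4: "inj_on fst (trips (\<lambda>z s b. z < b \<and> z < s))"
proof (rule trips_inj)
  fix z s b s' b'
  assume 1: "(z, s, b) \<in> trips (\<lambda>z s b. z < b \<and> z < s)" and 2: "(z, s', b') \<in> trips (\<lambda>z s b. z < b \<and> z < s)"
    and lt: "p s < p s'"
  have f: "(a, s) \<in> E" "(s', b') \<in> E" "(b', z) \<in> E" "b' \<in> out" "z \<in> out" "p z < p s" "p z < p b'" "p b' < p s'"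
    using 1 2 trips4_lt[OF 2] by (auto simp: trips_def)
  show False
  proof (cases "p b' < p s")
    case True
    then show False using no_cross[OF f(1) E_sym[OF f(2)]] p_out[OF f(4)] lt by blast
  next
    case False
    then have "p s < p b'" using out_nb_lt f by blast
    then show False using no_cross[OF f(1) E_sym[OF f(3)]] p_out[OF f(5)] f(6) by blast
  qed
next
  fix z s b b'
  assume 1: "(z, s, b) \<in> trips (\<lambda>z s b. z < b \<and> z < s)" and 2: "(z, s, b') \<in> trips (\<lambda>z s b. z < b \<and> z < s)"
    and lt: "p b < p b'"
  then have f: "(b', z) \<in> E" "(s, b) \<in> E" "p z < p b" "p b' < p s"
    using trips4_lt[OF 2] by (auto simp: trips_def)
  show False using no_cross[OF E_sym[OF f(1)] E_sym[OF f(2)]] lt f by simp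
qed

text \<open>Take for \<open>c\<close> the first vertex of \<open>out\<close> after the left
  neighbour \<open>y\<close> of the apex. An earlier neighbour of \<open>c\<close> in
  \<open>out\<close> would lie before \<open>y\<close>, and its edge would pass over this wall. Thus
  \<open>c\<close> is no end for the two patterns with \<open>b\<close> before \<open>z\<close>. The
  last clause turns an apex not adjacent to \<open>h\<close> into a \<open>c\<close> not adjacent to
  \<open>h\<close>.\<close>

lemma apex_first:
  assumes z: "z \<in> apex"
  shows "\<exists>c\<in>out. (\<forall>b\<in>out. (b, c) \<in> E \<longrightarrow> \<not> p b < p c) \<and>
     (\<exists>y. (a, y) \<in> E \<and> (y, z) \<in> E \<and> p y < p c \<and> p c \<le> p z) \<and> (\<forall>h. (a, h) \<in> E \<and> (h, c) \<in> E \<longrightarrow> (h, z) \<in> E)"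
proof -
  obtain y y' where y: "(a, y) \<in> E" "(a, y') \<in> E" "(y, z) \<in> E" "(z, y') \<in> E" "p y < p z" "p z < p y'"
    using apexE[OF z] by metis
  have zo: "z \<in> out" using z by (simp add: apex_def)
  obtain c where c: "c \<in> out" "p y < p c" "p c \<le> p z" and min: "\<And>b. b \<in> out \<Longrightarrow> p y < p b \<Longrightarrow> p c \<le> p b"
    using ex_has_least_nat[of "\<lambda>c. c \<in> out \<and> p y < p c" z p] zo y(5) by metis
  have "\<not> p b < p c" if b: "b \<in> out" "(b, c) \<in> E" for b
  proof
    assume lt: "p b < p c"
    then have "\<not> p y < p b" using min[OF b(1)] by force
    then have "p b < p y" using p_neq'[of b y] out_nb_neq[OF b(1) y(1)] out_V[OF b(1)] E_V(2)[OF y(1)] by blast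
    then show False using no_cross[OF y(1) b(2)] p_out[OF b(1)] c(2) by blast
  qed
  moreover have "(h, z) \<in> E" if h: "(a, h) \<in> E" "(h, c) \<in> E" for h
  proof (rule ccontr)
    assume n: "(h, z) \<notin> E"
    then have ne: "h \<noteq> y" "h \<noteq> y'" "h \<noteq> z" using y E_sym out_notin[OF zo] h(1) by blast+
    have V: "h \<in> V" "y \<in> V" "y' \<in> V" "z \<in> V" using h y E_V(2) out_V[OF zo] by blast+
    consider "p h < p y" | "p y < p h" "p h < p z" | "p z < p h" "p h < p y'" | "p y' < p h"
      using p_neq'[OF V(1,2) ne(1)] p_neq'[OF V(1,3) ne(2)] p_neq'[OF V(1,4) ne(3)] by blast
    then show False
    proof cases
      case 1 then show False using no_cross[OF y(1) h(2)] p_root[OF h(1)] c(2) by blast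
    next
      case 2 then show False using no_root_nb_between[OF y(1) h(1) y(3)] by blast
    next
      case 3 then show False using no_root_nb_between'[OF h(1) y(4)] V(4) zo by (auto simp: out_def)
    next
      case 4 then show False using no_cross[OF y(2) E_sym[OF h(2)]] p_out[OF c(1)] c(3) y(6) by simp
    qed
  qed
  ultimately show ?thesis using c y by blast
qed

text \<open>The mirror image, with the last vertex of \<open>out\<close> before the right neighbour:
  it is no end for the two patterns with \<open>b\<close> after \<open>z\<close>. Together with
  \<open>apex_first\<close>, each apex removes four walks from \<open>trips\<close>.\<close>

lemma apex_last:
  assumes z: "z \<in> apex"
  shows "\<exists>c\<in>out. (\<forall>b\<in>out. (b, c) \<in> E \<longrightarrow> \<not> p c < p b) \<and>
     (\<exists>y. (a, y) \<in> E \<and> (z, y) \<in> E \<and> p c < p y \<and> p z \<le> p c) \<and> (\<forall>h. (a, h) \<in> E \<and> (h, c) \<in> E \<longrightarrow> (h, z) \<in> E)"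
proof -
  obtain y y' where y: "(a, y) \<in> E" "(a, y') \<in> E" "(y, z) \<in> E" "(z, y') \<in> E" "p y < p z" "p z < p y'"
    using apexE[OF z] by metis
  have zo: "z \<in> out" using z by (simp add: apex_def)
  obtain c where c: "c \<in> out" "p c < p y'" "p z \<le> p c" and max: "\<And>b. b \<in> out \<Longrightarrow> p b < p y' \<Longrightarrow> p b \<le> p c"
    using ex_has_greatest_nat[of "\<lambda>c. c \<in> out \<and> p c < p y'" z p "p y'"] zo y(6) by metis
  have "\<not> p c < p b" if b: "b \<in> out" "(b, c) \<in> E" for b
  proof
    assume lt: "p c < p b"
    then have "\<not> p b < p y'" using max[OF b(1)] by force
    then have "p y' < p b" using p_neq'[of b y'] out_nb_neq[OF b(1) y(2)] out_V[OF b(1)] E_V(2)[OF y(2)] by blast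
    then show False using no_cross[OF y(2) E_sym[OF b(2)]] p_out[OF c(1)] c(2) by blast
  qed
  moreover have "(h, z) \<in> E" if h: "(a, h) \<in> E" "(h, c) \<in> E" for h
  proof (rule ccontr)
    assume n: "(h, z) \<notin> E"
    then have ne: "h \<noteq> y" "h \<noteq> y'" "h \<noteq> z" using y E_sym out_notin[OF zo] h(1) by blast+
    have V: "h \<in> V" "y \<in> V" "y' \<in> V" "z \<in> V" using h y E_V(2) out_V[OF zo] by blast+
    consider "p h < p y" | "p y < p h" "p h < p z" | "p z < p h" "p h < p y'" | "p y' < p h"
      using p_neq'[OF V(1,2) ne(1)] p_neq'[OF V(1,3) ne(2)] p_neq'[OF V(1,4) ne(3)] by blast
    then show False
    proof cases
      case 1 then show False using no_cross[OF y(1) h(2)] p_root[OF h(1)] c(3) y(5) by simp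
    next
      case 2 then show False using no_root_nb_between[OF y(1) h(1) y(3)] by blast
    next
      case 3 then show False using no_root_nb_between'[OF h(1) y(4)] V(4) zo by (auto simp: out_def)
    next
      case 4 then show False using no_cross[OF y(2) E_sym[OF h(2)]] p_out[OF c(1)] c(2) by blast
    qed
  qed
  ultimately show ?thesis using c y by blast
qed

text \<open>Distinct apexes have separated intervals, so the vertices chosen in them are distinct
  and none of the savings is counted twice.\<close>

lemma apex_firsts:
  assumes "X \<subseteq> apex"
  obtains C where "C \<subseteq> out" "card C = card X" "\<And>c b. c \<in> C \<Longrightarrow> b \<in> out \<Longrightarrow> (b, c) \<in> E \<Longrightarrow> \<not> p b < p c"
    "\<And>h c. (a, h) \<in> E \<Longrightarrow> nb E h \<inter> X = {} \<Longrightarrow> c \<in> C \<Longrightarrow> (h, c) \<notin> E"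
proof -
  have "\<forall>z\<in>X. \<exists>c. c \<in> out \<and> (\<forall>b\<in>out. (b, c) \<in> E \<longrightarrow> \<not> p b < p c) \<and>
     (\<exists>y. (a, y) \<in> E \<and> (y, z) \<in> E \<and> p y < p c \<and> p c \<le> p z) \<and> (\<forall>h. (a, h) \<in> E \<and> (h, c) \<in> E \<longrightarrow> (h, z) \<in> E)"
    using apex_first assms by (meson subsetD)
  then obtain f where f: "\<And>z. z \<in> X \<Longrightarrow> f z \<in> out \<and> (\<forall>b\<in>out. (b, f z) \<in> E \<longrightarrow> \<not> p b < p (f z)) \<and>
     (\<exists>y. (a, y) \<in> E \<and> (y, z) \<in> E \<and> p y < p (f z) \<and> p (f z) \<le> p z) \<and> (\<forall>h. (a, h) \<in> E \<and> (h, f z) \<in> E \<longrightarrow> (h, z) \<in> E)"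
    by metis
  have "p (f z1) < p (f z2)" if z: "z1 \<in> X" "z2 \<in> X" "p z1 < p z2" for z1 z2
  proof -
    have zo: "z1 \<in> out" "z2 \<in> out" "z1 \<in> apex" using z assms by (auto simp: apex_def)
    obtain y1 where 1: "(a, y1) \<in> E" "(z1, y1) \<in> E" "p z1 < p y1" using apexE[OF zo(3)] by metis
    obtain y2 where 2: "(a, y2) \<in> E" "(y2, z2) \<in> E" "p y2 < p (f z2)" "p (f z2) \<le> p z2" using f[OF z(2)] by blast
    have "p y1 \<le> p y2" using apex_separated[OF z(3) zo(1,2) 1 2(1,2)] 2 by simp
    then show ?thesis using 1 2 f[OF z(1)] by fastforce
  qed
  then have "inj_on f X"
    using assms apex_V p_neq' by (intro inj_onI) (metis less_irrefl subsetD)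
  then have "card (f ` X) = card X" by (rule card_image)
  then show ?thesis using that[of "f ` X"] f by (auto simp: disjoint_iff)
qed

lemma apex_lasts:
  assumes "X \<subseteq> apex"
  obtains C where "C \<subseteq> out" "card C = card X" "\<And>c b. c \<in> C \<Longrightarrow> b \<in> out \<Longrightarrow> (b, c) \<in> E \<Longrightarrow> \<not> p c < p b"
    "\<And>h c. (a, h) \<in> E \<Longrightarrow> nb E h \<inter> X = {} \<Longrightarrow> c \<in> C \<Longrightarrow> (h, c) \<notin> E"
proof -
  have "\<forall>z\<in>X. \<exists>c. c \<in> out \<and> (\<forall>b\<in>out. (b, c) \<in> E \<longrightarrow> \<not> p c < p b) \<and>
     (\<exists>y. (a, y) \<in> E \<and> (z, y) \<in> E \<and> p c < p y \<and> p z \<le> p c) \<and> (\<forall>h. (a, h) \<in> E \<and> (h, c) \<in> E \<longrightarrow> (h, z) \<in> E)"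
    using apex_last assms by (meson subsetD)
  then obtain f where f: "\<And>z. z \<in> X \<Longrightarrow> f z \<in> out \<and> (\<forall>b\<in>out. (b, f z) \<in> E \<longrightarrow> \<not> p (f z) < p b) \<and>
     (\<exists>y. (a, y) \<in> E \<and> (z, y) \<in> E \<and> p (f z) < p y \<and> p z \<le> p (f z)) \<and> (\<forall>h. (a, h) \<in> E \<and> (h, f z) \<in> E \<longrightarrow> (h, z) \<in> E)"
    by metis
  have "p (f z1) < p (f z2)" if z: "z1 \<in> X" "z2 \<in> X" "p z1 < p z2" for z1 z2
  proof -
    have zo: "z1 \<in> out" "z2 \<in> out" "z2 \<in> apex" using z assms by (auto simp: apex_def)
    obtain y2 where 2: "(a, y2) \<in> E" "(y2, z2) \<in> E" "p y2 < p z2" using apexE[OF zo(3)] by metis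
    obtain y1 where 1: "(a, y1) \<in> E" "(z1, y1) \<in> E" "p (f z1) < p y1" "p z1 \<le> p (f z1)" using f[OF z(1)] by blast
    have "p y1 \<le> p y2" using apex_separated[OF z(3) zo(1,2) 1(1,2) _ 2] 1 by simp
    then show ?thesis using 1 2 f[OF z(2)] by fastforce
  qed
  then have "inj_on f X"
    using assms apex_V p_neq' by (intro inj_onI) (metis less_irrefl subsetD)
  then have "card (f ` X) = card X" by (rule card_image)
  then show ?thesis using that[of "f ` X"] f by (auto simp: disjoint_iff)
qed

lemma card_trips_split:
  "card (trips (\<lambda>_ _ _. True)) \<le> card (trips (\<lambda>z s b. b < z \<and> s < z)) + card (trips (\<lambda>z s b. z < b \<and> s < z))
    + card (trips (\<lambda>z s b. b < z \<and> z < s)) + card (trips (\<lambda>z s b. z < b \<and> z < s))"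
    (is "_ \<le> card ?A + card ?B + card ?C + card ?D")
proof -
  have "trips (\<lambda>_ _ _. True) \<subseteq> ?A \<union> ?B \<union> ?C \<union> ?D"
  proof
    fix x assume x: "x \<in> trips (\<lambda>_ _ _. True)"
    then obtain z s b where [simp]: "x = (z, s, b)" and zsb: "z \<in> out" "b \<in> out" "(a, s) \<in> E" "(s, b) \<in> E" "(b, z) \<in> E"
      by (auto simp: trips_def)
    have "p s < p z \<or> p z < p s" "p b < p z \<or> p z < p b"
      using out_nb_lt[OF zsb(1,3)] p_lt[OF zsb(5)] by blast+
    then show "x \<in> ?A \<union> ?B \<union> ?C \<union> ?D" using zsb by (auto simp: trips_def)
  qed
  then have "card (trips (\<lambda>_ _ _. True)) \<le> card (?A \<union> ?B \<union> ?C \<union> ?D)"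
    by (rule card_mono[rotated]) (simp add: finite_trips)
  also have "\<dots> \<le> card ?A + card ?B + card ?C + card ?D"
    by (intro order_trans[OF card_Un_le] add_mono order_refl)
  finally show ?thesis .
qed

lemma V_split: "V - {a} = nb E a \<union> out" "nb E a \<inter> out = {}"
  using nb_V[of a] E_irrefl[of a] by (auto simp: out_def)

lemma card_V: "card V = 1 + dg E a + card out"
proof -
  have "card (V - {a}) = dg E a + card out"
    using V_split finite_out by (simp add: card_Un_disjoint dg_def)
  moreover have "card V = Suc (card (V - {a}))" by (rule card.remove[OF finite_V a_V])
  ultimately show ?thesis by simp
qed

definition touched :: "'a set" where "touched = {z \<in> out. nb E a \<inter> nb E z \<noteq> {}}"

lemma sum_out_le: "(\<Sum>z\<in>out. card (nb E a \<inter> nb E z)) \<le> card touched + card apex"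
proof -
  have "(\<Sum>z\<in>out. card (nb E a \<inter> nb E z)) \<le> (\<Sum>z\<in>out. (if z \<in> touched then 1 else 0) + (if z \<in> apex then 1 else 0))"
  proof (rule sum_mono)
    fix z assume z: "z \<in> out"
    then have "card (nb E a \<inter> nb E z) \<le> 2" using card_common_root[of z] by (auto simp: out_def)
    then have "card (nb E a \<inter> nb E z) = 0 \<or> card (nb E a \<inter> nb E z) = 1 \<or> card (nb E a \<inter> nb E z) = 2" by linarith
    then show "card (nb E a \<inter> nb E z) \<le> (if z \<in> touched then 1 else 0) + (if z \<in> apex then 1 else 0)"
      using z by (auto simp: touched_def apex_def)
  qed
  also have "\<dots> = card touched + card apex"
    using finite_out by (simp add: sum.distrib sum.If_cases touched_def apex_def Int_def cong: conj_cong)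
  finally show ?thesis .
qed

lemma walks2_sum: "card (walks2 E a) \<le> 2 * dg E a + (\<Sum>z\<in>out. card (nb E a \<inter> nb E z))"
proof -
  have "card (walks2 E a) = (\<Sum>z\<in>nb E a. card (nb E a \<inter> nb E z)) + (\<Sum>z\<in>out. card (nb E a \<inter> nb E z))"
    unfolding card_walks2 V_split(1) using V_split(2) finite_out by (simp add: sum.union_disjoint)
  also have "(\<Sum>z\<in>nb E a. card (nb E a \<inter> nb E z)) \<le> (\<Sum>z\<in>nb E a. 2)"
    by (intro sum_mono card_common_root) (use E_irrefl[of a] in auto)
  finally show ?thesis by (simp add: dg_def)
qed

text \<open>The walks \<open>a\<close>, \<open>y\<close>, \<open>b\<close>, \<open>z\<close> are
  sorted by whether \<open>b\<close> and \<open>z\<close> are neighbours of \<open>a\<close>. If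
  \<open>z\<close> is one, then \<open>y\<close> and \<open>z\<close> are two different common
  neighbours of \<open>a\<close> and \<open>b\<close>, so a \<open>b\<close> in \<open>out\<close>
  contributes only when it is an apex. If both are in \<open>out\<close>, the walk is one of
  \<open>trips\<close>.\<close>

lemma walks3_sum:
  "card (walks3 E a) \<le> 2 * dg E a + 2 * (\<Sum>z\<in>out. card (nb E a \<inter> nb E z)) + 2 * card apex
     + card (trips (\<lambda>_ _ _. True))"
proof -
  let ?off = "\<lambda>b. {(y, z). y \<in> nb E a \<inter> nb E b \<and> z \<in> nb E a \<inter> nb E b \<and> y \<noteq> z}"
  let ?A = "SIGMA b : nb E a. ?off b" and ?C = "SIGMA b : out. ?off b"
  let ?B = "SIGMA x : (SIGMA z : out. nb E a \<inter> nb E z). nb E a \<inter> nb E (snd x)"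
  let ?f = "\<lambda>(b, (y, z)). (y, b, z)" and ?g = "\<lambda>((z, b), y). (y, b, z)" and ?k = "\<lambda>(z, s, b). (s, b, z)"
  let ?T = "trips (\<lambda>_ _ _. True)"
  have off_fin: "finite (?off b)" for b by (rule finite_subset[of _ "nb E a \<times> nb E a"]) auto
  have off: "card (?off b) \<le> (if card (nb E a \<inter> nb E b) = 2 then 2 else 0)" if "b \<noteq> a" for b
    using card_offdiag_le[of "nb E a \<inter> nb E b"] card_common_root[OF that] by simp
  have "walks3 E a \<subseteq> ?f ` ?A \<union> ?g ` ?B \<union> ?f ` ?C \<union> ?k ` ?T"
  proof
    fix x assume "x \<in> walks3 E a"
    then obtain y b z where [simp]: "x = (y, b, z)" and e: "(a, y) \<in> E" "(y, b) \<in> E" "(b, z) \<in> E"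
      and ne: "b \<noteq> a" "z \<noteq> a" "z \<noteq> y" by (auto simp: walks3_def)
    have V: "b \<in> nb E a \<union> out" "z \<in> nb E a \<union> out" using E_V(2)[OF e(2)] E_V(2)[OF e(3)] ne V_split(1) by blast+
    consider "b \<in> nb E a" "z \<in> nb E a" | "b \<in> nb E a" "z \<in> out" | "b \<in> out" "z \<in> nb E a" | "b \<in> out" "z \<in> out"
      using V by blast
    then show "x \<in> ?f ` ?A \<union> ?g ` ?B \<union> ?f ` ?C \<union> ?k ` ?T"
    proof cases
      case 1
      then have "(b, (y, z)) \<in> ?A" using e ne E_sym by auto
      then have "x \<in> ?f ` ?A" by force
      then show ?thesis by blast
    next
      case 2
      then have "((z, b), y) \<in> ?B" using e ne E_sym by auto
      then have "x \<in> ?g ` ?B" by force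
      then show ?thesis by blast
    next
      case 3
      then have "(b, (y, z)) \<in> ?C" using e ne E_sym by auto
      then have "x \<in> ?f ` ?C" by force
      then show ?thesis by blast
    next
      case 4
      then have "(z, y, b) \<in> ?T" using e by (auto simp: trips_def)
      then have "x \<in> ?k ` ?T" by force
      then show ?thesis by blast
    qed
  qed
  moreover have fin: "finite ?A" "finite ?B" "finite ?C" "finite ?T"
    using off_fin finite_out finite_trips by auto
  ultimately have "card (walks3 E a) \<le> card (?f ` ?A \<union> ?g ` ?B \<union> ?f ` ?C \<union> ?k ` ?T)"
    by (intro card_mono) auto
  also have "\<dots> \<le> card (?f ` ?A) + card (?g ` ?B) + card (?f ` ?C) + card (?k ` ?T)"
    by (intro order_trans[OF card_Un_le] add_mono order_refl)
  also have "\<dots> \<le> card ?A + card ?B + card ?C + card ?T"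
    by (intro add_mono card_image_le fin)
  also have "card ?A \<le> dg E a * 2"
  proof (rule card_Sigma_le)
    show "card (?off b) \<le> 2" if "b \<in> nb E a" for b
    proof -
      have "b \<noteq> a" using that E_irrefl[of a] by auto
      then show ?thesis using order_trans[OF off[of b], of 2] by simp
    qed
  qed (use off_fin in \<open>auto simp: dg_def\<close>)
  also have "card ?B \<le> (\<Sum>z\<in>out. card (nb E a \<inter> nb E z)) * 2"
  proof (rule card_Sigma_le)
    show "card (nb E a \<inter> nb E (snd x)) \<le> 2" if "x \<in> (SIGMA z : out. nb E a \<inter> nb E z)" for x
      by (rule card_common_root) (use that E_irrefl[of a] in auto)
  qed (use finite_out in \<open>auto simp: card_SigmaI\<close>)
  also have "card ?C = (\<Sum>b\<in>out. card (?off b))" using finite_out off_fin by (simp add: card_SigmaI)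
  also have "\<dots> \<le> (\<Sum>b\<in>out. if b \<in> apex then 2 else 0)"
  proof (rule sum_mono)
    fix b assume b: "b \<in> out"
    then have "b \<noteq> a" by (auto simp: out_def)
    have eq: "b \<in> apex \<longleftrightarrow> card (nb E a \<inter> nb E b) = 2" using b by (simp add: apex_def)
    show "card (?off b) \<le> (if b \<in> apex then 2 else 0)" unfolding eq by (rule off[OF \<open>b \<noteq> a\<close>])
  qed
  also have "\<dots> = 2 * card apex"
    using finite_out by (simp add: sum.If_cases apex_def Int_def cong: conj_cong)
  finally show ?thesis by simp
qed

text \<open>The sums give 6 deg a + 4 |touched| + 6 |apex| + |trips|, and the four walks saved per
  apex reduce this to 6 deg a + 4 |touched| + 2 |apex| + 4 |out|, at most 8n as |apex| <= deg a. The
  refund comes from \<open>touched\<close>: a touched neighbour of \<open>h\<close> yields a walk in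
  \<open>trips\<close> that ends in \<open>h\<close>, so all but boundedly many neighbours of
  \<open>h\<close> are untouched.\<close>

lemma walks3_bound_out:
  assumes h: "h \<in> out"
  shows "card (walks3 E a) + 2 * card (walks2 E a) + 2 * dg E h \<le> 8 * card V + 24"
proof -
  let ?T = "trips (\<lambda>_ _ _. True)"
  obtain C where C: "C \<subseteq> out" "card C = card apex" "\<And>c b. c \<in> C \<Longrightarrow> b \<in> out \<Longrightarrow> (b, c) \<in> E \<Longrightarrow> \<not> p b < p c"
    using apex_firsts[OF subset_refl] by metis
  obtain D where D: "D \<subseteq> out" "card D = card apex" "\<And>c b. c \<in> D \<Longrightarrow> b \<in> out \<Longrightarrow> (b, c) \<in> E \<Longrightarrow> \<not> p c < p b"
    using apex_lasts[OF subset_refl] by metis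
  have "card (trips (\<lambda>z s b. b < z \<and> s < z)) + card C \<le> card out"
    by (rule trips_bound[OF trips1 C(1)]) (use C(3) in \<open>auto simp: trips_def\<close>)
  moreover have "card (trips (\<lambda>z s b. z < b \<and> s < z)) + card D \<le> card out"
    by (rule trips_bound[OF trips2 D(1)]) (use D(3) in \<open>auto simp: trips_def\<close>)
  moreover have "card (trips (\<lambda>z s b. b < z \<and> z < s)) + card C \<le> card out"
    by (rule trips_bound[OF trips3 C(1)]) (use C(3) in \<open>auto simp: trips_def\<close>)
  moreover have "card (trips (\<lambda>z s b. z < b \<and> z < s)) + card D \<le> card out"
    by (rule trips_bound[OF trips4 D(1)]) (use D(3) in \<open>auto simp: trips_def\<close>)
  ultimately have T: "card ?T + 4 * card apex \<le> 4 * card out"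
    using card_trips_split C(2) D(2) by linarith
  let ?at = "\<lambda>R. {x \<in> trips R. fst x = h}"
  let ?A = "?at (\<lambda>z s b. b < z \<and> s < z)" and ?B = "?at (\<lambda>z s b. z < b \<and> s < z)"
    and ?C = "?at (\<lambda>z s b. b < z \<and> z < s)" and ?D = "?at (\<lambda>z s b. z < b \<and> z < s)"
  have "nb E h \<inter> touched \<subseteq> (snd \<circ> snd) ` (?A \<union> ?B \<union> ?C \<union> ?D)"
  proof
    fix z assume z: "z \<in> nb E h \<inter> touched"
    then obtain s where "(a, s) \<in> E" "(z, s) \<in> E" "z \<in> out" "(h, z) \<in> E"
      by (auto simp: touched_def)
    then have s: "(a, s) \<in> E" "(s, z) \<in> E" "z \<in> out" "(z, h) \<in> E" using E_sym by blast+
    have "p s < p h \<or> p h < p s" "p z < p h \<or> p h < p z"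
      using out_nb_lt[OF h s(1)] p_lt[OF s(4)] by blast+
    then have "(h, s, z) \<in> ?A \<union> ?B \<union> ?C \<union> ?D" using s h by (auto simp: trips_def)
    then show "z \<in> (snd \<circ> snd) ` (?A \<union> ?B \<union> ?C \<union> ?D)" by force
  qed
  then have "card (nb E h \<inter> touched) \<le> card (?A \<union> ?B \<union> ?C \<union> ?D)"
    by (rule surj_card_le[rotated]) (simp add: finite_trips)
  also have "\<dots> \<le> card ?A + card ?B + card ?C + card ?D"
    by (intro order_trans[OF card_Un_le] add_mono order_refl)
  also have "\<dots> \<le> 1 + 1 + 1 + 1"
    by (intro add_mono trips_at_card trips1 trips2 trips3 trips4)
  finally have c1: "card (nb E h \<inter> touched) \<le> 4" by simp
  have ha: "h \<noteq> a" "(h, a) \<notin> E" using h E_sym by (auto simp: out_def)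
  have c2: "card (nb E a \<inter> nb E h) \<le> 2" by (rule card_common_root[OF ha(1)])
  have "nb E h \<subseteq> (nb E h \<inter> touched) \<union> (nb E a \<inter> nb E h) \<union> (out - touched)"
  proof
    fix z assume z: "z \<in> nb E h"
    then have "z \<in> V - {a}" using nb_V[of h] ha by auto
    then show "z \<in> (nb E h \<inter> touched) \<union> (nb E a \<inter> nb E h) \<union> (out - touched)" using z V_split(1) by blast
  qed
  then have "dg E h \<le> card ((nb E h \<inter> touched) \<union> (nb E a \<inter> nb E h) \<union> (out - touched))"
    unfolding dg_def by (rule card_mono[rotated]) (simp add: finite_out)
  also have "\<dots> \<le> card (nb E h \<inter> touched) + card (nb E a \<inter> nb E h) + card (out - touched)"
    by (intro order_trans[OF card_Un_le] add_mono order_refl)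
  also have "card (out - touched) = card out - card touched"
    by (rule card_Diff_subset) (auto simp: touched_def finite_out intro: finite_subset[OF _ finite_out])
  finally have dh: "dg E h \<le> 6 + (card out - card touched)" using c1 c2 by linarith
  have "card touched \<le> card out" by (rule card_mono[OF finite_out]) (auto simp: touched_def)
  then show ?thesis
    using walks3_sum walks2_sum sum_out_le T dh apex_card card_V by linarith
qed

text \<open>For a neighbour \<open>h\<close> of \<open>a\<close> the refund comes from
  \<open>trips\<close>: each neighbour of \<open>h\<close> in \<open>out\<close> is excluded as an
  end for two of the four patterns, up to three exceptions on either side of \<open>h\<close>.
  Apexes adjacent to \<open>h\<close>, at most two, are left out so that this saving and the one
  from the apexes concern disjoint sets.\<close>

lemma walks3_bound_nb:
  assumes h: "(a, h) \<in> E"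
  shows "card (walks3 E a) + 2 * card (walks2 E a) + 2 * dg E h \<le> 8 * card V + 24"
proof -
  let ?T = "trips (\<lambda>_ _ _. True)"
  have ha: "h \<noteq> a" using h E_irrefl by blast
  define X where "X = apex - nb E h"
  have X: "X \<subseteq> apex" "nb E h \<inter> X = {}" by (auto simp: X_def)
  have "finite apex" using finite_out by (auto simp: apex_def intro: finite_subset[OF _ finite_out])
  then have cX: "card apex \<le> card X + 2"
    using apex_nb_card[of h] card_Un_le[of X "apex \<inter> nb E h"] by (simp add: X_def Un_Diff_Int)
  obtain C where C: "C \<subseteq> out" "card C = card X" "\<And>c b. c \<in> C \<Longrightarrow> b \<in> out \<Longrightarrow> (b, c) \<in> E \<Longrightarrow> \<not> p b < p c"
    "\<And>c. c \<in> C \<Longrightarrow> (h, c) \<notin> E"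
    using apex_firsts[OF X(1)] h X(2) by metis
  obtain D where D: "D \<subseteq> out" "card D = card X" "\<And>c b. c \<in> D \<Longrightarrow> b \<in> out \<Longrightarrow> (b, c) \<in> E \<Longrightarrow> \<not> p c < p b"
    "\<And>c. c \<in> D \<Longrightarrow> (h, c) \<notin> E"
    using apex_lasts[OF X(1)] h X(2) by metis
  define Zp Zm where "Zp = {z \<in> nb E h \<inter> out. p h < p z}" and "Zm = {z \<in> nb E h \<inter> out. p z < p h}"
  define Wp Wm where "Wp = Zp \<inter> fst ` trips (\<lambda>z s b. z < b \<and> z < s)"
    and "Wm = Zm \<inter> fst ` trips (\<lambda>z s b. b < z \<and> s < z)"
  have fin: "finite Zp" "finite Zm" "finite C" "finite D"
    using finite_out C(1) D(1) by (auto simp: Zp_def Zm_def intro: finite_subset)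
  \<comment> \<open>For an exceptional \<open>z\<close> other than \<open>zm\<close>, the farthest
    neighbour of \<open>h\<close> in \<open>out\<close> after \<open>h\<close>, the vertex
    \<open>b\<close> has to be \<open>zm\<close> itself: on either side of \<open>zm\<close> the
    walk would cross the edge from \<open>h\<close> to \<open>zm\<close> or pass over a wall. So
    \<open>z\<close> is a common neighbour of \<open>h\<close> and \<open>zm\<close>.\<close>
  have Wp: "card Wp \<le> 3"
  proof (cases "Zp = {}")
    case True then show ?thesis by (simp add: Wp_def)
  next
    case False
    obtain zm where zm: "zm \<in> Zp" "\<And>z. z \<in> Zp \<Longrightarrow> p z \<le> p zm"
      using ex_has_greatest_nat[of "\<lambda>z. z \<in> Zp" _ p "Suc (Max (p ` Zp))"] False fin by (metis Max_ge all_not_in_conv finite_imageI imageI le_imp_less_Suc)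
    have zmf: "(h, zm) \<in> E" "zm \<in> out" "p h < p zm" using zm(1) by (auto simp: Zp_def)
    have "Wp \<subseteq> {zm} \<union> (nb E h \<inter> nb E zm)"
    proof
      fix z assume z: "z \<in> Wp"
      then obtain s b where t: "(z, s, b) \<in> trips (\<lambda>z s b. z < b \<and> z < s)" by (auto simp: Wp_def)
      have f: "(a, s) \<in> E" "(s, b) \<in> E" "(b, z) \<in> E" "z \<in> out" "b \<in> out" "p z < p b" "p z < p s"
        using t by (auto simp: trips_def)
      have bs: "p b < p s" by (rule trips4_lt[OF t])
      have zf: "(h, z) \<in> E" "p h < p z" "p z \<le> p zm" using z zm by (auto simp: Wp_def Zp_def)
      show "z \<in> {zm} \<union> (nb E h \<inter> nb E zm)"
      proof (cases "z = zm")
        case False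
        then have lt: "p z < p zm" using zf(3) p_eq[of z zm] out_V f(4) zmf(2) by fastforce
        have "b = zm"
        proof (rule pos_eqI)
          assume c: "p b < p zm"
          show False
          proof (cases "p zm < p s")
            case True
            then show False using no_cross[OF zmf(1) E_sym[OF f(2)]] c zf(2) f(6) by simp
          next
            case False
            then have "p s < p zm" using out_nb_lt[OF zmf(2) f(1)] by blast
            then show False using no_root_nb_between[OF h f(1) zmf(1)] zf(2) f(7) by simp
          qed
        next
          assume "p zm < p b"
          then show False using no_cross[OF zmf(1) E_sym[OF f(3)]] lt zf(2) by blast
        qed (use out_V f(5) zmf(2) in auto)
        then show ?thesis using zf(1) f(3) by auto
      qed simp
    qed
    then have "card Wp \<le> card ({zm} \<union> (nb E h \<inter> nb E zm))" by (rule card_mono[rotated]) simp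
    also have "\<dots> \<le> card {zm} + card (nb E h \<inter> nb E zm)" by (rule card_Un_le)
    also have "card (nb E h \<inter> nb E zm) \<le> 2" by (rule card_common) (use zmf E_irrefl in blast)
    finally show ?thesis by simp
  qed
  have Wm: "card Wm \<le> 3"
  proof (cases "Zm = {}")
    case True then show ?thesis by (simp add: Wm_def)
  next
    case False
    obtain zm where zm: "zm \<in> Zm" "\<And>z. z \<in> Zm \<Longrightarrow> p zm \<le> p z"
      using ex_has_least_nat[of "\<lambda>z. z \<in> Zm" _ p] False by (metis all_not_in_conv)
    have zmf: "(h, zm) \<in> E" "zm \<in> out" "p zm < p h" using zm(1) by (auto simp: Zm_def)
    have "Wm \<subseteq> {zm} \<union> (nb E h \<inter> nb E zm)"
    proof
      fix z assume z: "z \<in> Wm"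
      then obtain s b where t: "(z, s, b) \<in> trips (\<lambda>z s b. b < z \<and> s < z)" by (auto simp: Wm_def)
      have f: "(a, s) \<in> E" "(s, b) \<in> E" "(b, z) \<in> E" "z \<in> out" "b \<in> out" "p b < p z" "p s < p z"
        using t by (auto simp: trips_def)
      have bs: "p s < p b" by (rule trips1_lt[OF t])
      have zf: "(h, z) \<in> E" "p z < p h" "p zm \<le> p z" using z zm by (auto simp: Wm_def Zm_def)
      show "z \<in> {zm} \<union> (nb E h \<inter> nb E zm)"
      proof (cases "z = zm")
        case False
        then have lt: "p zm < p z" using zf(3) p_eq[of z zm] out_V f(4) zmf(2) by fastforce
        have "b = zm"
        proof (rule pos_eqI)
          assume c: "p zm < p b"
          show False
          proof (cases "p zm < p s")
            case True
            then show False using no_cross[OF f(1) E_sym[OF zmf(1)]] p_out[OF zmf(2)] f(7) zf(2) by simp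
          next
            case False
            then have "p s < p zm" using out_nb_lt[OF zmf(2) f(1)] by blast
            then show False using no_cross[OF f(2) E_sym[OF zmf(1)]] c f(6) zf(2) by simp
          qed
        next
          assume "p b < p zm"
          then show False using no_cross[OF f(3) E_sym[OF zmf(1)]] lt zf(2) by blast
        qed (use out_V f(5) zmf(2) in auto)
        then show ?thesis using zf(1) f(3) by auto
      qed simp
    qed
    then have "card Wm \<le> card ({zm} \<union> (nb E h \<inter> nb E zm))" by (rule card_mono[rotated]) simp
    also have "\<dots> \<le> card {zm} + card (nb E h \<inter> nb E zm)" by (rule card_Un_le)
    also have "card (nb E h \<inter> nb E zm) \<le> 2" by (rule card_common) (use zmf E_irrefl in blast)
    finally show ?thesis by simp
  qed
  have Z3: "z \<notin> Zp" if t: "(z, s, b) \<in> trips (\<lambda>z s b. b < z \<and> z < s)" for z s b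
  proof
    assume z: "z \<in> Zp"
    have f: "(a, s) \<in> E" "(s, b) \<in> E" "(b, z) \<in> E" "b \<in> out" "p b < p z" "p z < p s" "(h, z) \<in> E" "p h < p z"
      using t z by (auto simp: trips_def Zp_def)
    show False
    proof (cases "p b < p h")
      case True then show False using no_cross[OF h f(3)] p_out[OF f(4)] f(8) by blast
    next
      case False
      then have "p h < p b" using out_nb_lt[OF f(4) h] by blast
      then show False using no_cross[OF f(7) E_sym[OF f(2)]] f(5,6) by blast
    qed
  qed
  have Z2: "z \<notin> Zm" if t: "(z, s, b) \<in> trips (\<lambda>z s b. z < b \<and> s < z)" for z s b
  proof
    assume z: "z \<in> Zm"
    have f: "(a, s) \<in> E" "(s, b) \<in> E" "(b, z) \<in> E" "b \<in> out" "p z < p b" "p s < p z" "(h, z) \<in> E" "p z < p h" "z \<in> out"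
      using t z by (auto simp: trips_def Zm_def)
    show False
    proof (cases "p b < p h")
      case True then show False using no_cross[OF f(2) E_sym[OF f(7)]] f(5,6) by blast
    next
      case False
      then have "p h < p b" using out_nb_lt[OF f(4) h] by blast
      then show False using no_cross[OF h E_sym[OF f(3)]] p_out[OF f(9)] f(8) by blast
    qed
  qed
  have Zout: "Zp \<subseteq> out" "Zm \<subseteq> out" by (auto simp: Zp_def Zm_def)
  have disj: "C \<inter> Zp = {}" "C \<inter> Zm = {}" "D \<inter> Zp = {}" "D \<inter> Zm = {}"
    using C(4) D(4) by (auto simp: Zp_def Zm_def)
  have "card (trips (\<lambda>z s b. b < z \<and> s < z)) + card (C \<union> (Zm - Wm)) \<le> card out"
    by (rule trips_bound[OF trips1]) (use C Zout in \<open>auto simp: trips_def Wm_def image_iff\<close>)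
  moreover have "card (trips (\<lambda>z s b. z < b \<and> s < z)) + card (D \<union> Zm) \<le> card out"
    by (rule trips_bound[OF trips2]) (use D Zout Z2 in \<open>auto simp: trips_def\<close>)
  moreover have "card (trips (\<lambda>z s b. b < z \<and> z < s)) + card (C \<union> Zp) \<le> card out"
    by (rule trips_bound[OF trips3]) (use C Zout Z3 in \<open>auto simp: trips_def\<close>)
  moreover have "card (trips (\<lambda>z s b. z < b \<and> z < s)) + card (D \<union> (Zp - Wp)) \<le> card out"
    by (rule trips_bound[OF trips4]) (use D Zout in \<open>auto simp: trips_def Wp_def image_iff\<close>)
  moreover have "card (C \<union> Zp) = card C + card Zp" "card (D \<union> Zm) = card D + card Zm"
    using disj fin by (auto simp: card_Un_disjoint)
  moreover have "card (C \<union> (Zm - Wm)) = card C + card (Zm - Wm)" "card (D \<union> (Zp - Wp)) = card D + card (Zp - Wp)"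
    using disj fin by (auto intro!: card_Un_disjoint)
  moreover have "card Zm \<le> card (Zm - Wm) + card Wm" "card Zp \<le> card (Zp - Wp) + card Wp"
    using card_Un_le[of "Zm - Wm" Wm] card_Un_le[of "Zp - Wp" Wp] card_mono[of "(Zm - Wm) \<union> Wm" Zm]
      card_mono[of "(Zp - Wp) \<union> Wp" Zp] fin by (auto simp: Wm_def Wp_def)
  ultimately have T: "card ?T + 4 * card X + 2 * card Zp + 2 * card Zm \<le> 4 * card out + 6"
    using card_trips_split C(2) D(2) Wp Wm by linarith
  have "nb E h \<subseteq> {a} \<union> (nb E a \<inter> nb E h) \<union> Zp \<union> Zm"
  proof
    fix z assume z: "z \<in> nb E h"
    then have "z = a \<or> z \<in> nb E a \<or> z \<in> out" using nb_V[of h] V_split(1) by blast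
    then show "z \<in> {a} \<union> (nb E a \<inter> nb E h) \<union> Zp \<union> Zm"
      using z p_lt[of h z] by (auto simp: Zp_def Zm_def)
  qed
  then have "dg E h \<le> card ({a} \<union> (nb E a \<inter> nb E h) \<union> Zp \<union> Zm)"
    unfolding dg_def by (rule card_mono[rotated]) (simp add: fin)
  also have "\<dots> \<le> card {a} + card (nb E a \<inter> nb E h) + card Zp + card Zm"
    by (intro order_trans[OF card_Un_le] add_mono order_refl)
  finally have dh: "dg E h \<le> 3 + card Zp + card Zm" using card_common_root[OF ha] by simp
  have "card touched \<le> card out" by (rule card_mono[OF finite_out]) (auto simp: touched_def)
  then show ?thesis
    using walks3_sum walks2_sum sum_out_le T dh cX apex_card card_V by linarith
qed

end

lemma (in ordered_outer) walks3_le: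
  assumes "a \<in> V" "h \<in> V" "h \<noteq> a"
  shows "card (walks3 E a) + 2 * card (walks2 E a) + 2 * dg E h \<le> 8 * card V + 24"
proof -
  obtain q where "rooted V E q a" using rootedE[OF assms(1)] .
  then interpret rooted V E q a .
  have "h \<in> nb E a \<union> out" using V_split(1) assms by blast
  then show ?thesis using walks3_bound_nb walks3_bound_out by auto
qed

section \<open>A vertex on few paths\<close>

text \<open>Maximality refers to all orders at once, hence it survives a rotation at the hub and
  makes every fitting order triangulated.\<close>

definition edge_maximal :: "'a set \<Rightarrow> ('a \<times> 'a) set \<Rightarrow> bool" where
  "edge_maximal V E \<longleftrightarrow> outer V E \<and> (\<forall>E'. outer V E' \<longrightarrow> E \<subseteq> E' \<longrightarrow> E' = E)"

lemma edge_maximal_exists: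
  assumes "outer V E"
  shows "\<exists>E'. E \<subseteq> E' \<and> edge_maximal V E'"
proof -
  have fin: "finite V" using assms by (auto simp: outer_def ordered_outer_def sgraph_def)
  have sub: "E' \<subseteq> V \<times> V" if "outer V E'" for E' using that by (auto simp: outer_def ordered_outer_def sgraph_def)
  have "card E' < Suc (card (V \<times> V))" if "outer V E'" for E'
    using card_mono[OF _ sub[OF that]] fin by simp
  then obtain E' where E': "outer V E'" "E \<subseteq> E'" "\<And>F. outer V F \<Longrightarrow> E \<subseteq> F \<Longrightarrow> card F \<le> card E'"
    using ex_has_greatest_nat[of "\<lambda>E'. outer V E' \<and> E \<subseteq> E'" E card "Suc (card (V \<times> V))"] assms by blast
  have "F = E'" if "outer V F" "E' \<subseteq> F" for F
    using E'(3)[OF that(1)] E'(2) that card_seteq[of F E'] sub[OF that(1)] fin finite_subset[of F "V \<times> V"] by auto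
  then show ?thesis using E' by (auto simp: edge_maximal_def)
qed

locale triangulated = ordered_outer V E p for V :: "'a set" and E p +
  assumes triangle: "(i, j) \<in> E \<Longrightarrow> p i < p j \<Longrightarrow> k \<in> V \<Longrightarrow> p i < p k \<Longrightarrow> p k < p j \<Longrightarrow>
    \<exists>b. (i, b) \<in> E \<and> (b, j) \<in> E \<and> p i < p b \<and> p b < p j"

lemma (in ordered_outer) edge_maximal_add:
  assumes max: "edge_maximal V E" and ij: "i \<in> V" "j \<in> V" "p i < p j"
    and nc: "\<And>k l. (k, l) \<in> E \<Longrightarrow> p i < p k \<Longrightarrow> p k < p j \<Longrightarrow> p j < p l \<Longrightarrow> False"
      "\<And>k l. (k, l) \<in> E \<Longrightarrow> p k < p i \<Longrightarrow> p i < p l \<Longrightarrow> p l < p j \<Longrightarrow> False"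
  shows "(i, j) \<in> E"
proof -
  have "ordered_outer V (E \<union> {(i, j), (j, i)}) p"
  proof unfold_locales
    show "noncrossing p (E \<union> {(i, j), (j, i)})"
      unfolding noncrossing_def
    proof (intro allI impI notI, elim conjE)
      fix s t k l assume e: "(s, t) \<in> E \<union> {(i, j), (j, i)}" "(k, l) \<in> E \<union> {(i, j), (j, i)}"
        and lt: "p s < p k" "p k < p t" "p t < p l"
      show False
      proof (cases "(s, t) \<in> E")
        case True
        show False
        proof (cases "(k, l) \<in> E")
          case False
          then have "k = i \<and> l = j" using e(2) lt ij by auto
          then show False using nc(2)[OF True] lt by simp
        qed (use no_cross True lt in blast)
      next
        case False
        then have st: "s = i \<and> t = j" using e(1) lt ij by auto
        then have "(k, l) \<in> E" using e(2) lt ij by auto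
        then show False using nc(1) lt st by blast
      qed
    qed
  qed (use finite_V E_sub sym_E irrefl_E inj_p ij in \<open>auto simp: sym_def irrefl_def\<close>)
  then have "E \<union> {(i, j), (j, i)} = E" using max unfolding edge_maximal_def outer_def by blast
  then show ?thesis by blast
qed

text \<open>\<open>i\<close> is joined to its successor \<open>s\<close>, so it has a last neighbour
  \<open>t\<close> before \<open>j\<close>. A chord separating \<open>t\<close> from
  \<open>j\<close> would cross \<open>i j\<close> or \<open>i t\<close>, or start at
  \<open>i\<close> and contradict the choice of \<open>t\<close>; so \<open>t j\<close> is an
  edge.\<close>

lemma (in ordered_outer) edge_maximal_triangulated:
  assumes max: "edge_maximal V E"
  shows "triangulated V E p"
proof unfold_locales
  fix i j k assume ij: "(i, j) \<in> E" "p i < p j" and k: "k \<in> V" "p i < p k" "p k < p j"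
  have V: "i \<in> V" "j \<in> V" using E_V[OF ij(1)] by auto
  obtain s where s: "s \<in> V" "p i < p s" "\<And>t. t \<in> V \<Longrightarrow> p i < p t \<Longrightarrow> p s \<le> p t"
    using ex_has_least_nat[of "\<lambda>t. t \<in> V \<and> p i < p t" k p] k by blast
  have sE: "(i, s) \<in> E"
  proof (rule edge_maximal_add[OF max V(1) s(1,2)])
    show False if "(a, b) \<in> E" "p i < p a" "p a < p s" for a b
      using s(3)[of a] E_V(1)[OF that(1)] that by simp
    show False if "(a, b) \<in> E" "p a < p i" "p i < p b" "p b < p s" for a b
      using s(3)[of b] E_V(2)[OF that(1)] that by simp
  qed
  have "p s < p j" using s(3)[OF k(1,2)] k(3) by simp
  then obtain t where t: "(i, t) \<in> E" "p i < p t" "p t < p j"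
    and tmax: "\<And>r. (i, r) \<in> E \<Longrightarrow> p i < p r \<Longrightarrow> p r < p j \<Longrightarrow> p r \<le> p t"
    using ex_has_greatest_nat[of "\<lambda>t. (i, t) \<in> E \<and> p i < p t \<and> p t < p j" s p "p j"] sE s(2) by blast
  have "(t, j) \<in> E"
  proof (rule edge_maximal_add[OF max E_V(2)[OF t(1)] V(2) t(3)])
    show False if "(a, b) \<in> E" "p t < p a" "p a < p j" "p j < p b" for a b
      using no_cross[OF ij(1) that(1)] that t(2) by simp
    show False if ab: "(a, b) \<in> E" "p a < p t" "p t < p b" "p b < p j" for a b
    proof -
      consider "p a < p i" | "a = i" | "p i < p a" using p_eq[OF E_V(1)[OF ab(1)] V(1)] by (meson linorder_neqE_nat)
      then show False
      proof cases
        case 1 then show False using no_cross[OF ab(1) ij(1)] ab t by simp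
      next
        case 2 then show False using tmax[of b] ab t by simp
      next
        case 3 then show False using no_cross[OF t(1) ab(1)] ab by simp
      qed
    qed
  qed
  then show "\<exists>b. (i, b) \<in> E \<and> (b, j) \<in> E \<and> p i < p b \<and> p b < p j" using t by blast
qed

lemma (in ordered_outer) edge_maximal_ends:
  assumes max: "edge_maximal V E" and h: "h \<in> V" "\<And>v. v \<in> V \<Longrightarrow> v \<noteq> h \<Longrightarrow> p h < p v"
    and m: "m \<in> V" "m \<noteq> h" "\<And>v. v \<in> V \<Longrightarrow> p v \<le> p m"
  shows "(h, m) \<in> E"
proof (rule edge_maximal_add[OF max h(1) m(1)])
  show "p h < p m" using h(2) m by blast
  show False if "(a, b) \<in> E" "p m < p b" for a b using m(3)[of b] E_V(2)[OF that(1)] that(2) by simp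
  show False if "(a, b) \<in> E" "p a < p h" for a b
    using h(2)[of a] E_V(1)[OF that(1)] that(2) by (cases "a = h") auto
qed

text \<open>The two smaller of three numbers make up at most two thirds of the sum.\<close>

lemma sum_two_le: "x \<le> z \<Longrightarrow> y \<le> z \<Longrightarrow> x + y + z \<le> n + 6 \<Longrightarrow> 3 * x + 3 * y \<le> 2 * n + 12"
  for x y z n :: nat by linarith

section \<open>Degrees, ears and common neighbours below a chord\<close>

context ordered_outer
begin

lemma pos_neq: "u \<in> V \<Longrightarrow> v \<in> V \<Longrightarrow> u \<noteq> v \<Longrightarrow> p u < p v \<or> p v < p u"
  using p_eq by (metis linorder_neqE_nat)

definition between :: "'a \<Rightarrow> 'a \<Rightarrow> 'a set" where
  "between i j = {k \<in> V. p i < p k \<and> p k < p j}"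

lemma finite_between: "finite (between i j)" using finite_V by (simp add: between_def)

lemma nb_between:
  assumes "(i, j) \<in> E" "k \<in> between i j"
  shows "nb E k \<subseteq> between i j \<union> {i, j}"
proof
  fix l assume "l \<in> nb E k"
  then have kl: "(k, l) \<in> E" by simp
  have k: "p i < p k" "p k < p j" using assms(2) by (auto simp: between_def)
  have V: "l \<in> V" "i \<in> V" "j \<in> V" using E_V(2)[OF kl] E_V[OF assms(1)] by auto
  have "\<not> p l < p i" using no_cross[OF E_sym[OF kl] assms(1)] k by blast
  moreover have "\<not> p j < p l" using no_cross[OF assms(1) kl] k by blast
  ultimately show "l \<in> between i j \<union> {i, j}"
    using V p_eq[OF V(1,2)] p_eq[OF V(1,3)] by (auto simp: between_def neq_iff not_less le_less)
qed

text \<open>On either side the longest chord from \<open>s\<close> into \<open>U\<close> covers all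
  other neighbours of \<open>s\<close> in \<open>U\<close> on that side: 1 + 3 for each side and two
  for \<open>H\<close>.\<close>

lemma dg_bounded:
  assumes sub: "nb E s \<subseteq> U \<union> H" and H: "finite H" "card H \<le> 2"
    and lo: "\<And>t. t \<in> U \<Longrightarrow> (t, s) \<in> E \<Longrightarrow> p t < p s \<Longrightarrow> card (between t s) \<le> 3"
    and up: "\<And>t. t \<in> U \<Longrightarrow> (s, t) \<in> E \<Longrightarrow> p s < p t \<Longrightarrow> card (between s t) \<le> 3"
  shows "dg E s \<le> 10"
proof -
  let ?L = "{t \<in> U. (s, t) \<in> E \<and> p t < p s}" and ?R = "{t \<in> U. (s, t) \<in> E \<and> p s < p t}"
  have fin: "finite ?L" "finite ?R" by (rule finite_subset[of _ "nb E s"]; auto)+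
  have VL: "t \<in> V" if "(s, t) \<in> E" for t using E_V(2)[OF that] .
  have L: "card ?L \<le> 4"
  proof (cases "?L = {}")
    case False
    then obtain t0 where t0: "t0 \<in> ?L" "\<And>t. t \<in> ?L \<Longrightarrow> p t0 \<le> p t"
      using ex_has_least_nat[of "\<lambda>t. t \<in> ?L" _ p] by blast
    have "?L \<subseteq> insert t0 (between t0 s)"
    proof
      fix t assume t: "t \<in> ?L"
      then have "p t0 \<le> p t" "t \<in> V" "t0 \<in> V" using t0 VL by blast+
      then show "t \<in> insert t0 (between t0 s)" using t p_eq[of t0 t] by (auto simp: between_def le_less)
    qed
    then have "card ?L \<le> card (insert t0 (between t0 s))" by (rule card_mono[rotated]) (simp add: finite_between)
    also have "\<dots> \<le> Suc (card (between t0 s))" by (rule card_insert_le_m1[of "Suc (card (between t0 s))", simplified]) auto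
    also have "card (between t0 s) \<le> 3" using lo[of t0] t0(1) E_sym by blast
    finally show ?thesis by simp
  qed (metis card.empty zero_le)
  have R: "card ?R \<le> 4"
  proof (cases "?R = {}")
    case False
    have "\<And>t. t \<in> ?R \<Longrightarrow> p t < Suc (Max (p ` ?R))" using fin(2) by (simp add: less_Suc_eq_le)
    then obtain t0 where t0: "t0 \<in> ?R" "\<And>t. t \<in> ?R \<Longrightarrow> p t \<le> p t0"
      using False ex_has_greatest_nat[of "\<lambda>t. t \<in> ?R" _ p "Suc (Max (p ` ?R))"] by blast
    have "?R \<subseteq> insert t0 (between s t0)"
    proof
      fix t assume t: "t \<in> ?R"
      then have "p t \<le> p t0" "t \<in> V" "t0 \<in> V" using t0 VL by blast+
      then show "t \<in> insert t0 (between s t0)" using t p_eq[of t t0] by (auto simp: between_def le_less)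
    qed
    then have "card ?R \<le> card (insert t0 (between s t0))" by (rule card_mono[rotated]) (simp add: finite_between)
    also have "\<dots> \<le> Suc (card (between s t0))" by (rule card_insert_le_m1[of "Suc (card (between s t0))", simplified]) auto
    also have "card (between s t0) \<le> 3" using up[of t0] t0(1) by blast
    finally show ?thesis by simp
  qed (metis card.empty zero_le)
  have ne: "p t < p s \<or> p s < p t" if "(s, t) \<in> E" for t
    using p_eq[OF E_V[OF that]] E_irrefl that by (metis linorder_neqE_nat)
  have "nb E s \<subseteq> ?L \<union> ?R \<union> H"
  proof
    fix t assume t: "t \<in> nb E s"
    then have "t \<in> U \<or> t \<in> H" "p t < p s \<or> p s < p t" using sub ne[of t] by auto
    then show "t \<in> ?L \<union> ?R \<union> H" using t by auto
  qed
  then have "dg E s \<le> card (?L \<union> ?R \<union> H)" unfolding dg_def by (rule card_mono[rotated]) (simp add: fin H)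
  also have "\<dots> \<le> card ?L + card ?R + card H" by (intro order_trans[OF card_Un_le] add_mono order_refl)
  finally show ?thesis using L R H by linarith
qed

end

context triangulated
begin

text \<open>Descend through the triangles below the chord until neither lower side of the triangle
  covers a vertex.\<close>

lemma ear_between:
  assumes "(i, j) \<in> E" "p i < p j" "between i j \<noteq> {}"
  shows "\<exists>i' j' e. (i', j') \<in> E \<and> p i \<le> p i' \<and> p i' < p j' \<and> p j' \<le> p j \<and> between i' j' = {e}"
  using assms
proof (induction "card (between i j)" arbitrary: i j rule: less_induct)
  case less
  then obtain k where k: "k \<in> V" "p i < p k" "p k < p j" by (auto simp: between_def)
  obtain b where b: "(i, b) \<in> E" "(b, j) \<in> E" "p i < p b" "p b < p j"
    using triangle[OF less.prems(1,2) k] by blast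
  have bV: "b \<in> between i j" using b E_V(2)[OF b(1)] by (auto simp: between_def)
  have l: "card (between i b) < card (between i j)" "card (between b j) < card (between i j)"
  proof -
    have "between i b \<subset> between i j" "between b j \<subset> between i j" using b bV by (auto simp: between_def)
    then show "card (between i b) < card (between i j)" "card (between b j) < card (between i j)"
      by (auto intro: psubset_card_mono[OF finite_between])
  qed
  consider "between i b \<noteq> {}" | "between b j \<noteq> {}" | "between i b = {}" "between b j = {}" by blast
  then show ?case
  proof cases
    case 1
    from less.hyps[OF l(1) b(1,3) 1] b(4) show ?thesis by (meson le_less_trans less_imp_le order_trans)
  next
    case 2
    from less.hyps[OF l(2) b(2,4) 2] b(3) show ?thesis by (meson le_less_trans less_imp_le order_trans)
  next
    case 3
    have "between i j = {b}"
    proof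
      show "between i j \<subseteq> {b}"
      proof
        fix x assume x: "x \<in> between i j"
        show "x \<in> {b}"
        proof (rule ccontr)
          assume "x \<notin> {b}"
          then have "p x < p b \<or> p b < p x" using pos_neq[of x b] x bV by (auto simp: between_def)
          then show False using 3 x by (auto simp: between_def)
        qed
      qed
    qed (use bV in simp)
    then show ?thesis using less.prems by blast
  qed
qed

definition loss :: "'a \<Rightarrow> nat" where
  "loss e = 2 * card (through1 E e) + 2 * card (through2 E e) + card (through3 E e)"

lemma between_bounded_degree:
  assumes aa: "(a, a') \<in> E" and s: "s \<in> between a a'"
    and small: "\<And>i j. (i, j) \<in> E \<Longrightarrow> p a \<le> p i \<Longrightarrow> p i < p j \<Longrightarrow> p j \<le> p a' \<Longrightarrow> i \<noteq> a \<or> j \<noteq> a' \<Longrightarrow>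
      card (between i j) \<le> 3"
  shows "dg E s \<le> 10"
proof (rule dg_bounded[OF nb_between[OF aa s]])
  show "card {a, a'} \<le> 2" by (simp add: card_insert_if)
  fix t assume t: "t \<in> between a a'"
  show "card (between t s) \<le> 3" if "(t, s) \<in> E" "p t < p s"
    using small[OF that(1) _ that(2)] t s by (auto simp: between_def)
  show "card (between s t) \<le> 3" if "(s, t) \<in> E" "p s < p t"
    using small[OF that(1) _ that(2)] t s by (auto simp: between_def)
qed simp

text \<open>Each of \<open>a\<close> and \<open>a'\<close> has at most one common neighbour with
  \<open>s\<close> on each side of \<open>s\<close>. All four cannot occur: an edge from
  \<open>a\<close> beyond \<open>s\<close> and one from \<open>a'\<close> to a vertex before
  \<open>s\<close> cross.\<close>

lemma common_between:
  assumes aa: "(a, a') \<in> E" and s: "s \<in> between a a'"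
  shows "card (nb E s \<inter> nb E a \<inter> between a a') + card (nb E s \<inter> nb E a' \<inter> between a a') \<le> 3"
proof -
  let ?K = "between a a'"
  let ?A1 = "{t \<in> nb E s \<inter> nb E a \<inter> ?K. p t < p s}" and ?A2 = "{t \<in> nb E s \<inter> nb E a \<inter> ?K. p s < p t}"
    and ?B1 = "{t \<in> nb E s \<inter> nb E a' \<inter> ?K. p t < p s}" and ?B2 = "{t \<in> nb E s \<inter> nb E a' \<inter> ?K. p s < p t}"
  have sp: "p a < p s" "p s < p a'" using s by (auto simp: between_def)
  have eq: "t = r" if "t \<in> ?K" "r \<in> ?K" "p t < p r \<Longrightarrow> False" "p r < p t \<Longrightarrow> False" for t r
    using that pos_neq[of t r] by (auto simp: between_def)
  have ne: "p t < p s \<or> p s < p t" if "(s, t) \<in> E" for t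
    using p_eq[OF E_V[OF that]] E_irrefl that by (metis linorder_neqE_nat)
  have A1: "card ?A1 \<le> 1"
  proof (rule card_le_1I, rule eq)
    have "False" if "t \<in> ?A1" "r \<in> ?A1" "p t < p r" for t r
      using no_cross[of a r t s] that E_sym by (auto simp: between_def)
    then show "p x < p y \<Longrightarrow> False" "p y < p x \<Longrightarrow> False" if "x \<in> ?A1" "y \<in> ?A1" for x y using that by blast+
  qed auto
  have A2: "card ?A2 \<le> 1"
  proof (rule card_le_1I, rule eq)
    have "False" if "t \<in> ?A2" "r \<in> ?A2" "p t < p r" for t r
      using no_cross[of a t s r] that sp by auto
    then show "p x < p y \<Longrightarrow> False" "p y < p x \<Longrightarrow> False" if "x \<in> ?A2" "y \<in> ?A2" for x y using that by blast+
  qed auto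
  have B1: "card ?B1 \<le> 1"
  proof (rule card_le_1I, rule eq)
    have "False" if "t \<in> ?B1" "r \<in> ?B1" "p t < p r" for t r
      using no_cross[of t s r a'] that sp E_sym by auto
    then show "p x < p y \<Longrightarrow> False" "p y < p x \<Longrightarrow> False" if "x \<in> ?B1" "y \<in> ?B1" for x y using that by blast+
  qed auto
  have B2: "card ?B2 \<le> 1"
  proof (rule card_le_1I, rule eq)
    have "False" if "t \<in> ?B2" "r \<in> ?B2" "p t < p r" for t r
      using no_cross[of s r t a'] that sp E_sym by (auto simp: between_def)
    then show "p x < p y \<Longrightarrow> False" "p y < p x \<Longrightarrow> False" if "x \<in> ?B2" "y \<in> ?B2" for x y using that by blast+
  qed auto
  have or: "?A2 = {} \<or> ?B1 = {}"
  proof (rule ccontr)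
    assume "\<not> ?thesis"
    then obtain t r where "t \<in> ?A2" "r \<in> ?B1" by blast
    then show False using no_cross[of a t r a'] E_sym by (auto simp: between_def)
  qed
  have split: "nb E s \<inter> nb E a \<inter> ?K \<subseteq> ?A1 \<union> ?A2" "nb E s \<inter> nb E a' \<inter> ?K \<subseteq> ?B1 \<union> ?B2"
    by (auto dest: ne)
  have "card (nb E s \<inter> nb E a \<inter> ?K) \<le> card ?A1 + card ?A2"
    by (rule order_trans[OF card_mono[OF _ split(1)] card_Un_le]) (rule finite_subset[of _ "nb E s"], auto)
  moreover have "card (nb E s \<inter> nb E a' \<inter> ?K) \<le> card ?B1 + card ?B2"
    by (rule order_trans[OF card_mono[OF _ split(2)] card_Un_le]) (rule finite_subset[of _ "nb E s"], auto)
  moreover have "card ?A2 = 0 \<or> card ?B1 = 0" using or by (elim disjE) (simp_all only: card.empty simp_thms)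
  ultimately show ?thesis using A1 A2 B1 B2 by linarith
qed

text \<open>The inner chord carries an ear \<open>e\<close> whose neighbours \<open>i'\<close>,
  \<open>j'\<close> lie strictly below \<open>a a'\<close>, so paths from \<open>e\<close> reach
  large degrees only through \<open>a\<close> and \<open>a'\<close>. At most three edges join
  \<open>i'\<close>, \<open>j'\<close> to these two, hence three terms w2, each with refund deg h;
  the degrees enter with total weight at most nine, six on one of them. The refund pays for the
  surplus and 6n + 3 (deg a + deg a') <= 8n + O(1) remains.\<close>

lemma nonpure_loss:
  assumes h: "h \<in> V" "h \<noteq> a" "h \<noteq> a'" "dg E a \<le> dg E h" "dg E a' \<le> dg E h"
    and aa: "(a, a') \<in> E" "p a < p a'"
    and small: "\<And>i j. (i, j) \<in> E \<Longrightarrow> p a \<le> p i \<Longrightarrow> p i < p j \<Longrightarrow> p j \<le> p a' \<Longrightarrow> i \<noteq> a \<or> j \<noteq> a' \<Longrightarrow>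
      card (between i j) \<le> 3"
    and ij: "(i, j) \<in> E" "i \<in> between a a'" "j \<in> between a a'" "p i < p j" "between i j \<noteq> {}"
  shows "\<exists>e\<in>V. loss e \<le> 16 * card V + 17000"
proof -
  let ?K = "between a a'"
  obtain i' j' e where e: "(i', j') \<in> E" "p i \<le> p i'" "p i' < p j'" "p j' \<le> p j" "between i' j' = {e}"
    using ear_between[OF ij(1,4,5)] by blast
  have V: "i' \<in> V" "j' \<in> V" "e \<in> V" using E_V[OF e(1)] e(5) by (auto simp: between_def)
  have K: "i' \<in> ?K" "j' \<in> ?K" using e ij V by (auto simp: between_def)
  let ?P = "{i', j'}"
  have ne: "i' \<noteq> j'" using e by auto
  have nbe: "nb E e \<subseteq> ?P"
    using nb_between[OF e(1), of e] e(5) E_irrefl[of e] by auto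
  have aa_ne: "a \<noteq> a'" using aa by auto
  define al al' si si' where "al = card (?P \<inter> nb E a)" and "al' = card (?P \<inter> nb E a')"
    and "si = (\<Sum>s\<in>?P. card (nb E s \<inter> nb E a \<inter> ?K))" and "si' = (\<Sum>s\<in>?P. card (nb E s \<inter> nb E a' \<inter> ?K))"
  have t: "card (through1 E e) + card (through2 E e) \<le>
      (\<Sum>b\<in>{a, a'}. card (?P \<inter> nb E b) * card (walks2 E b)
        + (card (?P \<inter> nb E b) + (\<Sum>s\<in>?P. card (nb E s \<inter> nb E b \<inter> ?K))) * dg E b) + 4 * (10 + 1) ^ 3"
    "card (through3 E e) \<le> 4 * (10 + 1) ^ 3"
  proof -
    have "dg E s \<le> 10" if "s \<in> ?K" for s using between_bounded_degree[OF aa(1) that small] .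
    note te = through_ear[where B = 10 and U = ?K and P = ?P, OF nb_between[OF aa(1)] this nbe]
    have prem: "?P \<subseteq> ?K" "card ?P \<le> 2" "finite ?P" "finite {a, a'}" using K by (auto simp: card_insert_if)
    show "card (through1 E e) + card (through2 E e) \<le>
      (\<Sum>b\<in>{a, a'}. card (?P \<inter> nb E b) * card (walks2 E b)
        + (card (?P \<inter> nb E b) + (\<Sum>s\<in>?P. card (nb E s \<inter> nb E b \<inter> ?K))) * dg E b) + 4 * (10 + 1) ^ 3"
      by (rule te(1)[OF _ _ prem]) auto
    show "card (through3 E e) \<le> 4 * (10 + 1) ^ 3"
      by (rule te(2)[OF _ _ prem]) auto
  qed
  \<comment> \<open>5324 is the error term 4 * 11^3 of \<open>through_ear\<close> for the degree
    bound 10.\<close>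
  have t1: "card (through1 E e) + card (through2 E e) \<le> al * card (walks2 E a) + al' * card (walks2 E a')
     + (al + si) * dg E a + (al' + si') * dg E a' + 5324"
    using t(1) aa_ne by (simp add: al_def al'_def si_def si'_def)
  have "(i', a') \<notin> E \<or> (j', a) \<notin> E"
    using no_cross[of a j' i' a'] K e(3) E_sym by (auto simp: between_def)
  then have "?P \<inter> nb E a' \<subseteq> {j'} \<or> ?P \<inter> nb E a \<subseteq> {i'}" using E_sym by auto
  then have "al \<le> 1 \<or> al' \<le> 1"
    using card_mono[of "{j'}" "?P \<inter> nb E a'"] card_mono[of "{i'}" "?P \<inter> nb E a"] by (auto simp: al_def al'_def)
  moreover have "al \<le> 2" "al' \<le> 2"
    unfolding al_def al'_def by (rule order_trans[OF card_mono[of ?P]]; use ne in simp)+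
  ultimately have al: "al + al' \<le> 3" "al \<le> 2" "al' \<le> 2" by linarith+
  have c2: "card (nb E s \<inter> nb E b \<inter> ?K) \<le> 2" if "s \<noteq> b" for s b
    using card_common[OF that] card_mono[of "nb E s \<inter> nb E b" "nb E s \<inter> nb E b \<inter> ?K"] by fastforce
  have K_ne: "s \<noteq> a" "s \<noteq> a'" if "s \<in> ?K" for s using that by (auto simp: between_def)
  have si: "si \<le> 4" "si' \<le> 4" "si + si' \<le> 6"
    using c2[of i' a] c2[of j' a] c2[of i' a'] c2[of j' a'] K_ne K ne common_between[OF aa(1) K(1)]
      common_between[OF aa(1) K(2)] by (auto simp: si_def si'_def)
  have w: "card (walks2 E a) \<le> 2 * card V + 3 - dg E h" "card (walks2 E a') \<le> 2 * card V + 3 - dg E h"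
    using walks2_le[of a h] walks2_le[of a' h] E_V[OF aa(1)] h by auto
  have dh: "dg E h \<le> card V" unfolding dg_def by (rule card_mono[OF finite_V nb_V])
  have three: "dg E a + dg E a' + dg E h \<le> card V + 6" by (rule sum_three_degrees) (use h aa_ne in auto)
  define W where "W = 2 * card V + 3 - dg E h"
  have "al * card (walks2 E a) + al' * card (walks2 E a') \<le> al * W + al' * W"
    using w unfolding W_def by (intro add_mono mult_le_mono2)
  also have "\<dots> = (al + al') * W" by (simp add: add_mult_distrib)
  also have "\<dots> \<le> 3 * W" using al by simp
  finally have "al * card (walks2 E a) + al' * card (walks2 E a') \<le> 3 * W" .
  have W3: "3 * W + 3 * dg E h = 6 * card V + 9" unfolding W_def using dh by simp
  define ka ka' where "ka = al + si" and "ka' = al' + si'"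
  have ka: "ka \<le> 6" "ka' \<le> 6" "ka + ka' \<le> 9" using al si by (auto simp: ka_def ka'_def)
  \<comment> \<open>With total weight nine and at most six on \<open>x\<close>, the sum is largest
    when six units sit on the larger number.\<close>
  have mix: "ka * x + ka' * y \<le> 6 * x + 3 * y" if "y \<le> x" "ka \<le> 6" "ka + ka' \<le> 9" for x y ka ka' :: nat
  proof -
    note le = that
    obtain c where c: "x = y + c" using le_Suc_ex[OF le(1)] by blast
    have "ka * x + ka' * y = (ka + ka') * y + ka * c" unfolding c by (simp only: distrib_left distrib_right ac_simps)
    also have "\<dots> \<le> 9 * y + 6 * c" by (intro add_mono mult_le_mono1 le)
    finally show ?thesis by (simp add: c)
  qed
  have "ka * dg E a + ka' * dg E a' \<le> 3 * dg E a + 3 * dg E a' + 3 * dg E h"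
  proof (cases "dg E a' \<le> dg E a")
    case True
    have "6 * dg E a + 3 * dg E a' \<le> 3 * dg E a + 3 * dg E a' + 3 * dg E h" using h(4) by simp
    with mix[OF True ka(1,3)] show ?thesis by (rule order_trans)
  next
    case False
    then have "dg E a \<le> dg E a'" by simp
    from mix[OF this ka(2), of ka] ka(3) have "ka * dg E a + ka' * dg E a' \<le> 6 * dg E a' + 3 * dg E a" by (simp add: add.commute)
    moreover have "6 * dg E a' + 3 * dg E a \<le> 3 * dg E a + 3 * dg E a' + 3 * dg E h" using h(5) by simp
    ultimately show ?thesis by (rule order_trans)
  qed
  moreover have "3 * dg E a + 3 * dg E a' \<le> 2 * card V + 12" by (rule sum_two_le[OF h(4,5) three])
  ultimately have "card (through1 E e) + card (through2 E e) \<le> 8 * card V + 9 + 12 + 5324"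
    using t1[folded ka_def ka'_def] \<open>al * card (walks2 E a) + al' * card (walks2 E a') \<le> 3 * W\<close> W3 by linarith
  then have "loss e \<le> 16 * card V + 17000" using t(2) unfolding loss_def by simp
  then show ?thesis using V by blast
qed

end

text \<open>By \<open>pure\<close>, edges strictly below \<open>a a'\<close> join consecutive
  vertices only, and the edge \<open>a b\<close> shields the vertices below it from
  \<open>a'\<close>. So the first three vertices \<open>e\<close>, \<open>u\<close>,
  \<open>w\<close> begin a fan at \<open>a\<close>, and \<open>through_fan\<close> with the refunded
  walk bound gives 16n - 4 deg h + 4 deg a + 2 deg a' up to a constant, the worst of all
  cases.\<close>

lemma (in ordered_outer) pure_fan_loss:
  assumes h: "h \<in> V" "h \<noteq> a" "h \<noteq> a'" "dg E a \<le> dg E h" "dg E a' \<le> dg E h"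
    and aa: "(a, a') \<in> E" "p a < p a'"
    and deg: "\<And>s. s \<in> between a a' \<Longrightarrow> dg E s \<le> 10"
    and pure: "\<And>s t k. (s, t) \<in> E \<Longrightarrow> s \<in> between a a' \<Longrightarrow> t \<in> between a a' \<Longrightarrow> k \<in> V \<Longrightarrow> p s < p k \<Longrightarrow> p k < p t \<Longrightarrow> False"
    and b: "(a, b) \<in> E" "b \<in> between a a'" "2 \<le> card (between a b)"
  shows "\<exists>e\<in>V. 3 * (2 * card (through1 E e) + 2 * card (through2 E e) + card (through3 E e)) \<le> 50 * card V + 1000"
proof -
  let ?K = "between a a'"
  have bp: "p a < p b" "p b < p a'" using b by (auto simp: between_def)
  have sub: "between a b \<subseteq> ?K" using bp by (auto simp: between_def)
  have bK: "between a b \<noteq> {}" using b(3) by auto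
  then have "?K \<noteq> {}" using sub by blast
  then obtain e where e: "e \<in> ?K" "\<And>t. t \<in> ?K \<Longrightarrow> p e \<le> p t"
    using ex_has_least_nat[of "\<lambda>t. t \<in> ?K" _ p] by blast
  \<comment> \<open>Two vertices below \<open>a b\<close> ensure that both \<open>e\<close> and
    \<open>u\<close> come before \<open>b\<close>, so that \<open>u\<close> is shielded too and a
    third vertex \<open>w\<close> exists.\<close>
  have "\<not> between a b \<subseteq> {e}"
  proof
    assume "between a b \<subseteq> {e}"
    from card_mono[OF _ this] b(3) show False by simp
  qed
  then obtain x where x: "x \<in> between a b" "x \<noteq> e" by blast
  have bne: "b \<noteq> x" using x by (auto simp: between_def)
  obtain u where u: "u \<in> ?K" "u \<noteq> e" "\<And>t. t \<in> ?K \<Longrightarrow> t \<noteq> e \<Longrightarrow> p u \<le> p t"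
    using ex_has_least_nat[of "\<lambda>t. t \<in> ?K \<and> t \<noteq> e" x p] x sub by blast
  have ux: "p u \<le> p x" using u(3)[of x] x sub by blast
  then have ub: "p u < p b" using x by (auto simp: between_def)
  have eu: "p e < p u" using e(2)[OF u(1)] p_eq[of e u] e(1) u by (auto simp: between_def le_less)
  have bu: "b \<in> ?K \<and> b \<noteq> e \<and> b \<noteq> u" using b(2) ub eu by auto
  then obtain w where w: "w \<in> ?K" "w \<noteq> e" "w \<noteq> u" "\<And>t. t \<in> ?K \<Longrightarrow> t \<noteq> e \<Longrightarrow> t \<noteq> u \<Longrightarrow> p w \<le> p t"
    using ex_has_least_nat[of "\<lambda>t. t \<in> ?K \<and> t \<noteq> e \<and> t \<noteq> u" b p] by blast
  have uw: "p u < p w" using u(3)[OF w(1,2)] p_eq[of u w] u(1) w by (auto simp: between_def le_less)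
  have KV: "t \<in> V" if "t \<in> ?K" for t using that by (simp add: between_def)
  have not_a': "(t, a') \<notin> E" if "t \<in> ?K" "p t < p b" for t
    using no_cross[OF b(1), of t a'] that bp by (auto simp: between_def)
  have nbe: "nb E e \<subseteq> {a, u}"
  proof
    fix t assume "t \<in> nb E e"
    then have t: "(e, t) \<in> E" by simp
    then have "t \<in> ?K \<union> {a, a'}" using nb_between[OF aa(1) e(1)] by auto
    moreover have "t \<noteq> a'" using not_a'[OF e(1)] t eu ub by auto
    moreover have "t = u" if tK: "t \<in> ?K"
    proof (rule ccontr)
      assume n: "t \<noteq> u"
      have "t \<noteq> e" using t E_irrefl by blast
      then have "p u \<le> p t" using u(3)[OF tK] by blast
      then have "p u < p t" using p_eq[of u t] n KV u(1) tK by (auto simp: le_less)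
      then show False using pure[OF t e(1) tK KV[OF u(1)] eu] by blast
    qed
    ultimately show "t \<in> {a, u}" by blast
  qed
  have nbu: "nb E u \<subseteq> {a, e, w}"
  proof
    fix t assume "t \<in> nb E u"
    then have t: "(u, t) \<in> E" by simp
    then have "t \<in> ?K \<union> {a, a'}" using nb_between[OF aa(1) u(1)] by auto
    moreover have "t \<noteq> a'" using not_a'[OF u(1)] t ub by auto
    moreover have "t = w" if tK: "t \<in> ?K" "t \<noteq> e"
    proof (rule ccontr)
      assume n: "t \<noteq> w"
      have "t \<noteq> u" using t E_irrefl by blast
      then have "p w \<le> p t" using w(4)[OF tK] by blast
      then have "p w < p t" using p_eq[of w t] n KV w(1) tK by (auto simp: le_less)
      then show False using pure[OF t u(1) tK(1) KV[OF w(1)] uw] by blast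
    qed
    ultimately show "t \<in> {a, e, w}" by blast
  qed
  note tf = through_fan[OF nbe nbu nb_between[OF aa(1) w(1)] deg[OF w(1)] deg]
  have L: "card (walks3 E a) + 2 * card (walks2 E a) + 2 * dg E h \<le> 8 * card V + 24"
    by (rule walks3_le) (use h E_V[OF aa(1)] in auto)
  have "a \<noteq> a'" using aa by auto
  then have three: "dg E a + dg E a' + dg E h \<le> card V + 6" by (intro sum_three_degrees) (use h in auto)
  have "3 * (2 * card (through1 E e) + 2 * card (through2 E e) + card (through3 E e)) \<le> 50 * card V + 1000"
    using tf L three h(4,5) by simp
  then show ?thesis using KV[OF e(1)] by blast
qed

text \<open>Here all degrees except that of \<open>h\<close> are at most ten, so \<open>h\<close>
  alone plays the role of \<open>H\<close>. The edge \<open>z1 z2\<close> lies strictly between two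
  consecutive neighbours \<open>y\<close>, \<open>y'\<close> of \<open>h\<close>, and an ear found
  there has at most one of its two neighbours adjacent to \<open>h\<close>. One term w2 <= 2n and a
  degree with weight five, doubled, make 14n.\<close>

lemma (in triangulated) bounded_loss:
  assumes h: "h \<in> V" "\<And>v. v \<in> V \<Longrightarrow> v \<noteq> h \<Longrightarrow> p h < p v"
    and m: "(h, m) \<in> E" "\<And>v. v \<in> V \<Longrightarrow> p v \<le> p m"
    and small: "\<And>i j. (i, j) \<in> E \<Longrightarrow> i \<noteq> h \<Longrightarrow> j \<noteq> h \<Longrightarrow> p i < p j \<Longrightarrow> card (between i j) \<le> 3"
    and z: "(z1, z2) \<in> E" "z1 \<noteq> h" "z2 \<noteq> h" "(h, z1) \<notin> E" "(h, z2) \<notin> E" "p z1 < p z2"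
  shows "\<exists>e\<in>V. loss e \<le> 14 * card V + 17000"
proof -
  have zV: "z1 \<in> V" "z2 \<in> V" using E_V[OF z(1)] by auto
  have mV: "m \<in> V" "m \<noteq> h" using E_V[OF m(1)] m(1) E_irrefl by auto
  have "p z2 < p m" using m(2)[OF zV(2)] p_eq[OF zV(2) mV(1)] m(1) z(5) by (auto simp: le_less)
  then obtain y' where y': "(h, y') \<in> E" "p z2 < p y'" and y'min: "\<And>t. (h, t) \<in> E \<Longrightarrow> p z2 < p t \<Longrightarrow> p y' \<le> p t"
    using ex_has_least_nat[of "\<lambda>t. (h, t) \<in> E \<and> p z2 < p t" m p] m(1) by blast
  have hy': "p h < p y'" using h(2)[OF E_V(2)[OF y'(1)]] y'(1) E_irrefl by blast
  obtain y where y: "(h, y) \<in> E" "(y, y') \<in> E" "p h < p y" "p y < p y'"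
    using triangle[OF y'(1) hy' zV(2) h(2)[OF zV(2) z(3)] y'(2)] by blast
  have yV: "y \<in> V" "y' \<in> V" using E_V[OF y(2)] by auto
  have "\<not> p z2 < p y" using y'min[OF y(1)] y(4) by auto
  then have yz2: "p y < p z2" using pos_neq[OF yV(1) zV(2)] y(1) z(5) by auto
  have "\<not> p z1 < p y" using no_cross[OF y(1) z(1)] h(2)[OF zV(1) z(2)] yz2 by blast
  then have yz1: "p y < p z1" using pos_neq[OF yV(1) zV(1)] y(1) z(4) by auto
  have noD: "(h, t) \<notin> E" if "p y < p t" "p t < p y'" for t
    using no_cross[OF _ y(2), of h t] that y(3) by blast
  obtain c where c: "(y, c) \<in> E" "(c, y') \<in> E" "p y < p c" "p c < p y'"
    using triangle[OF y(2,4) zV(1) yz1] z(6) y'(2) by auto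
  have cV: "c \<in> V" using E_V(2)[OF c(1)] .
  have hlt: "t \<noteq> h" if "p y \<le> p t" for t using that y(3) by auto
  \<comment> \<open>One of the two lower sides of the triangle on \<open>y y'\<close> covers
    \<open>z1\<close> or \<open>z2\<close>. Passing to this side rules out \<open>y y'\<close> as
    the base of the ear, whose two ends are both adjacent to \<open>h\<close>.\<close>
  have "\<exists>i j. (i, j) \<in> E \<and> p i < p j \<and> between i j \<noteq> {} \<and> p y \<le> p i \<and> p j \<le> p y' \<and> (p j < p y' \<or> p y < p i)"
  proof (cases "c = z1")
    case True
    then have "z2 \<in> between c y'" using zV z(6) y'(2) by (auto simp: between_def)
    then show ?thesis using c by (intro exI[of _ c] exI[of _ y']) auto
  next
    case False
    then consider "p z1 < p c" | "p c < p z1" using pos_neq[OF zV(1) cV] by auto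
    then show ?thesis
    proof cases
      case 1
      then have "z1 \<in> between y c" using zV yz1 by (auto simp: between_def)
      then show ?thesis using c by (intro exI[of _ y] exI[of _ c]) auto
    next
      case 2
      then have "z1 \<in> between c y'" using zV z(6) y'(2) by (auto simp: between_def)
      then show ?thesis using c by (intro exI[of _ c] exI[of _ y']) auto
    qed
  qed
  then obtain i j where ij: "(i, j) \<in> E" "p i < p j" "between i j \<noteq> {}" "p y \<le> p i" "p j \<le> p y'" "p j < p y' \<or> p y < p i" by blast
  obtain i' j' e where e: "(i', j') \<in> E" "p i \<le> p i'" "p i' < p j'" "p j' \<le> p j" "between i' j' = {e}"
    using ear_between[OF ij(1-3)] by blast
  have V: "i' \<in> V" "j' \<in> V" "e \<in> V" using E_V[OF e(1)] e(5) by (auto simp: between_def)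
  let ?P = "{i', j'}" and ?U = "V - {h}"
  have P: "i' \<noteq> h" "j' \<noteq> h" using hlt[of i'] hlt[of j'] e ij by auto
  have one: "(h, i') \<notin> E \<or> (h, j') \<notin> E" using noD[of i'] noD[of j'] e ij by linarith
  have nbe: "nb E e \<subseteq> ?P"
    using nb_between[OF e(1), of e] e(5) E_irrefl[of e] by auto
  have nbU: "nb E s \<subseteq> ?U \<union> {h}" for s using nb_V by auto
  have deg: "dg E s \<le> 10" if "s \<in> ?U" for s
    by (rule dg_bounded[OF nbU]) (use small that in auto)
  have prem: "?P \<subseteq> ?U" "card ?P \<le> 2" "finite ?P" "finite {h}" using V P by (auto simp: card_insert_if)
  note te = through_ear[where B = 10 and U = ?U and P = ?P, OF nbU deg nbe prem]
  have "?P \<inter> nb E h \<subseteq> {i'} \<or> ?P \<inter> nb E h \<subseteq> {j'}" using one by auto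
  then have al: "card (?P \<inter> nb E h) \<le> 1"
    using card_mono[of "{i'}" "?P \<inter> nb E h"] card_mono[of "{j'}" "?P \<inter> nb E h"] by auto
  have c2: "card (nb E s \<inter> nb E h \<inter> ?U) \<le> 2" if "s \<noteq> h" for s
    using card_common[OF that] card_mono[of "nb E s \<inter> nb E h" "nb E s \<inter> nb E h \<inter> ?U"] by fastforce
  have si: "(\<Sum>s\<in>?P. card (nb E s \<inter> nb E h \<inter> ?U)) \<le> 4"
    using c2[OF P(1)] c2[OF P(2)] by (cases "i' = j'") auto
  have w: "card (walks2 E h) \<le> 2 * card V + 3" using walks2_le[OF h(1) P(1)] by simp
  have dh: "dg E h \<le> card V" unfolding dg_def by (rule card_mono[OF finite_V nb_V])
  have "card (through1 E e) + card (through2 E e) \<le> 1 * card (walks2 E h) + (1 + 4) * dg E h + 5324"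
    using te(1) by (rule order_trans) (use al si in \<open>auto intro!: add_mono mult_le_mono1\<close>)
  then have "loss e \<le> 14 * card V + 17000" using te(2) w dh by (simp add: loss_def)
  then show ?thesis using V by blast
qed

text \<open>With the order cut at \<open>h\<close>, a chord avoiding \<open>h\<close> never covers
  it. Among the chords avoiding \<open>h\<close> with at least four vertices below, one with fewest
  is taken; minimality bounds all degrees below it. Without such a chord the whole graph apart from
  \<open>h\<close> has bounded degree. The factor three keeps 50/3 integral.\<close>

lemma (in ordered_outer) cheap_vertex:
  assumes max: "edge_maximal V E" and hV: "h \<in> V" and hmax: "\<And>v. v \<in> V \<Longrightarrow> dg E v \<le> dg E h"
    and z: "(z1, z2) \<in> E" "z1 \<noteq> h" "z2 \<noteq> h" "(h, z1) \<notin> E" "(h, z2) \<notin> E"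
  shows "\<exists>e\<in>V. 3 * (2 * card (through1 E e) + 2 * card (through2 E e) + card (through3 E e)) \<le> 50 * card V + 51000"
proof -
  obtain q where "rooted V E q h" using rootedE[OF hV] .
  then interpret q: rooted V E q h .
  interpret q: triangulated V E q by (rule q.edge_maximal_triangulated[OF max])
  have root: "\<And>v. v \<in> V \<Longrightarrow> v \<noteq> h \<Longrightarrow> q h < q v" by (rule q.root)
  have lossI: ?thesis if "\<exists>e\<in>V. q.loss e \<le> 16 * card V + 17000"
  proof -
    from that obtain e where e: "e \<in> V" "q.loss e \<le> 16 * card V + 17000" by blast
    then have "3 * q.loss e \<le> 50 * card V + 51000" by linarith
    then show ?thesis using e(1) unfolding q.loss_def by blast
  qed
  have pureI: ?thesis
    if "\<exists>e\<in>V. 3 * (2 * card (through1 E e) + 2 * card (through2 E e) + card (through3 E e)) \<le> 50 * card V + 1000"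
  proof -
    from that obtain e where e: "e \<in> V" "3 * (2 * card (through1 E e) + 2 * card (through2 E e) + card (through3 E e)) \<le> 50 * card V + 1000"
      by blast
    then have "3 * (2 * card (through1 E e) + 2 * card (through2 E e) + card (through3 E e)) \<le> 50 * card V + 51000" by linarith
    then show ?thesis using e(1) by blast
  qed
  show ?thesis
  proof (cases "\<exists>i j. (i, j) \<in> E \<and> i \<noteq> h \<and> j \<noteq> h \<and> q i < q j \<and> 4 \<le> card (q.between i j)")
    case True
    define Pr where "Pr x \<longleftrightarrow> (case x of (i, j) \<Rightarrow> (i, j) \<in> E \<and> i \<noteq> h \<and> j \<noteq> h \<and> q i < q j \<and> 4 \<le> card (q.between i j))" for x
    obtain x0 where "Pr x0" using True by (auto simp: Pr_def)
    then obtain x where x: "Pr x" "\<And>y. Pr y \<Longrightarrow> (case x of (i, j) \<Rightarrow> card (q.between i j)) \<le> (case y of (i, j) \<Rightarrow> card (q.between i j))"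
      using ex_has_least_nat[of Pr x0 "\<lambda>y. case y of (i, j) \<Rightarrow> card (q.between i j)"] by blast
    obtain a a' where [simp]: "x = (a, a')" by (cases x)
    have aa: "(a, a') \<in> E" "a \<noteq> h" "a' \<noteq> h" "q a < q a'" "4 \<le> card (q.between a a')" using x(1) by (auto simp: Pr_def)
    have least: "card (q.between a a') \<le> card (q.between i j)"
      if "(i, j) \<in> E" "i \<noteq> h" "j \<noteq> h" "q i < q j" "4 \<le> card (q.between i j)" for i j
      using x(2)[of "(i, j)"] that by (auto simp: Pr_def)
    have V: "a \<in> V" "a' \<in> V" using E_V[OF aa(1)] by auto
    have small: "card (q.between i j) \<le> 3"
      if ij: "(i, j) \<in> E" "q a \<le> q i" "q i < q j" "q j \<le> q a'" "i \<noteq> a \<or> j \<noteq> a'" for i j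
    proof (rule ccontr)
      assume n: "\<not> ?thesis"
      have ijV: "i \<in> V" "j \<in> V" using E_V[OF ij(1)] by auto
      have "q h < q a" using root V aa by auto
      then have "i \<noteq> h" "j \<noteq> h" using ij by auto
      then have le: "card (q.between a a') \<le> card (q.between i j)" using least[OF ij(1)] ij n by simp
      have "q a \<noteq> q i \<or> q j \<noteq> q a'" using ij(5) q.p_eq[OF V(1) ijV(1)] q.p_eq[OF ijV(2) V(2)] by blast
      then have "q a < q i \<or> q j < q a'" using ij(2,4) by linarith
      then have "i \<in> q.between a a' - q.between i j \<or> j \<in> q.between a a' - q.between i j"
        using ij(2-4) ijV unfolding q.between_def by fastforce
      moreover have "q.between i j \<subseteq> q.between a a'" using ij(2,4) unfolding q.between_def by fastforce
      ultimately have "q.between i j \<subset> q.between a a'" by blast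
      from psubset_card_mono[OF q.finite_between this] le show False by simp
    qed
    have d: "dg E a \<le> dg E h" "dg E a' \<le> dg E h" using hmax V by auto
    show ?thesis
    proof (cases "\<exists>i j. (i, j) \<in> E \<and> i \<in> q.between a a' \<and> j \<in> q.between a a' \<and> q i < q j \<and> q.between i j \<noteq> {}")
      case True
      then obtain i j where "(i, j) \<in> E" "i \<in> q.between a a'" "j \<in> q.between a a'" "q i < q j" "q.between i j \<noteq> {}"
        by blast
      from q.nonpure_loss[OF hV aa(2)[symmetric] aa(3)[symmetric] d aa(1,4) small this] show ?thesis by (rule lossI)
    next
      case False
      have pure: "False" if st: "(s, t) \<in> E" "s \<in> q.between a a'" "t \<in> q.between a a'" "k \<in> V" "q s < q k" "q k < q t" for s t k
      proof -
        have "k \<in> q.between s t" using st by (simp add: q.between_def)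
        moreover have "q s < q t" using st by linarith
        ultimately show False using False st by blast
      qed
      have deg: "dg E s \<le> 10" if "s \<in> q.between a a'" for s by (rule q.between_bounded_degree[OF aa(1) that small])
      have "q.between a a' \<noteq> {}" using aa(5) by auto
      then obtain k where k: "k \<in> V" "q a < q k" "q k < q a'" by (auto simp: q.between_def)
      obtain b where b: "(a, b) \<in> E" "(b, a') \<in> E" "q a < q b" "q b < q a'"
        using q.triangle[OF aa(1,4) k] by blast
      have bK: "b \<in> q.between a a'" using b E_V(2)[OF b(1)] by (auto simp: q.between_def)
      have "q.between a a' \<subseteq> insert b (q.between a b \<union> q.between b a')"
        using q.pos_neq[of _ b] E_V(2)[OF b(1)] by (auto simp: q.between_def)
      then have "card (q.between a a') \<le> card (insert b (q.between a b \<union> q.between b a'))"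
        by (rule card_mono[rotated]) (simp add: q.finite_between)
      also have "\<dots> \<le> Suc (card (q.between a b \<union> q.between b a'))" by (rule card_insert_le_m1[of "Suc (card (q.between a b \<union> q.between b a'))", simplified]) auto
      also have "\<dots> \<le> Suc (card (q.between a b) + card (q.between b a'))" using card_Un_le by simp
      \<comment> \<open>This is why large means at least four vertices: three remain besides
        \<open>b\<close>, and two of them are on the same side.\<close>
      finally have two: "2 \<le> card (q.between a b) \<or> 2 \<le> card (q.between b a')" using aa(5) by linarith
      then show ?thesis
      proof
        assume "2 \<le> card (q.between a b)"
        from q.pure_fan_loss[OF hV aa(2)[symmetric] aa(3)[symmetric] d aa(1,4) deg pure b(1) bK this] show ?thesis by (rule pureI)
      next
        assume two': "2 \<le> card (q.between b a')"
        \<comment> \<open>Reflection moves \<open>a'\<close> to the left end, so that the fan at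
          \<open>a'\<close> becomes an instance of the same lemma.\<close>
        obtain r where "ordered_outer V E r" and r: "\<forall>u\<in>V. \<forall>v\<in>V. r u < r v \<longleftrightarrow> q v < q u" using q.reflect by blast
        then interpret r: ordered_outer V E r by simp
        have rb: "r.between u v = q.between v u" if "u \<in> V" "v \<in> V" for u v
          using that r by (auto simp: r.between_def q.between_def)
        have bV: "b \<in> V" using bK by (simp add: q.between_def)
        have KV: "s \<in> V" if "s \<in> q.between a a'" for s using that by (simp add: q.between_def)
        have "\<exists>e\<in>V. 3 * (2 * card (through1 E e) + 2 * card (through2 E e) + card (through3 E e)) \<le> 50 * card V + 1000"
        proof (rule r.pure_fan_loss[OF hV aa(3)[symmetric] aa(2)[symmetric] d(2,1) E_sym[OF aa(1)], where b = b, unfolded rb[OF V(2,1)] rb[OF V(2) bV]])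
          show "r a' < r a" using r V aa by auto
          show "dg E s \<le> 10" if "s \<in> q.between a a'" for s using deg[OF that] .
          show "(a', b) \<in> E" using b E_sym by blast
          show "b \<in> q.between a a'" by (rule bK)
          show "2 \<le> card (q.between b a')" by (rule two')
          show False if "(s, t) \<in> E" "s \<in> q.between a a'" "t \<in> q.between a a'" "k \<in> V" "r s < r k" "r k < r t" for s t k
            using pure[OF E_sym[OF that(1)] that(3,2,4)] that r KV by auto
        qed
        then show ?thesis by (rule pureI)
      qed
    qed
  next
    case False
    then have small: "\<And>i j. (i, j) \<in> E \<Longrightarrow> i \<noteq> h \<Longrightarrow> j \<noteq> h \<Longrightarrow> q i < q j \<Longrightarrow> card (q.between i j) \<le> 3"
      by (metis eval_nat_numeral(2) not_less_eq_eq numeral_3_eq_3 semiring_norm(26) semiring_norm(27))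
    obtain m where m: "m \<in> V" "\<And>v. v \<in> V \<Longrightarrow> q v \<le> q m"
      using ex_has_greatest_nat[of "\<lambda>v. v \<in> V" h q "Suc (Max (q ` V))"] hV finite_V by (metis Max_ge finite_imageI imageI le_imp_less_Suc)
    have z1V: "z1 \<in> V" "z2 \<in> V" using E_V[OF z(1)] by auto
    have "m \<noteq> h" using m(2)[OF z1V(1)] root[OF z1V(1) z(2)] by auto
    then have hm: "(h, m) \<in> E" using q.edge_maximal_ends[OF max hV root m(1) _ m(2)] by blast
    have "q z1 < q z2 \<or> q z2 < q z1" using q.pos_neq[OF z1V] z(1) E_irrefl by blast
    then have "\<exists>e\<in>V. q.loss e \<le> 14 * card V + 17000"
      using q.bounded_loss[OF hV root hm m(2) small z] q.bounded_loss[OF hV root hm m(2) small E_sym[OF z(1)] z(3,2,5,4)] by blast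
    then obtain e where "e \<in> V" "q.loss e \<le> 14 * card V + 17000" by blast
    then have "\<exists>e\<in>V. q.loss e \<le> 16 * card V + 17000" by (intro bexI[of _ e]) linarith+
    then show ?thesis by (rule lossI)
  qed
qed

text \<open>Tuples are counted by choosing their coordinates one after the other in any convenient
  order; \<open>f\<close> restores the order along the path. Four-vertex tuples use a unit value as
  fifth coordinate.\<close>

lemma card_le5:
  assumes A: "finite A" "card A \<le> k1"
    and B: "\<And>a. a \<in> A \<Longrightarrow> finite (B a) \<and> card (B a) \<le> k2"
    and C: "\<And>a b. a \<in> A \<Longrightarrow> b \<in> B a \<Longrightarrow> finite (C a b) \<and> card (C a b) \<le> k3"
    and D: "\<And>a b c. a \<in> A \<Longrightarrow> b \<in> B a \<Longrightarrow> c \<in> C a b \<Longrightarrow> finite (D a b c) \<and> card (D a b c) \<le> k4"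
    and F: "\<And>a b c d. a \<in> A \<Longrightarrow> b \<in> B a \<Longrightarrow> c \<in> C a b \<Longrightarrow> d \<in> D a b c \<Longrightarrow> finite (F a b c d) \<and> card (F a b c d) \<le> k5"
    and X: "\<And>x. x \<in> X \<Longrightarrow> \<exists>a b c d e. a \<in> A \<and> b \<in> B a \<and> c \<in> C a b \<and> d \<in> D a b c \<and> e \<in> F a b c d \<and> x = f a b c d e"
  shows "card X \<le> k1 * (k2 * (k3 * (k4 * k5)))"
proof -
  let ?S = "SIGMA a : A. SIGMA b : B a. SIGMA c : C a b. SIGMA d : D a b c. F a b c d"
  have fin: "finite ?S" using assms by (auto intro!: finite_SigmaI)
  have "X \<subseteq> (\<lambda>(a, b, c, d, e). f a b c d e) ` ?S"
  proof
    fix x assume "x \<in> X"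
    then obtain a b c d e where *: "a \<in> A" "b \<in> B a" "c \<in> C a b" "d \<in> D a b c" "e \<in> F a b c d" "x = f a b c d e"
      using X by blast
    then have "(a, b, c, d, e) \<in> ?S" by auto
    then show "x \<in> (\<lambda>(a, b, c, d, e). f a b c d e) ` ?S" using *(6) by (intro image_eqI[of _ _ "(a, b, c, d, e)"]) auto
  qed
  then have "card X \<le> card ?S" by (rule surj_card_le[OF fin])
  also have "\<dots> \<le> k1 * (k2 * (k3 * (k4 * k5)))"
    by (intro card_Sigma_le) (use assms in \<open>auto intro!: finite_SigmaI\<close>)
  finally show ?thesis .
qed

section \<open>Graphs in which the non-neighbours of the hub are independent\<close>

locale direct = rooted V E p a + triangulated V E p for V :: "'a set" and E p a +
  assumes indep: "\<And>z1 z2. (z1, z2) \<in> E \<Longrightarrow> z1 \<in> out \<Longrightarrow> z2 \<in> out \<Longrightarrow> False"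
begin

abbreviation D :: "'a set" where "D \<equiv> nb E a"
abbreviation NB :: "'a \<Rightarrow> 'a set" where "NB v \<equiv> nb E v - {a}"

lemma D_neq: "y \<in> D \<Longrightarrow> y \<noteq> a" using E_irrefl by auto
lemma out_neq: "z \<in> out \<Longrightarrow> z \<noteq> a" by (auto simp: out_def)

lemma NB_cases: "y \<in> NB v \<Longrightarrow> y \<in> D \<or> y \<in> out"
  using nb_V[of v] V_split(1) by blast

lemma nb_out: "z \<in> out \<Longrightarrow> nb E z \<subseteq> D"
proof
  fix y assume z: "z \<in> out" and "y \<in> nb E z"
  then have y: "(z, y) \<in> E" by simp
  have "y \<noteq> a" using y out_notin[OF z] E_sym by blast
  then have "y \<in> D \<or> y \<in> out" using y NB_cases[of y z] by simp
  then show "y \<in> D" using indep[OF y z] by blast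
qed

lemma card_D: "v \<noteq> a \<Longrightarrow> card (D \<inter> nb E v) \<le> 2" by (rule card_common_root)

lemma card_diff1: "finite S \<Longrightarrow> card S \<le> Suc m \<Longrightarrow> u \<in> S \<Longrightarrow> card (S - {u}) \<le> m"
  by (simp add: card_Diff_singleton)

lemma card_nb_out: "z \<in> out \<Longrightarrow> card (nb E z) \<le> 2"
  using card_D[of z] nb_out[of z] out_neq[of z] by (simp add: Int_absorb1)

lemma card_nb_out_diff: "z \<in> out \<Longrightarrow> y \<in> nb E z \<Longrightarrow> card (nb E z - {y}) \<le> 1"
  using card_diff1[of "nb E z" 1 y] card_nb_out[of z] by simp

lemma card_nb_out_diff': "z \<in> out \<Longrightarrow> z \<in> nb E y \<Longrightarrow> card (nb E z - {y}) \<le> 1"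
  using card_nb_out_diff[of z y] E_sym[of y z] by simp

lemma nb_outD: "z \<in> out \<Longrightarrow> (z, y) \<in> E \<Longrightarrow> (a, y) \<in> E" using nb_out[of z] by auto

lemma card_DD: "y \<in> D \<Longrightarrow> card (D \<inter> nb E y) \<le> 2" using card_D D_neq by blast

lemma card_DD_diff: "v \<in> D \<Longrightarrow> u \<in> D \<Longrightarrow> v \<in> nb E u \<Longrightarrow> card (D \<inter> nb E v - {u}) \<le> 1"
  using card_diff1[of "D \<inter> nb E v" 1 u] card_DD[of v] E_sym[of u v] by simp

text \<open>At most one on each side of \<open>y\<close>: below the longer of two such chords on one
  side, the third corner of the triangle is a neighbour of \<open>a\<close>, because
  \<open>out\<close> is independent, and the chord would pass over this wall.\<close>

lemma card_out: "y \<in> D \<Longrightarrow> card (out \<inter> nb E y) \<le> 2"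
proof -
  assume y: "y \<in> D"
  let ?L = "{z \<in> out \<inter> nb E y. p z < p y}" and ?R = "{z \<in> out \<inter> nb E y. p y < p z}"
  have eq: "u = v" if "u \<in> out" "v \<in> out" "p u < p v \<Longrightarrow> False" "p v < p u \<Longrightarrow> False" for u v
    using pos_neq[of u v] that out_V by blast
  have R: "card ?R \<le> 1"
  proof (rule card_le_1I, rule eq)
    have "False" if z: "z1 \<in> ?R" "z2 \<in> ?R" "p z1 < p z2" for z1 z2
    proof -
      have f: "(y, z2) \<in> E" "p y < p z2" "z1 \<in> V" "p y < p z1" "z2 \<in> out" using z out_V by auto
      obtain b where b: "(y, b) \<in> E" "(b, z2) \<in> E" "p y < p b" "p b < p z2"
        using triangle[OF f(1,2,3,4) z(3)] by blast
      have "b \<noteq> a" using b(3) p_root[of y] y by auto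
      then have "b \<in> D \<or> b \<in> out" using NB_cases[of b y] b by simp
      then have "(a, b) \<in> E" using indep[OF b(2) _ f(5)] by auto
      then show False using no_root_nb_between[of y b z2] y f(1) b by simp
    qed
    then show "p u < p v \<Longrightarrow> False" "p v < p u \<Longrightarrow> False" if "u \<in> ?R" "v \<in> ?R" for u v using that by blast+
  qed auto
  have L: "card ?L \<le> 1"
  proof (rule card_le_1I, rule eq)
    have "False" if z: "z1 \<in> ?L" "z2 \<in> ?L" "p z1 < p z2" for z1 z2
    proof -
      have f: "(z1, y) \<in> E" "p z1 < p y" "z2 \<in> V" "p z2 < p y" "z1 \<in> out" using z out_V E_sym by auto
      obtain b where b: "(z1, b) \<in> E" "(b, y) \<in> E" "p z1 < p b" "p b < p y"
        using triangle[OF f(1,2,3) z(3) f(4)] by blast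
      have "b \<noteq> a" using b(1) out_notin[OF f(5)] E_sym by blast
      then have "b \<in> D \<or> b \<in> out" using NB_cases[of b z1] b by simp
      then have "(a, b) \<in> E" using indep[OF b(1) f(5)] by auto
      then show False using no_root_nb_between'[of b z1 y] f b out_V out_neq by blast
    qed
    then show "p u < p v \<Longrightarrow> False" "p v < p u \<Longrightarrow> False" if "u \<in> ?L" "v \<in> ?L" for u v using that by blast+
  qed auto
  have "out \<inter> nb E y \<subseteq> ?L \<union> ?R" using p_lt[of y] by auto
  then have "card (out \<inter> nb E y) \<le> card (?L \<union> ?R)"
    by (rule card_mono[rotated]) (rule finite_subset[of _ "nb E y"], auto)
  also have "\<dots> \<le> card ?L + card ?R" by (rule card_Un_le)
  finally show ?thesis using L R by linarith
qed

lemma card_D_out_diff: "y \<in> D \<Longrightarrow> u \<in> out \<Longrightarrow> y \<in> nb E u \<Longrightarrow> card (out \<inter> nb E y - {u}) \<le> 1"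
  using card_diff1[of "out \<inter> nb E y" 1 u] card_out[of y] E_sym[of u y] by simp

lemma card_NB_diff: "y \<in> D \<Longrightarrow> y \<in> nb E u \<Longrightarrow> u \<noteq> a \<Longrightarrow> card (NB y - {u}) \<le> 3"
proof -
  assume y: "y \<in> D" and "y \<in> nb E u" "u \<noteq> a"
  then have u: "u \<in> NB y" using E_sym[of u y] by simp
  have "NB y \<subseteq> (D \<inter> nb E y) \<union> (out \<inter> nb E y)" using NB_cases[of _ y] by blast
  then have "card (NB y) \<le> card ((D \<inter> nb E y) \<union> (out \<inter> nb E y))" by (rule card_mono[rotated]) simp
  also have "\<dots> \<le> card (D \<inter> nb E y) + card (out \<inter> nb E y)" by (rule card_Un_le)
  finally have "card (NB y) \<le> 4" using card_D[OF D_neq[OF y]] card_out[OF y] by linarith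
  then show ?thesis using card_diff1[of "NB y" 3 u] u by simp
qed

lemma trips_empty: "trips (\<lambda>_ _ _. True) = {}" using indep by (auto simp: trips_def)

lemma card_apex_out: "card apex \<le> card out"
  by (rule card_mono[OF finite_out]) (auto simp: apex_def)

lemma sum_out_le2: "(\<Sum>z\<in>out. card (nb E a \<inter> nb E z)) \<le> 2 * card out"
  using sum_bounded_above[of out "\<lambda>z. card (nb E a \<inter> nb E z)" 2] card_D out_neq by simp

lemma walks3_le_indep: "card (walks3 E a) \<le> 2 * dg E a + 6 * card out"
  using walks3_sum sum_out_le2 card_apex_out trips_empty by simp

lemma walks2_le_indep: "card (walks2 E a) \<le> 2 * dg E a + 2 * card out"
  using walks2_sum sum_out_le2 by simp

text \<open>A path centred at \<open>a\<close> is an ordered pair of walks of length two, and no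
  walk is paired with itself. This linear saving enters the sign of the linear term.\<close>

lemma card_through3_le: "card (through3 E a) + card (walks2 E a) \<le> card (walks2 E a) * card (walks2 E a)"
proof -
  let ?W = "walks2 E a" and ?f = "\<lambda>(s1, s2, s4, s5). ((s2, s1), (s4, s5))"
  have inj: "inj_on ?f (through3 E a)" by (auto simp: inj_on_def)
  have "?f ` through3 E a \<subseteq> ?W \<times> ?W - Id_on ?W"
    using E_sym by (auto simp: through3_def paths5_def walks2_def)
  then have "card (through3 E a) \<le> card (?W \<times> ?W - Id_on ?W)"
    using card_image[OF inj] card_mono[of "?W \<times> ?W - Id_on ?W" "?f ` through3 E a"] by simp
  also have "\<dots> = card (?W \<times> ?W) - card (Id_on ?W)"
    by (rule card_Diff_subset) (auto simp: Id_on_def)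
  also have "card (Id_on ?W) = card ?W"
  proof -
    have "Id_on ?W = (\<lambda>x. (x, x)) ` ?W" by auto
    then show ?thesis by (simp add: card_image inj_on_def)
  qed
  finally have "card (through3 E a) \<le> card ?W * card ?W - card ?W" by (simp add: card_cartesian_product)
  moreover have "card ?W \<le> card ?W * card ?W" by (cases "card ?W") auto
  ultimately show ?thesis by linarith
qed

text \<open>Besides a walk of length three the path needs a neighbour of \<open>a\<close> that is
  not on the walk. Since \<open>out\<close> is independent, the walk \<open>y\<close>,
  \<open>b\<close>, \<open>z\<close> already uses two neighbours of \<open>a\<close>:
  \<open>y\<close> and one of \<open>b\<close>, \<open>z\<close>.\<close>

lemma card_through2_le: "card (through2 E a) + 2 * card (walks3 E a) \<le> dg E a * card (walks3 E a)"
proof -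
  let ?W = "walks3 E a" and ?S = "SIGMA w : walks3 E a. D - {fst w, fst (snd w), snd (snd w)}"
  let ?f = "\<lambda>(s1, s3, s4, s5). ((s3, s4, s5), s1)"
  have inj: "inj_on ?f (through2 E a)" by (auto simp: inj_on_def)
  have "?f ` through2 E a \<subseteq> ?S"
    using E_sym by (auto simp: through2_def paths5_def walks3_def)
  then have "card (through2 E a) \<le> card ?S"
    using card_image[OF inj] card_mono[of ?S "?f ` through2 E a"] by simp
  also have "card ?S = (\<Sum>w\<in>?W. card (D - {fst w, fst (snd w), snd (snd w)}))" by (simp add: card_SigmaI)
  finally have "card (through2 E a) + 2 * card ?W \<le> (\<Sum>w\<in>?W. card (D - {fst w, fst (snd w), snd (snd w)}) + 2)"
    by (simp only: sum.distrib sum_constant of_nat_id)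
  also have "\<dots> \<le> (\<Sum>w\<in>?W. dg E a)"
  proof (rule sum_mono)
    fix w assume w: "w \<in> ?W"
    obtain y b z where [simp]: "w = (y, b, z)" by (cases w)
    have e: "(a, y) \<in> E" "(y, b) \<in> E" "(b, z) \<in> E" "b \<noteq> a" "z \<noteq> a" "z \<noteq> y" using w by (auto simp: walks3_def)
    have "b \<noteq> y" using e E_irrefl by blast
    have "\<exists>c. c \<in> D \<and> c \<noteq> y \<and> c \<in> {b, z}"
    proof (cases "b \<in> D")
      case True then show ?thesis using \<open>b \<noteq> y\<close> by blast
    next
      case False
      then have "b \<in> out" using NB_cases[of b y] e by auto
      then have "z \<in> D" using nb_out[of b] e by auto
      then show ?thesis using e by blast
    qed
    then obtain c where c: "c \<in> D" "c \<noteq> y" "c \<in> {b, z}" by blast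
    have "card (D - {fst w, fst (snd w), snd (snd w)}) \<le> card (D - {y, c})"
      using c by (intro card_mono) auto
    also have "\<dots> = card D - card {y, c}" by (rule card_Diff_subset) (use c e in auto)
    finally have "card (D - {fst w, fst (snd w), snd (snd w)}) \<le> card D - 2" using c by simp
    moreover have "2 \<le> card D" using card_mono[of D "{y, c}"] c e by simp
    ultimately show "card (D - {fst w, fst (snd w), snd (snd w)}) + 2 \<le> dg E a" by (simp add: dg_def)
  qed
  finally show ?thesis by (simp add: mult.commute)
qed

text \<open>Within the neighbourhood of \<open>a\<close> each vertex has at most two neighbours, so
  after the first step a path there continues in at most one way; this keeps the coefficient of the
  degree at two. All other paths are charged to a vertex of \<open>out\<close>, with 4 + 4 + 6
  choices.\<close>

lemma card_through1_le: "card (through1 E a) \<le> 2 * dg E a + 14 * card out"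
proof -
  let ?T = "through1 E a"
  have T: "(a, v2) \<in> E" "(v2, v3) \<in> E" "(v3, v4) \<in> E" "(v4, v5) \<in> E" "distinct [a, v2, v3, v4, v5]"
    "(v3, v2) \<in> E" "(v4, v3) \<in> E" "(v5, v4) \<in> E"
    if "(v2, v3, v4, v5) \<in> ?T" for v2 v3 v4 v5 using that by (auto simp: through1_def paths5_def E_sym)
  define A1 A2 A3 A4 where "A1 = {(v2, v3, v4, v5) \<in> ?T. v3 \<in> D \<and> v4 \<in> D \<and> v5 \<in> D}"
    and "A2 = {(v2, v3, v4, v5) \<in> ?T. v3 \<in> D \<and> v4 \<in> D \<and> v5 \<in> out}"
    and "A3 = {(v2, v3, v4, v5) \<in> ?T. v3 \<in> D \<and> v4 \<in> out}"
    and "A4 = {(v2, v3, v4, v5) \<in> ?T. v3 \<in> out}"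
  have "?T \<subseteq> A1 \<union> A2 \<union> A3 \<union> A4"
  proof
    fix x assume x: "x \<in> ?T"
    obtain v2 v3 v4 v5 where [simp]: "x = (v2, v3, v4, v5)" by (cases x)
    have "v3 \<in> D \<or> v3 \<in> out" "v4 \<in> D \<or> v4 \<in> out" "v5 \<in> D \<or> v5 \<in> out"
      using T[of v2 v3 v4 v5] x NB_cases[of v3 v2] NB_cases[of v4 v3] NB_cases[of v5 v4] by auto
    then show "x \<in> A1 \<union> A2 \<union> A3 \<union> A4" using x by (auto simp: A1_def A2_def A3_def A4_def)
  qed
  moreover have "finite (A1 \<union> A2 \<union> A3 \<union> A4)"
    by (rule finite_subset[of _ ?T]) (auto simp: A1_def A2_def A3_def A4_def)
  ultimately have "card ?T \<le> card (A1 \<union> A2 \<union> A3 \<union> A4)" by (rule card_mono[rotated])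
  also have "\<dots> \<le> card A1 + card A2 + card A3 + card A4" by (intro order_trans[OF card_Un_le] add_mono order_refl)
  also have "card A1 \<le> dg E a * (2 * (1 * (1 * 1)))"
  proof (rule card_le5[where f = "\<lambda>v2 v3 v4 v5 (_::unit). (v2, v3, v4, v5)"
        and A = D and B = "\<lambda>v2. D \<inter> nb E v2" and C = "\<lambda>v2 v3. D \<inter> nb E v3 - {v2}"
        and D = "\<lambda>v2 v3 v4. D \<inter> nb E v4 - {v3}" and F = "\<lambda>_ _ _ _. {()}"])
    fix x assume "x \<in> A1"
    then obtain v2 v3 v4 v5 where "x = (v2, v3, v4, v5)" "(v2, v3, v4, v5) \<in> ?T" "v3 \<in> D" "v4 \<in> D" "v5 \<in> D"
      by (auto simp: A1_def)
    then show "\<exists>v2 v3 v4 v5 e. v2 \<in> D \<and> v3 \<in> D \<inter> nb E v2 \<and> v4 \<in> D \<inter> nb E v3 - {v2} \<and> v5 \<in> D \<inter> nb E v4 - {v3} \<and> e \<in> {()} \<and> x = (v2, v3, v4, v5)"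
      using T[of v2 v3 v4 v5] by - (rule exI[of _ v2], rule exI[of _ v3], rule exI[of _ v4], rule exI[of _ v5], rule exI[of _ "()"], auto)
  qed (use card_DD card_DD_diff in \<open>auto simp: dg_def\<close>)
  also have "card A2 \<le> card out * (2 * (2 * (1 * 1)))"
  proof (rule card_le5[where f = "\<lambda>v5 v4 v3 v2 (_::unit). (v2, v3, v4, v5)"
        and A = out and B = "\<lambda>v5. nb E v5" and C = "\<lambda>v5 v4. D \<inter> nb E v4"
        and D = "\<lambda>v5 v4 v3. D \<inter> nb E v3 - {v4}" and F = "\<lambda>_ _ _ _. {()}"])
    fix x assume "x \<in> A2"
    then obtain v2 v3 v4 v5 where "x = (v2, v3, v4, v5)" "(v2, v3, v4, v5) \<in> ?T" "v3 \<in> D" "v4 \<in> D" "v5 \<in> out"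
      by (auto simp: A2_def)
    then show "\<exists>v5 v4 v3 v2 e. v5 \<in> out \<and> v4 \<in> nb E v5 \<and> v3 \<in> D \<inter> nb E v4 \<and> v2 \<in> D \<inter> nb E v3 - {v4} \<and> e \<in> {()} \<and> x = (v2, v3, v4, v5)"
      using T[of v2 v3 v4 v5] by - (rule exI[of _ v5], rule exI[of _ v4], rule exI[of _ v3], rule exI[of _ v2], rule exI[of _ "()"], auto)
  qed (use card_nb_out card_DD card_DD_diff nb_outD finite_out in auto)
  also have "card A3 \<le> card out * (2 * (2 * (1 * 1)))"
  proof (rule card_le5[where f = "\<lambda>v4 v3 v2 v5 (_::unit). (v2, v3, v4, v5)"
        and A = out and B = "\<lambda>v4. nb E v4" and C = "\<lambda>v4 v3. D \<inter> nb E v3"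
        and D = "\<lambda>v4 v3 v2. nb E v4 - {v3}" and F = "\<lambda>_ _ _ _. {()}"])
    fix x assume "x \<in> A3"
    then obtain v2 v3 v4 v5 where "x = (v2, v3, v4, v5)" "(v2, v3, v4, v5) \<in> ?T" "v3 \<in> D" "v4 \<in> out"
      by (auto simp: A3_def)
    then show "\<exists>v4 v3 v2 v5 e. v4 \<in> out \<and> v3 \<in> nb E v4 \<and> v2 \<in> D \<inter> nb E v3 \<and> v5 \<in> nb E v4 - {v3} \<and> e \<in> {()} \<and> x = (v2, v3, v4, v5)"
      using T[of v2 v3 v4 v5] by - (rule exI[of _ v4], rule exI[of _ v3], rule exI[of _ v2], rule exI[of _ v5], rule exI[of _ "()"], auto)
  qed (use card_nb_out card_nb_out_diff card_DD nb_outD finite_out in auto)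
  also have "card A4 \<le> card out * (2 * (1 * (3 * 1)))"
  proof (rule card_le5[where f = "\<lambda>v3 v4 v2 v5 (_::unit). (v2, v3, v4, v5)"
        and A = out and B = "\<lambda>v3. nb E v3" and C = "\<lambda>v3 v4. nb E v3 - {v4}"
        and D = "\<lambda>v3 v4 v2. NB v4 - {v3}" and F = "\<lambda>_ _ _ _. {()}"])
    fix x assume "x \<in> A4"
    then obtain v2 v3 v4 v5 where "x = (v2, v3, v4, v5)" "(v2, v3, v4, v5) \<in> ?T" "v3 \<in> out"
      by (auto simp: A4_def)
    then show "\<exists>v3 v4 v2 v5 e. v3 \<in> out \<and> v4 \<in> nb E v3 \<and> v2 \<in> nb E v3 - {v4} \<and> v5 \<in> NB v4 - {v3} \<and> e \<in> {()} \<and> x = (v2, v3, v4, v5)"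
      using T[of v2 v3 v4 v5] by - (rule exI[of _ v3], rule exI[of _ v4], rule exI[of _ v2], rule exI[of _ v5], rule exI[of _ "()"], auto)
  next
    show "finite (NB v4 - {v3}) \<and> card (NB v4 - {v3}) \<le> 3" if "v3 \<in> out" "v4 \<in> nb E v3" for v3 v4 v2
      using card_NB_diff[of v4 v3] nb_outD[OF that(1)] that out_neq by auto
  qed (use card_nb_out card_nb_out_diff finite_out in auto)
  finally show ?thesis by simp
qed

text \<open>Paths inside the neighbourhood of \<open>a\<close> have two choices for the first step
  and one for each later step. Every other path is charged to a vertex of \<open>out\<close> on it,
  and the six patterns \<open>A1\<close> and \<open>A3\<close> to \<open>A7\<close> give 18 + 12 + 4
  + 12 + 12 + 2 = 60.\<close>

lemma card_paths5_del_le: "card (paths5 (del E a)) \<le> 2 * dg E a + 60 * card out"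
proof -
  let ?T = "paths5 (del E a)"
  have T: "(v1, v2) \<in> E" "(v2, v3) \<in> E" "(v3, v4) \<in> E" "(v4, v5) \<in> E" "distinct [a, v1, v2, v3, v4, v5]"
    "(v2, v1) \<in> E" "(v3, v2) \<in> E" "(v4, v3) \<in> E" "(v5, v4) \<in> E"
    if "(v1, v2, v3, v4, v5) \<in> ?T" for v1 v2 v3 v4 v5 using that by (auto simp: del_def paths5_def E_sym)
  have "?T \<subseteq> paths5 E" by (auto simp: paths5_def del_def)
  then have finT: "finite ?T" by (rule finite_subset[OF _ finite_paths5])
  have n3: "finite (NB y - {u}) \<and> card (NB y - {u}) \<le> 3" if "(a, y) \<in> E" "(u, y) \<in> E" "u \<noteq> a" for y u
    using card_NB_diff[of y u] that by simp
  define A1 A2 A3 A4 A5 A6 A7 where "A1 = {(v1, v2, v3, v4, v5) \<in> ?T. v3 \<in> out}"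
    and "A2 = {(v1, v2, v3, v4, v5) \<in> ?T. v1 \<in> D \<and> v2 \<in> D \<and> v3 \<in> D \<and> v4 \<in> D \<and> v5 \<in> D}"
    and "A3 = {(v1, v2, v3, v4, v5) \<in> ?T. v1 \<in> out \<and> v3 \<in> D \<and> v4 \<in> D}"
    and "A4 = {(v1, v2, v3, v4, v5) \<in> ?T. v1 \<in> D \<and> v2 \<in> D \<and> v3 \<in> D \<and> v4 \<in> D \<and> v5 \<in> out}"
    and "A5 = {(v1, v2, v3, v4, v5) \<in> ?T. v2 \<in> out \<and> v3 \<in> D \<and> v4 \<in> D}"
    and "A6 = {(v1, v2, v3, v4, v5) \<in> ?T. v2 \<in> D \<and> v3 \<in> D \<and> v4 \<in> out}"
    and "A7 = {(v1, v2, v3, v4, v5) \<in> ?T. v2 \<in> out \<and> v3 \<in> D \<and> v4 \<in> out}"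
  have "?T \<subseteq> A1 \<union> A2 \<union> A3 \<union> A4 \<union> A5 \<union> A6 \<union> A7"
  proof
    fix x assume x: "x \<in> ?T"
    obtain v1 v2 v3 v4 v5 where [simp]: "x = (v1, v2, v3, v4, v5)" by (cases x)
    have d: "v1 \<in> D \<or> v1 \<in> out" "v2 \<in> D \<or> v2 \<in> out" "v3 \<in> D \<or> v3 \<in> out" "v4 \<in> D \<or> v4 \<in> out" "v5 \<in> D \<or> v5 \<in> out"
      using T[of v1 v2 v3 v4 v5] x NB_cases[of v1 v2] NB_cases[of v2 v1] NB_cases[of v3 v2] NB_cases[of v4 v3] NB_cases[of v5 v4] by auto
    show "x \<in> A1 \<union> A2 \<union> A3 \<union> A4 \<union> A5 \<union> A6 \<union> A7"
      using d x unfolding A1_def A2_def A3_def A4_def A5_def A6_def A7_def by simp blast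
  qed
  moreover have "finite (A1 \<union> A2 \<union> A3 \<union> A4 \<union> A5 \<union> A6 \<union> A7)"
    by (rule finite_subset[OF _ finT]) (auto simp: A1_def A2_def A3_def A4_def A5_def A6_def A7_def)
  ultimately have "card ?T \<le> card (A1 \<union> A2 \<union> A3 \<union> A4 \<union> A5 \<union> A6 \<union> A7)" by (rule card_mono[rotated])
  also have "\<dots> \<le> card A1 + card A2 + card A3 + card A4 + card A5 + card A6 + card A7" by (intro order_trans[OF card_Un_le] add_mono order_refl)
  also have "card A1 \<le> card out * (2 * (1 * (3 * 3)))"
  proof (rule card_le5[where f = "\<lambda>v3 v2 v4 v1 v5. (v1, v2, v3, v4, v5)"
        and A = "out" and B = "\<lambda>v3. nb E v3" and C = "\<lambda>v3 v2. nb E v3 - {v2}" and D = "\<lambda>v3 v2 v4. NB v2 - {v3}" and F = "\<lambda>v3 v2 v4 v1. NB v4 - {v3}"])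
    fix x assume "x \<in> A1"
    then obtain v1 v2 v3 v4 v5 where x: "x = (v1, v2, v3, v4, v5)" "(v1, v2, v3, v4, v5) \<in> ?T" "v3 \<in> out"
      unfolding A1_def by blast
    show "\<exists>v3 v2 v4 v1 v5. v3 \<in> out \<and> v2 \<in> nb E v3 \<and> v4 \<in> nb E v3 - {v2} \<and> v1 \<in> NB v2 - {v3} \<and> v5 \<in> NB v4 - {v3} \<and> x = (v1, v2, v3, v4, v5)"
      using x(1,3) T[OF x(2)] by - (rule exI[of _ v3], rule exI[of _ v2], rule exI[of _ v4], rule exI[of _ v1], rule exI[of _ v5], auto)
  qed (use n3 card_nb_out card_nb_out_diff card_nb_out_diff' card_DD card_DD_diff card_D_out_diff nb_outD finite_out out_neq D_neq in \<open>auto simp: dg_def\<close>)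
  also have "card A2 \<le> dg E a * (2 * (1 * (1 * 1)))"
  proof (rule card_le5[where f = "\<lambda>v1 v2 v3 v4 v5. (v1, v2, v3, v4, v5)"
        and A = "D" and B = "\<lambda>v1. D \<inter> nb E v1" and C = "\<lambda>v1 v2. D \<inter> nb E v2 - {v1}" and D = "\<lambda>v1 v2 v3. D \<inter> nb E v3 - {v2}" and F = "\<lambda>v1 v2 v3 v4. D \<inter> nb E v4 - {v3}"])
    fix x assume "x \<in> A2"
    then obtain v1 v2 v3 v4 v5 where x: "x = (v1, v2, v3, v4, v5)" "(v1, v2, v3, v4, v5) \<in> ?T" "v1 \<in> D \<and> v2 \<in> D \<and> v3 \<in> D \<and> v4 \<in> D \<and> v5 \<in> D"
      unfolding A2_def by blast
    show "\<exists>v1 v2 v3 v4 v5. v1 \<in> D \<and> v2 \<in> D \<inter> nb E v1 \<and> v3 \<in> D \<inter> nb E v2 - {v1} \<and> v4 \<in> D \<inter> nb E v3 - {v2} \<and> v5 \<in> D \<inter> nb E v4 - {v3} \<and> x = (v1, v2, v3, v4, v5)"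
      using x(1,3) T[OF x(2)] by - (rule exI[of _ v1], rule exI[of _ v2], rule exI[of _ v3], rule exI[of _ v4], rule exI[of _ v5], auto)
  qed (use n3 card_nb_out card_nb_out_diff card_nb_out_diff' card_DD card_DD_diff card_D_out_diff nb_outD finite_out out_neq D_neq in \<open>auto simp: dg_def\<close>)
  also have "card A3 \<le> card out * (2 * (2 * (1 * 3)))"
  proof (rule card_le5[where f = "\<lambda>v1 v2 v3 v4 v5. (v1, v2, v3, v4, v5)"
        and A = "out" and B = "\<lambda>v1. nb E v1" and C = "\<lambda>v1 v2. D \<inter> nb E v2" and D = "\<lambda>v1 v2 v3. D \<inter> nb E v3 - {v2}" and F = "\<lambda>v1 v2 v3 v4. NB v4 - {v3}"])
    fix x assume "x \<in> A3"
    then obtain v1 v2 v3 v4 v5 where x: "x = (v1, v2, v3, v4, v5)" "(v1, v2, v3, v4, v5) \<in> ?T" "v1 \<in> out \<and> v3 \<in> D \<and> v4 \<in> D"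
      unfolding A3_def by blast
    show "\<exists>v1 v2 v3 v4 v5. v1 \<in> out \<and> v2 \<in> nb E v1 \<and> v3 \<in> D \<inter> nb E v2 \<and> v4 \<in> D \<inter> nb E v3 - {v2} \<and> v5 \<in> NB v4 - {v3} \<and> x = (v1, v2, v3, v4, v5)"
      using x(1,3) T[OF x(2)] by - (rule exI[of _ v1], rule exI[of _ v2], rule exI[of _ v3], rule exI[of _ v4], rule exI[of _ v5], auto)
  qed (use n3 card_nb_out card_nb_out_diff card_nb_out_diff' card_DD card_DD_diff card_D_out_diff nb_outD finite_out out_neq D_neq in \<open>auto simp: dg_def\<close>)
  also have "card A4 \<le> card out * (2 * (2 * (1 * 1)))"
  proof (rule card_le5[where f = "\<lambda>v5 v4 v3 v2 v1. (v1, v2, v3, v4, v5)"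
        and A = "out" and B = "\<lambda>v5. nb E v5" and C = "\<lambda>v5 v4. D \<inter> nb E v4" and D = "\<lambda>v5 v4 v3. D \<inter> nb E v3 - {v4}" and F = "\<lambda>v5 v4 v3 v2. D \<inter> nb E v2 - {v3}"])
    fix x assume "x \<in> A4"
    then obtain v1 v2 v3 v4 v5 where x: "x = (v1, v2, v3, v4, v5)" "(v1, v2, v3, v4, v5) \<in> ?T" "v1 \<in> D \<and> v2 \<in> D \<and> v3 \<in> D \<and> v4 \<in> D \<and> v5 \<in> out"
      unfolding A4_def by blast
    show "\<exists>v5 v4 v3 v2 v1. v5 \<in> out \<and> v4 \<in> nb E v5 \<and> v3 \<in> D \<inter> nb E v4 \<and> v2 \<in> D \<inter> nb E v3 - {v4} \<and> v1 \<in> D \<inter> nb E v2 - {v3} \<and> x = (v1, v2, v3, v4, v5)"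
      using x(1,3) T[OF x(2)] by - (rule exI[of _ v5], rule exI[of _ v4], rule exI[of _ v3], rule exI[of _ v2], rule exI[of _ v1], auto)
  qed (use n3 card_nb_out card_nb_out_diff card_nb_out_diff' card_DD card_DD_diff card_D_out_diff nb_outD finite_out out_neq D_neq in \<open>auto simp: dg_def\<close>)
  also have "card A5 \<le> card out * (2 * (1 * (2 * 3)))"
  proof (rule card_le5[where f = "\<lambda>v2 v3 v1 v4 v5. (v1, v2, v3, v4, v5)"
        and A = "out" and B = "\<lambda>v2. nb E v2" and C = "\<lambda>v2 v3. nb E v2 - {v3}" and D = "\<lambda>v2 v3 v1. D \<inter> nb E v3" and F = "\<lambda>v2 v3 v1 v4. NB v4 - {v3}"])
    fix x assume "x \<in> A5"
    then obtain v1 v2 v3 v4 v5 where x: "x = (v1, v2, v3, v4, v5)" "(v1, v2, v3, v4, v5) \<in> ?T" "v2 \<in> out \<and> v3 \<in> D \<and> v4 \<in> D"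
      unfolding A5_def by blast
    show "\<exists>v2 v3 v1 v4 v5. v2 \<in> out \<and> v3 \<in> nb E v2 \<and> v1 \<in> nb E v2 - {v3} \<and> v4 \<in> D \<inter> nb E v3 \<and> v5 \<in> NB v4 - {v3} \<and> x = (v1, v2, v3, v4, v5)"
      using x(1,3) T[OF x(2)] by - (rule exI[of _ v2], rule exI[of _ v3], rule exI[of _ v1], rule exI[of _ v4], rule exI[of _ v5], auto)
  qed (use n3 card_nb_out card_nb_out_diff card_nb_out_diff' card_DD card_DD_diff card_D_out_diff nb_outD finite_out out_neq D_neq in \<open>auto simp: dg_def\<close>)
  also have "card A6 \<le> card out * (2 * (1 * (2 * 3)))"
  proof (rule card_le5[where f = "\<lambda>v4 v3 v5 v2 v1. (v1, v2, v3, v4, v5)"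
        and A = "out" and B = "\<lambda>v4. nb E v4" and C = "\<lambda>v4 v3. nb E v4 - {v3}" and D = "\<lambda>v4 v3 v5. D \<inter> nb E v3" and F = "\<lambda>v4 v3 v5 v2. NB v2 - {v3}"])
    fix x assume "x \<in> A6"
    then obtain v1 v2 v3 v4 v5 where x: "x = (v1, v2, v3, v4, v5)" "(v1, v2, v3, v4, v5) \<in> ?T" "v2 \<in> D \<and> v3 \<in> D \<and> v4 \<in> out"
      unfolding A6_def by blast
    show "\<exists>v4 v3 v5 v2 v1. v4 \<in> out \<and> v3 \<in> nb E v4 \<and> v5 \<in> nb E v4 - {v3} \<and> v2 \<in> D \<inter> nb E v3 \<and> v1 \<in> NB v2 - {v3} \<and> x = (v1, v2, v3, v4, v5)"
      using x(1,3) T[OF x(2)] by - (rule exI[of _ v4], rule exI[of _ v3], rule exI[of _ v5], rule exI[of _ v2], rule exI[of _ v1], auto)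
  qed (use n3 card_nb_out card_nb_out_diff card_nb_out_diff' card_DD card_DD_diff card_D_out_diff nb_outD finite_out out_neq D_neq in \<open>auto simp: dg_def\<close>)
  also have "card A7 \<le> card out * (2 * (1 * (1 * 1)))"
  proof (rule card_le5[where f = "\<lambda>v2 v3 v1 v4 v5. (v1, v2, v3, v4, v5)"
        and A = "out" and B = "\<lambda>v2. nb E v2" and C = "\<lambda>v2 v3. nb E v2 - {v3}" and D = "\<lambda>v2 v3 v1. out \<inter> nb E v3 - {v2}" and F = "\<lambda>v2 v3 v1 v4. nb E v4 - {v3}"])
    fix x assume "x \<in> A7"
    then obtain v1 v2 v3 v4 v5 where x: "x = (v1, v2, v3, v4, v5)" "(v1, v2, v3, v4, v5) \<in> ?T" "v2 \<in> out \<and> v3 \<in> D \<and> v4 \<in> out"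
      unfolding A7_def by blast
    show "\<exists>v2 v3 v1 v4 v5. v2 \<in> out \<and> v3 \<in> nb E v2 \<and> v1 \<in> nb E v2 - {v3} \<and> v4 \<in> out \<inter> nb E v3 - {v2} \<and> v5 \<in> nb E v4 - {v3} \<and> x = (v1, v2, v3, v4, v5)"
      using x(1,3) T[OF x(2)] by - (rule exI[of _ v2], rule exI[of _ v3], rule exI[of _ v1], rule exI[of _ v4], rule exI[of _ v5], auto)
  qed (use n3 card_nb_out card_nb_out_diff card_nb_out_diff' card_DD card_DD_diff card_D_out_diff nb_outD finite_out out_neq D_neq in \<open>auto simp: dg_def\<close>)
  finally show ?thesis by simp
qed

lemma direct_bound:
  assumes "2 \<le> dg E a"
  shows "real (card (paths5 E)) \<le> 17 / 2 * (real (card V))\<^sup>2 - 9 / 2 * real (card V) + 150"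
proof -
  define d k w2 w3 where "d = real (dg E a)" and "k = real (card out)" and "w2 = real (card (walks2 E a))"
    and "w3 = real (card (walks3 E a))"
  have n: "real (card V) = 1 + d + k" using card_V by (simp add: d_def k_def)
  have "card (paths5 E) + card (walks2 E a) + 4 * card (walks3 E a) \<le>
     (2 * dg E a + 60 * card out) + 2 * (2 * dg E a + 14 * card out) + 2 * (dg E a * card (walks3 E a))
       + card (walks2 E a) * card (walks2 E a)"
    using card_paths5_del[of a] card_paths5_del_le card_through1_le card_through2_le card_through3_le by simp
  then have "real (card (paths5 E) + card (walks2 E a) + 4 * card (walks3 E a)) \<le> real ((2 * dg E a + 60 * card out)
       + 2 * (2 * dg E a + 14 * card out) + 2 * (dg E a * card (walks3 E a))
       + card (walks2 E a) * card (walks2 E a))"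
    by (rule of_nat_mono)
  then have Q: "real (card (paths5 E)) \<le> 6 * d + 88 * k + 2 * ((d - 2) * w3) + (w2 * w2 - w2)"
    by (simp add: d_def k_def w2_def w3_def algebra_simps)
  \<comment> \<open>The saving of two per walk makes \<open>d - 2\<close> the coefficient of
    \<open>w3\<close>; the degree assumption keeps it nonnegative, so that \<open>w3\<close> may be
    replaced by its upper bound.\<close>
  have "d - 2 \<ge> 0" "w3 \<le> 2 * d + 6 * k" using assms walks3_le_indep by (auto simp: d_def k_def w3_def)
  then have w3: "(d - 2) * w3 \<le> (d - 2) * (2 * d + 6 * k)" by (intro mult_left_mono) auto
  have w2: "w2 * w2 - w2 \<le> (2 * d + 2 * k) * (2 * d + 2 * k) - (2 * d + 2 * k)"
  proof -
    have le: "w2 \<le> 2 * d + 2 * k" using walks2_le_indep by (simp add: d_def k_def w2_def)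
    have "2 * d + 2 * k \<ge> 1" using \<open>d - 2 \<ge> 0\<close> by (simp add: k_def)
    moreover have "0 \<le> w2" by (simp add: w2_def)
    \<comment> \<open>The product is the difference of the values of x * x - x at the bound and at
      \<open>w2\<close>.\<close>
    ultimately have "0 \<le> (2 * d + 2 * k - w2) * (2 * d + 2 * k + w2 - 1)"
      using le by (intro mult_nonneg_nonneg) auto
    then show ?thesis by (simp add: algebra_simps)
  qed
  have "real (card (paths5 E)) \<le> 6 * d + 88 * k + 2 * ((d - 2) * (2 * d + 6 * k))
      + ((2 * d + 2 * k) * (2 * d + 2 * k) - (2 * d + 2 * k))"
    using Q w3 w2 by linarith
  \<comment> \<open>Completing the square: up to the shift 33 the square is that of 2 (d - 3k), so
    it vanishes near the optimum d = 3k. The shift and the constant are chosen to turn the linear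
    part into exactly -9/2 times the number of vertices.\<close>
  also have "\<dots> = 17 / 2 * (1 + d + k)\<^sup>2 - 9 / 2 * (1 + d + k) + 1057 / 8 - (8 * d - 6 * (d + k) + 33)\<^sup>2 / 8"
    by (simp add: power2_eq_square field_simps)
  also have "\<dots> \<le> 17 / 2 * (1 + d + k)\<^sup>2 - 9 / 2 * (1 + d + k) + 150"
    using zero_le_power2[of "8 * d - 6 * (d + k) + 33"] by linarith
  finally show ?thesis unfolding n .
qed

end

lemma paths5_mono: "E \<subseteq> E' \<Longrightarrow> paths5 E \<subseteq> paths5 E'"
  by (auto simp: paths5_def)

lemma finite_max_exists:
  fixes f :: "'a \<Rightarrow> nat"
  assumes "finite S" "S \<noteq> {}"
  shows "\<exists>x\<in>S. \<forall>y\<in>S. f y \<le> f x"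
proof -
  have "Max (f ` S) \<in> f ` S" using assms by (intro Max_in) auto
  then obtain x where "x \<in> S" "f x = Max (f ` S)" by auto
  then show ?thesis using Max_ge[of "f ` S"] assms(1) by (intro bexI[of _ x]) auto
qed

lemma (in ordered_outer) maximal_step:
  assumes max: "edge_maximal V E" and n: "3 \<le> card V"
  shows "real (card (paths5 E)) \<le> 17 / 2 * (real (card V))\<^sup>2 - 9 / 2 * real (card V) + 150 \<or>
    (\<exists>e\<in>V. 3 * card (paths5 E) \<le> 3 * card (paths5 (del E e)) + 50 * card V + 51000)"
proof -
  have "V \<noteq> {}" using n by auto
  then obtain h where h: "h \<in> V" "\<And>v. v \<in> V \<Longrightarrow> dg E v \<le> dg E h"
    using finite_max_exists[of V "dg E"] finite_V by blast
  show ?thesis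
  proof (cases "\<exists>z1 z2. (z1, z2) \<in> E \<and> z1 \<noteq> h \<and> z2 \<noteq> h \<and> (h, z1) \<notin> E \<and> (h, z2) \<notin> E")
    case True
    then obtain z1 z2 where z: "(z1, z2) \<in> E" "z1 \<noteq> h" "z2 \<noteq> h" "(h, z1) \<notin> E" "(h, z2) \<notin> E" by blast
    obtain e where e: "e \<in> V"
      "3 * (2 * card (through1 E e) + 2 * card (through2 E e) + card (through3 E e)) \<le> 50 * card V + 51000"
      using cheap_vertex[OF max h z] by blast
    then have "3 * card (paths5 E) \<le> 3 * card (paths5 (del E e)) + 50 * card V + 51000"
      using card_paths5_del[of e] by simp
    then show ?thesis using e(1) by blast
  next
    case False
    obtain q where "rooted V E q h" using rootedE[OF h(1)] .
    then interpret q: rooted V E q h .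
    interpret q: triangulated V E q by (rule q.edge_maximal_triangulated[OF max])
    interpret q: direct V E q h
    proof unfold_locales
      show False if "(z1, z2) \<in> E" "z1 \<in> q.out" "z2 \<in> q.out" for z1 z2
        using False that by (auto simp: q.out_def)
    qed
    obtain m where m: "m \<in> V" "\<And>v. v \<in> V \<Longrightarrow> q v \<le> q m"
      using finite_max_exists[of V q] finite_V \<open>V \<noteq> {}\<close> by blast
    \<comment> \<open>A third vertex gives \<open>h\<close> degree at least two: it is joined to the
      last vertex \<open>m\<close> and to the third corner of the triangle below that edge.\<close>
    have "\<not> V \<subseteq> {h, m}"
    proof
      assume "V \<subseteq> {h, m}"
      from card_mono[OF _ this] have "card V \<le> card {h, m}" by simp
      also have "\<dots> \<le> 2" by (simp add: card_insert_if)
      finally show False using n by simp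
    qed
    then obtain k where k: "k \<in> V" "k \<noteq> h" "k \<noteq> m" by blast
    have km: "q k < q m" using m(2)[OF k(1)] q.pos_neq[OF k(1) m(1) k(3)] by auto
    have hk: "q h < q k" using q.root[OF k(1,2)] .
    have "m \<noteq> h" using km hk by auto
    then have hm: "(h, m) \<in> E" using q.edge_maximal_ends[OF max h(1) q.root m(1) _ m(2)] by blast
    have "q h < q m" using km hk by simp
    then obtain b where b: "(h, b) \<in> E" "q b < q m" using q.triangle[OF hm _ k(1) hk km] by blast
    then have "card {b, m} \<le> dg E h" unfolding dg_def using hm by (intro card_mono) auto
    moreover have "b \<noteq> m" using b by auto
    ultimately have "2 \<le> dg E h" by simp
    then show ?thesis using q.direct_bound by blast
  qed
qed

section \<open>The quadratic bound by induction on the number of vertices\<close>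

lemma outer_del:
  assumes "outer V E"
  shows "outer (V - {e}) (del E e)"
proof (rule outer_subset[OF assms])
  have "sym E" "E \<subseteq> V \<times> V" using assms by (auto simp: outer_def ordered_outer_def sgraph_def)
  then show "del E e \<subseteq> E \<inter> (V - {e}) \<times> (V - {e})" "sym (del E e)" by (auto simp: del_def sym_def)
qed auto

text \<open>The trivial count n^5 for all n < 60000. Beyond that the induction has room: the bound
  grows by 17n - 19/2 and the deleted vertex costs at most 50/3 n + 17000, so any n from about 51029
  on would do.\<close>

definition paths5_const :: real where "paths5_const = 60000 ^ 5"

theorem outer_paths5_bound:
  assumes "outer V E"
  shows "real (card (paths5 E)) \<le> 17 / 2 * (real (card V))\<^sup>2 - real (card V) + paths5_const"
  using assms
proof (induction "card V" arbitrary: V E rule: less_induct)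
  case less
  obtain p where "ordered_outer V E p" using less.prems by (auto simp: outer_def)
  then interpret o: ordered_outer V E p .
  let ?n = "real (card V)"
  have sq: "?n \<le> ?n\<^sup>2" by (cases "card V") (auto simp: power2_eq_square)
  show ?case
  proof (cases "card V < 60000")
    case True
    have "card (paths5 E) \<le> card (V \<times> V \<times> V \<times> V \<times> V)"
      by (rule card_mono[OF _ o.paths5_V]) (simp add: o.finite_V)
    also have "\<dots> = card V ^ 5" by (simp add: card_cartesian_product power_numeral_reduce)
    finally have "real (card (paths5 E)) \<le> real (card V ^ 5)" by (rule of_nat_mono)
    also have "\<dots> = ?n ^ 5" by simp
    also have "\<dots> \<le> paths5_const" unfolding paths5_const_def by (intro power_mono) (use True in auto)
    finally have "real (card (paths5 E)) \<le> paths5_const" .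
    then show ?thesis using sq by linarith
  next
    case False
    obtain E' where E': "E \<subseteq> E'" "edge_maximal V E'" using edge_maximal_exists[OF less.prems] by blast
    then obtain p' where "ordered_outer V E' p'" by (auto simp: edge_maximal_def outer_def)
    then interpret m: ordered_outer V E' p' .
    have QQ: "card (paths5 E) \<le> card (paths5 E')" by (rule card_mono[OF m.finite_paths5 paths5_mono[OF E'(1)]])
    have "3 \<le> card V" using False by simp
    from m.maximal_step[OF E'(2) this] show ?thesis
    proof
      assume "real (card (paths5 E')) \<le> 17 / 2 * ?n\<^sup>2 - 9 / 2 * ?n + 150"
      moreover have "real (card (paths5 E)) \<le> real (card (paths5 E'))" using QQ by simp
      moreover have "150 \<le> paths5_const" unfolding paths5_const_def by simp
      ultimately show ?thesis by linarith
    next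
      assume "\<exists>e\<in>V. 3 * card (paths5 E') \<le> 3 * card (paths5 (del E' e)) + 50 * card V + 51000"
      then obtain e where e: "e \<in> V" "3 * card (paths5 E') \<le> 3 * card (paths5 (del E' e)) + 50 * card V + 51000" by blast
      have "real (card V) = real (Suc (card (V - {e})))" using card.remove[OF m.finite_V e(1)] by (rule arg_cong)
      then have c: "card (V - {e}) < card V" "real (card (V - {e})) = ?n - 1"
        using card_Diff1_less[OF m.finite_V e(1)] unfolding of_nat_Suc by linarith+
      have "outer V E'" using E'(2) by (simp add: edge_maximal_def)
      from less.hyps[OF c(1) outer_del[OF this]]
      have IH: "real (card (paths5 (del E' e))) \<le> 17 / 2 * (?n - 1)\<^sup>2 - (?n - 1) + paths5_const"
        unfolding c(2) .
      have "real (3 * card (paths5 E')) \<le> real (3 * card (paths5 (del E' e)) + 50 * card V + 51000)"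
        using e(2) by (rule of_nat_mono)
      then have "3 * real (card (paths5 E')) \<le> 3 * real (card (paths5 (del E' e))) + 50 * ?n + 51000" by simp
      moreover have "(?n - 1)\<^sup>2 = ?n\<^sup>2 - 2 * ?n + 1" by (simp add: power2_eq_square algebra_simps)
      moreover have "60000 \<le> ?n" using False by simp
      moreover have "real (card (paths5 E)) \<le> real (card (paths5 E'))" using QQ by simp
      ultimately show ?thesis using IH by linarith
    qed
  qed
qed

section \<open>From plane drawings to noncrossing orders\<close>

lemma inside_or_outside_connected:
  fixes S T :: "complex set"
  assumes "connected T" "S \<inter> T = {}"
  shows "T \<subseteq> inside S \<or> T \<subseteq> outside S"
  using assms inside_outside_intersect_connected[of T S] inside_Un_outside[of S] by blast

lemma arc_endless_closure:
  fixes g :: "real \<Rightarrow> complex"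
  assumes "arc g" "pathstart g = a" "pathfinish g = b"
  shows "closure (path_image g - {a,b}) = path_image g"
proof
  show "closure (path_image g - {a,b}) \<subseteq> path_image g"
    by (rule closure_minimal) (use assms closed_arc_image in auto)
  have eq: "path_image g - {a,b} = g ` {0<..<1}"
    using simple_path_endless[OF arc_imp_simple_path[OF assms(1)]] assms by simp
  have "continuous_on (closure {0<..<1}) g"
    using assms(1) by (simp add: arc_def path_def)
  then have "g ` closure {0<..<1} \<subseteq> closure (g ` {0<..<1})"
    by (rule image_closure_subset) (auto simp: closure_subset)
  then show "path_image g \<subseteq> closure (path_image g - {a,b})"
    unfolding eq by (simp add: path_image_def)
qed

locale theta_curve =
  fixes c1 c2 c3 :: "real \<Rightarrow> complex" and a b :: complex
  assumes arcs: "arc c1" "arc c2" "arc c3"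
    and starts: "pathstart c1 = a" "pathstart c2 = a" "pathstart c3 = a"
    and finishes: "pathfinish c1 = b" "pathfinish c2 = b" "pathfinish c3 = b"
    and meets: "path_image c1 \<inter> path_image c2 = {a,b}" "path_image c1 \<inter> path_image c3 = {a,b}"
      "path_image c2 \<inter> path_image c3 = {a,b}"
begin

lemma rotate: "theta_curve c2 c3 c1 a b"
  using arcs starts finishes meets by unfold_locales auto

lemma swap: "theta_curve c2 c1 c3 a b"
  using arcs starts finishes meets by unfold_locales auto

lemma ends_distinct: "a \<noteq> b"
  using arcs(1) starts(1) finishes(1) arc_distinct_ends by blast

lemma open_arc_connected: "connected (path_image c3 - {a,b})"
  using connected_simple_path_endless[OF arc_imp_simple_path[OF arcs(3)]] starts finishes by simp

lemma open_arc_nonempty: "path_image c3 - {a,b} \<noteq> {}"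
  using simple_path_endless[OF arc_imp_simple_path[OF arcs(3)]] starts finishes
  by (metis arcs(3) arc_imp_simple_path nonempty_simple_path_endless)

lemma simple_loop: "simple_path (c1 +++ reversepath c2)"
  "pathfinish (c1 +++ reversepath c2) = pathstart (c1 +++ reversepath c2)"
  "path_image (c1 +++ reversepath c2) = path_image c1 \<union> path_image c2"
  using arcs starts finishes meets
  by (auto simp: simple_path_join_loop_eq arc_reversepath path_image_join)

lemma open_arc_cases:
  "path_image c3 - {a,b} \<subseteq> inside (path_image c1 \<union> path_image c2) \<or>
   path_image c3 - {a,b} \<subseteq> outside (path_image c1 \<union> path_image c2)"
  by (rule inside_or_outside_connected) (use open_arc_connected meets in auto)

text \<open>The region bounded by \<open>c1\<close> and \<open>c2\<close> is connected and misses
  \<open>c2\<close> and \<open>c3\<close>, so it lies entirely inside or outside their loop. If it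
  were inside, its closure would carry the open arc of \<open>c1\<close> inside as well.\<close>

lemma inside_disjoint:
  assumes "path_image c3 - {a,b} \<subseteq> outside (path_image c1 \<union> path_image c2)"
    and "path_image c1 - {a,b} \<subseteq> outside (path_image c2 \<union> path_image c3)"
    and z: "z \<in> inside (path_image c1 \<union> path_image c2)"
  shows "z \<in> outside (path_image c2 \<union> path_image c3)"
proof -
  let ?I = "inside (path_image c1 \<union> path_image c2)" and ?J = "inside (path_image c2 \<union> path_image c3)"
  have J: "connected ?I" "frontier ?I = path_image c1 \<union> path_image c2"
    using Jordan_inside_outside[OF simple_loop(1,2)] simple_loop(3) by auto
  have disj: "?I \<inter> path_image c3 = {}"
    using assms(1) inside_Int_outside[of "path_image c1 \<union> path_image c2"] inside_no_overlap
      arcs starts finishes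
    by (smt (verit, best) Diff_iff Un_iff disjoint_iff insertCI insertE pathfinish_in_path_image
        pathstart_in_path_image singletonD subsetD)
  have "?I \<subseteq> ?J \<or> ?I \<subseteq> outside (path_image c2 \<union> path_image c3)"
    by (rule inside_or_outside_connected)
      (use J disj inside_no_overlap[of "path_image c1 \<union> path_image c2"] in blast)+
  moreover have "\<not> ?I \<subseteq> ?J"
  proof
    assume "?I \<subseteq> ?J"
    then have "closure ?I \<subseteq> closure ?J" by (rule closure_mono)
    also have "\<dots> \<subseteq> (path_image c2 \<union> path_image c3) \<union> ?J"
      by (rule closure_inside_subset) (simp add: arcs closed_Un closed_arc_image)
    finally have *: "path_image c1 \<subseteq> (path_image c2 \<union> path_image c3) \<union> ?J"
      using J(2) by (auto simp: frontier_def)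
    obtain w where w: "w \<in> path_image c1 - {a,b}"
      using theta_curve.open_arc_nonempty[OF rotate] by blast
    with * meets have "w \<in> ?J" by blast
    with w assms(2) inside_Int_outside[of "path_image c2 \<union> path_image c3"] show False by blast
  qed
  ultimately show ?thesis using z by blast
qed

text \<open>Otherwise a point in the bounded region of two of the arcs has winding number \<open>\<plusminus>1\<close> for
  one of the three loops and \<open>0\<close> for the other two, but these numbers add up to zero.\<close>

lemma some_arc_inside:
  "path_image c1 - {a,b} \<subseteq> inside (path_image c2 \<union> path_image c3) \<or>
   path_image c2 - {a,b} \<subseteq> inside (path_image c3 \<union> path_image c1) \<or>
   path_image c3 - {a,b} \<subseteq> inside (path_image c1 \<union> path_image c2)"
proof (rule ccontr)
  assume neg: "\<not> ?thesis"
  interpret r: theta_curve c2 c3 c1 a b by (rule rotate)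
  interpret s: theta_curve c3 c1 c2 a b by (rule r.rotate)
  interpret u: theta_curve c2 c1 c3 a b by (rule swap)
  have o: "path_image c1 - {a,b} \<subseteq> outside (path_image c2 \<union> path_image c3)"
    "path_image c2 - {a,b} \<subseteq> outside (path_image c3 \<union> path_image c1)"
    "path_image c3 - {a,b} \<subseteq> outside (path_image c1 \<union> path_image c2)"
    using neg open_arc_cases r.open_arc_cases s.open_arc_cases by blast+
  obtain z where z: "z \<in> inside (path_image c1 \<union> path_image c2)"
    using Jordan_inside_outside[OF simple_loop(1,2)] simple_loop(3) by auto
  have z1: "z \<in> outside (path_image c2 \<union> path_image c3)"
    using inside_disjoint[OF o(3) o(1) z] .
  have z2: "z \<in> outside (path_image c1 \<union> path_image c3)"
    using u.inside_disjoint[of z] o z by (simp add: Un_commute)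
  have nz: "z \<notin> path_image c1" "z \<notin> path_image c2" "z \<notin> path_image c3"
    using z1 z2 outside_no_overlap by blast+
  have p: "path c1" "path c2" "path c3" using arcs arc_imp_path by blast+
  have w: "winding_number (g +++ reversepath g') z = winding_number g z - winding_number g' z"
    if "g \<in> {c1,c2,c3}" "g' \<in> {c1,c2,c3}" for g g'
    using that nz p starts finishes
    by (auto simp: winding_number_join winding_number_reversepath)
  have "winding_number (c2 +++ reversepath c3) z = 0"
    by (rule winding_number_zero_in_outside) (use r.simple_loop z1 simple_path_imp_path in auto)
  moreover have "winding_number (c3 +++ reversepath c1) z = 0"
    by (rule winding_number_zero_in_outside)
      (use s.simple_loop z2 simple_path_imp_path in \<open>auto simp: Un_commute\<close>)
  ultimately have "winding_number (c1 +++ reversepath c2) z = 0"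
    using w by simp
  moreover have "cmod (winding_number (c1 +++ reversepath c2) z) = 1"
    using simple_closed_path_norm_winding_number_inside[OF simple_loop(1)] z simple_loop(3) by simp
  ultimately show False by simp
qed

end

text \<open>Both theta curves contain the same closed curve, cut at two pairs of points that
  alternate on it. As none of the four points is enclosed, both chords must run inside it. There
  \<open>A\<close> separates two regions, one with \<open>c\<close> and the other with
  \<open>d\<close> away from its closure, so a disjoint \<open>B\<close> cannot join them.\<close>

lemma no_crossing_chords:
  assumes Z: "theta_curve Z1 Z2 A a b" and Y: "theta_curve Y1 Y2 B c d"
    and eq: "path_image Z1 \<union> path_image Z2 = path_image Y1 \<union> path_image Y2"
    and c: "c \<in> path_image Z1" "c \<noteq> a" "c \<noteq> b" and d: "d \<in> path_image Z2" "d \<noteq> a" "d \<noteq> b"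
    and a: "a \<in> path_image Y1" and b: "b \<in> path_image Y2"
    and AB: "path_image A \<inter> path_image B = {}"
    and cd: "c \<notin> inside (path_image Z2 \<union> path_image A)" "d \<notin> inside (path_image Z1 \<union> path_image A)"
    and ab: "a \<notin> inside (path_image Y2 \<union> path_image B)" "b \<notin> inside (path_image Y1 \<union> path_image B)"
  shows False
proof -
  interpret Z: theta_curve Z1 Z2 A a b by (rule Z)
  interpret Y: theta_curve Y1 Y2 B c d by (rule Y)
  let ?Z = "path_image Z1 \<union> path_image Z2"
  have A: "path_image A - {a,b} \<subseteq> inside ?Z"
    using Z.some_arc_inside c d cd by (auto simp: Un_commute)
  have B: "path_image B - {c,d} \<subseteq> inside ?Z"
    using Y.some_arc_inside a b ab c d unfolding eq by (auto simp: Un_commute)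
  have ne: "path_image A \<inter> inside ?Z \<noteq> {}" using A Z.open_arc_nonempty by blast
  obtain split: "inside (path_image Z1 \<union> path_image A) \<inter> inside (path_image Z2 \<union> path_image A) = {}"
      "inside (path_image Z1 \<union> path_image A) \<union> inside (path_image Z2 \<union> path_image A) \<union>
           (path_image A - {a,b}) = inside ?Z"
    by (rule split_inside_simple_closed_curve[OF arc_imp_simple_path[OF Z.arcs(1)] Z.starts(1) Z.finishes(1)
          arc_imp_simple_path[OF Z.arcs(2)] Z.starts(2) Z.finishes(2) arc_imp_simple_path[OF Z.arcs(3)]
          Z.starts(3) Z.finishes(3) Z.ends_distinct Z.meets ne]) blast
  have cl: "closure (path_image B - {c,d}) = path_image B"
    by (rule arc_endless_closure) (use Y in \<open>auto simp: theta_curve_def\<close>)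
  have B1: "path_image B - {c,d} \<subseteq> inside (path_image Z1 \<union> path_image A) \<or>
      path_image B - {c,d} \<subseteq> outside (path_image Z1 \<union> path_image A)"
    by (rule inside_or_outside_connected[OF Y.open_arc_connected])
      (use AB B inside_no_overlap[of ?Z] in blast)
  show False
  proof (cases "path_image B - {c,d} \<subseteq> inside (path_image Z1 \<union> path_image A)")
    case True
    then have "path_image B \<subseteq> closure (inside (path_image Z1 \<union> path_image A))"
      using cl closure_mono by metis
    also have "\<dots> \<subseteq> path_image Z1 \<union> path_image A \<union> inside (path_image Z1 \<union> path_image A)"
      by (rule closure_inside_subset) (simp add: Z.arcs closed_Un closed_arc_image)
    finally show False
      using cd(2) d Z.meets Y.finishes(3) pathfinish_in_path_image[of B] AB by blast
  next
    case False
    with B1 have "path_image B - {c,d} \<subseteq> inside (path_image Z2 \<union> path_image A)"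
      using B split(2) AB inside_Int_outside[of "path_image Z1 \<union> path_image A"] by blast
    then have "path_image B \<subseteq> closure (inside (path_image Z2 \<union> path_image A))"
      using cl closure_mono by metis
    also have "\<dots> \<subseteq> path_image Z2 \<union> path_image A \<union> inside (path_image Z2 \<union> path_image A)"
      by (rule closure_inside_subset) (simp add: Z.arcs closed_Un closed_arc_image)
    finally show False
      using cd(1) c Z.meets Y.starts(3) pathstart_in_path_image[of B] AB by blast
  qed
qed

section \<open>Paths in a drawn graph and the subdivisions they exclude\<close>

fun path_edges :: "'a list \<Rightarrow> 'a set set" where
  "path_edges (x # y # zs) = insert {x, y} (path_edges (y # zs))"
| "path_edges _ = {}"

lemma Union_path_edges: "\<Union> (path_edges xs) \<subseteq> set xs"
  by (induction xs rule: path_edges.induct) auto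

lemma path_edges_append: "xs \<noteq> [] \<Longrightarrow> ys \<noteq> [] \<Longrightarrow>
  path_edges (xs @ ys) = path_edges xs \<union> {{last xs, hd ys}} \<union> path_edges ys"
  by (induction xs rule: path_edges.induct) (auto simp: neq_Nil_conv)

lemma path_edges_rev: "path_edges (rev xs) = path_edges xs"
proof (induction xs rule: path_edges.induct)
  case (1 x y zs)
  then show ?case
    by (simp add: path_edges_append[of "rev zs @ [y]" "[x]", simplified] insert_commute)
qed auto

lemma set_subset_Union_path_edges: "2 \<le> length xs \<Longrightarrow> set xs \<subseteq> \<Union> (path_edges xs)"
proof (induction xs rule: path_edges.induct)
  case (1 x y zs)
  then show ?case by (cases zs) auto
qed auto

lemma ends_notin_path_edges:
  assumes "distinct xs" "3 \<le> length xs"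
  shows "{hd xs, last xs} \<notin> path_edges xs"
proof -
  obtain x y z zs where xs: "xs = x # y # z # zs"
    using assms(2) by (auto simp: numeral_3_eq_3 Suc_le_length_iff)
  have "{x, last xs} \<noteq> {x, y}" using assms(1) xs by (auto simp: doubleton_eq_iff split: if_splits)
  moreover have "x \<notin> \<Union> (path_edges (y # z # zs))"
    using assms(1) xs Union_path_edges[of "y # z # zs"] by auto
  ultimately show ?thesis using xs by auto
qed

definition graph_path :: "'a graph \<Rightarrow> 'a list \<Rightarrow> bool" where
  "graph_path G xs \<longleftrightarrow> distinct xs \<and> set xs \<subseteq> verts G \<and> path_edges xs \<subseteq> edges G"

locale outer_drawing =
  fixes G :: "'a graph" and p :: "'a \<Rightarrow> complex" and \<gamma> :: "'a set \<Rightarrow> real \<Rightarrow> complex"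
  assumes simple: "simple_graph G" and drawing: "plane_drawing G p \<gamma>"
    and exposed: "p ` verts G \<subseteq> frontier (outside (drawing_points G p \<gamma>))"
begin

definition curve :: "'a set set \<Rightarrow> complex set" where
  "curve F = (\<Union>e\<in>F. path_image (\<gamma> e))"

lemma curve_Un: "curve (F \<union> F') = curve F \<union> curve F'"
  by (auto simp: curve_def)

lemma edge_subset: "e \<in> edges G \<Longrightarrow> e \<subseteq> verts G"
  using simple by (auto simp: simple_graph_def)

lemma finite_edges: "finite (edges G)"
  using simple edge_subset by (auto simp: simple_graph_def intro: finite_subset[of _ "Pow (verts G)"])

lemma closed_curve: "F \<subseteq> edges G \<Longrightarrow> closed (curve F)"
  unfolding curve_def using drawing finite_edges
  by (intro closed_UN) (auto simp: plane_drawing_def closed_arc_image intro: finite_subset)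

text \<open>The inside of a closed set is open and disjoint from the unbounded face of the whole
  drawing, so it contains no limit of that face.\<close>

lemma vertex_not_inside:
  assumes "x \<in> verts G" "F \<subseteq> edges G"
  shows "p x \<notin> inside (curve F)"
proof
  assume "p x \<in> inside (curve F)"
  moreover have "p x \<in> closure (outside (drawing_points G p \<gamma>))"
    using exposed assms by (auto simp: frontier_def)
  moreover have "open (inside (curve F))"
    using assms closed_curve open_inside by blast
  ultimately have "inside (curve F) \<inter> outside (drawing_points G p \<gamma>) \<noteq> {}"
    using open_Int_closure_eq_empty[of "inside (curve F)" "outside (drawing_points G p \<gamma>)"] by blast
  moreover have "outside (drawing_points G p \<gamma>) \<subseteq> outside (curve F)"
    by (rule outside_mono) (use assms in \<open>auto simp: curve_def drawing_points_def\<close>)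
  ultimately show False using inside_Int_outside[of "curve F"] by blast
qed

lemma curve_meets:
  assumes "F \<subseteq> edges G" "F' \<subseteq> edges G" "F \<inter> F' = {}"
  shows "curve F \<inter> curve F' \<subseteq> p ` (\<Union>F \<inter> \<Union>F')"
proof
  fix z assume "z \<in> curve F \<inter> curve F'"
  then obtain e e' where e: "e \<in> F" "e' \<in> F'" "z \<in> path_image (\<gamma> e) \<inter> path_image (\<gamma> e')"
    by (auto simp: curve_def)
  then have "e \<noteq> e'" using assms by auto
  with e assms drawing have "z \<in> p ` (e \<inter> e')"
    unfolding plane_drawing_def by blast
  with e show "z \<in> p ` (\<Union>F \<inter> \<Union>F')" by blast
qed

lemma point_in_curve: "F \<subseteq> edges G \<Longrightarrow> x \<in> \<Union>F \<Longrightarrow> p x \<in> curve F"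
proof -
  assume F: "F \<subseteq> edges G" and "x \<in> \<Union>F"
  then obtain e where e: "e \<in> F" "x \<in> e" by blast
  then have "path_image (\<gamma> e) \<inter> p ` verts G = p ` e"
    using drawing F unfolding plane_drawing_def by (meson subsetD)
  with e show "p x \<in> curve F" unfolding curve_def by blast
qed

lemma edge_arc:
  assumes "{x, y} \<in> edges G"
  shows "\<exists>g. arc g \<and> pathstart g = p x \<and> pathfinish g = p y \<and> path_image g = path_image (\<gamma> {x, y})"
proof -
  have a: "arc (\<gamma> {x,y})" "{pathstart (\<gamma> {x,y}), pathfinish (\<gamma> {x,y})} = {p x, p y}"
    using drawing assms unfolding plane_drawing_def by force+
  show ?thesis
  proof (cases "pathstart (\<gamma> {x,y}) = p x")
    case True
    then have "pathfinish (\<gamma> {x,y}) = p y" using a by (auto simp: doubleton_eq_iff)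
    with True a show ?thesis by blast
  next
    case False
    then have "pathfinish (\<gamma> {x,y}) = p x \<and> pathstart (\<gamma> {x,y}) = p y"
      using a(2) unfolding doubleton_eq_iff by blast
    with a show ?thesis
      by (intro exI[of _ "reversepath (\<gamma> {x,y})"]) (simp add: arc_reversepath)
  qed
qed

lemma path_arc:
  assumes "graph_path G xs" "2 \<le> length xs"
  shows "\<exists>g. arc g \<and> pathstart g = p (hd xs) \<and> pathfinish g = p (last xs) \<and>
    path_image g = curve (path_edges xs)"
  using assms
proof (induction xs rule: path_edges.induct)
  case (1 x y zs)
  have xy: "{x,y} \<in> edges G" using 1 by (auto simp: graph_path_def)
  obtain g where g: "arc g" "pathstart g = p x" "pathfinish g = p y" "path_image g = path_image (\<gamma> {x,y})"
    using edge_arc[OF xy] by blast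
  show ?case
  proof (cases zs)
    case Nil
    then show ?thesis using g by (auto simp: curve_def)
  next
    case (Cons z zs')
    have gp: "graph_path G (y # zs)" using 1 by (auto simp: graph_path_def)
    obtain k where k: "arc k" "pathstart k = p y" "pathfinish k = p (last (y # zs))"
      "path_image k = curve (path_edges (y # zs))"
      using 1(1)[OF gp] Cons by auto
    have "path_image g \<inter> path_image k = curve {{x,y}} \<inter> curve (path_edges (y # zs))"
      using g k by (simp add: curve_def)
    also have "\<dots> \<subseteq> p ` ({x,y} \<inter> \<Union>(path_edges (y # zs)))"
      using curve_meets[of "{{x,y}}" "path_edges (y # zs)"] xy gp Union_path_edges[of "y # zs"] 1(2)
      by (auto simp: graph_path_def)
    also have "\<dots> \<subseteq> {p y}"
      using 1(2) Union_path_edges[of "y # zs"] by (auto simp: graph_path_def)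
    finally have "arc (g +++ k)"
      using g k by (intro arc_join) auto
    then show ?thesis
      using g k by (intro exI[of _ "g +++ k"]) (auto simp: path_image_join curve_def)
  qed
qed auto

lemma theta_of_paths:
  assumes paths: "graph_path G xs" "graph_path G ys" "graph_path G zs"
    and len: "2 \<le> length xs" "2 \<le> length ys" "2 \<le> length zs"
    and hd: "hd xs = u" "hd ys = u" "hd zs = u" and last: "last xs = v" "last ys = v" "last zs = v"
    and sets: "set xs \<inter> set ys = {u,v}" "set xs \<inter> set zs = {u,v}" "set ys \<inter> set zs = {u,v}"
    and edges: "path_edges xs \<inter> path_edges ys = {}" "path_edges xs \<inter> path_edges zs = {}"
      "path_edges ys \<inter> path_edges zs = {}"
  shows "\<exists>c1 c2 c3. theta_curve c1 c2 c3 (p u) (p v) \<and> path_image c1 = curve (path_edges xs) \<and>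
    path_image c2 = curve (path_edges ys) \<and> path_image c3 = curve (path_edges zs)"
proof -
  have meet: "curve (path_edges as) \<inter> curve (path_edges bs) = {p u, p v}"
    if "graph_path G as" "graph_path G bs" "set as \<inter> set bs = {u,v}"
      "path_edges as \<inter> path_edges bs = {}" "2 \<le> length as" "2 \<le> length bs" for as bs
  proof
    have "curve (path_edges as) \<inter> curve (path_edges bs) \<subseteq> p ` (\<Union>(path_edges as) \<inter> \<Union>(path_edges bs))"
      by (rule curve_meets) (use that in \<open>auto simp: graph_path_def\<close>)
    also have "\<dots> \<subseteq> p ` (set as \<inter> set bs)"
      by (intro image_mono Int_mono Union_path_edges)
    finally show "curve (path_edges as) \<inter> curve (path_edges bs) \<subseteq> {p u, p v}"
      using that(3) by simp
    have "p x \<in> curve (path_edges as) \<inter> curve (path_edges bs)" if x: "x \<in> {u,v}" for x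
    proof -
      have xab: "x \<in> set as \<inter> set bs" using x \<open>set as \<inter> set bs = {u,v}\<close> by simp
      have "x \<in> \<Union>(path_edges as)"
        using xab set_subset_Union_path_edges[OF \<open>2 \<le> length as\<close>] by (auto dest: subsetD)
      moreover have "x \<in> \<Union>(path_edges bs)"
        using xab set_subset_Union_path_edges[OF \<open>2 \<le> length bs\<close>] by (auto dest: subsetD)
      ultimately show ?thesis
        using \<open>graph_path G as\<close> \<open>graph_path G bs\<close> point_in_curve by (simp add: graph_path_def)
    qed
    from this[of u] this[of v] show "{p u, p v} \<subseteq> curve (path_edges as) \<inter> curve (path_edges bs)" by simp
  qed
  obtain c1 where "arc c1" "pathstart c1 = p u" "pathfinish c1 = p v" "path_image c1 = curve (path_edges xs)"
    using path_arc[OF paths(1) len(1)] hd last by metis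
  moreover obtain c2 where "arc c2" "pathstart c2 = p u" "pathfinish c2 = p v" "path_image c2 = curve (path_edges ys)"
    using path_arc[OF paths(2) len(2)] hd last by metis
  moreover obtain c3 where "arc c3" "pathstart c3 = p u" "pathfinish c3 = p v" "path_image c3 = curve (path_edges zs)"
    using path_arc[OF paths(3) len(3)] hd last by metis
  ultimately have "theta_curve c1 c2 c3 (p u) (p v)"
    using meet[OF paths(1,2) sets(1) edges(1) len(1,2)] meet[OF paths(1,3) sets(2) edges(2) len(1,3)]
      meet[OF paths(2,3) sets(3) edges(3) len(2,3)]
    by unfold_locales auto
  then show ?thesis
    using \<open>path_image c1 = _\<close> \<open>path_image c2 = _\<close> \<open>path_image c3 = _\<close> by blast
qed

lemma inner_vertex:
  assumes "distinct xs" "3 \<le> length xs"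
  obtains x where "x \<in> set xs" "x \<noteq> hd xs" "x \<noteq> last xs"
proof -
  have l: "1 < length xs" "0 < length xs" "length xs - 1 < length xs" "1 \<noteq> length xs - 1"
    using assms(2) by linarith+
  then have "xs ! 1 \<in> set xs" "xs ! 1 \<noteq> xs ! 0" "xs ! 1 \<noteq> xs ! (length xs - 1)" "xs \<noteq> []"
    using nth_eq_iff_index_eq[OF assms(1)] by auto
  then show ?thesis using that by (metis hd_conv_nth last_conv_nth)
qed

lemma path_edges_disjoint:
  assumes "graph_path G as" "graph_path G bs" "set as \<inter> set bs = {u,v}" "hd as = u" "last as = v"
      "3 \<le> length as"
  shows "path_edges as \<inter> path_edges bs = {}"
proof (rule ccontr)
  assume "path_edges as \<inter> path_edges bs \<noteq> {}"
  then obtain e where e: "e \<in> path_edges as" "e \<in> path_edges bs" by blast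
  then have "e \<subseteq> {u,v}" using Union_path_edges[of as] Union_path_edges[of bs] assms(3) by blast
  moreover have "card e = 2" using e assms simple by (auto simp: graph_path_def simple_graph_def)
  ultimately have "e = {u,v}"
    using card_seteq[of "{u,v}" e] by (simp add: card_insert_if split: if_splits)
  then show False using e ends_notin_path_edges[of as] assms by (auto simp: graph_path_def)
qed

text \<open>One of the three arcs runs inside the loop of the other two, and having at least three
  vertices it takes an inner vertex with it. This excludes subdivisions of
  \<open>K\<^sub>2\<^sub>,\<^sub>3\<close>.\<close>

lemma no_theta:
  assumes paths: "graph_path G xs" "graph_path G ys" "graph_path G zs"
    and len: "3 \<le> length xs" "3 \<le> length ys" "3 \<le> length zs"
    and hd: "hd xs = u" "hd ys = u" "hd zs = u" and last: "last xs = v" "last ys = v" "last zs = v"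
    and sets: "set xs \<inter> set ys = {u,v}" "set xs \<inter> set zs = {u,v}" "set ys \<inter> set zs = {u,v}"
  shows False
proof -
  obtain c1 c2 c3 where th: "theta_curve c1 c2 c3 (p u) (p v)" and im: "path_image c1 = curve (path_edges xs)"
    "path_image c2 = curve (path_edges ys)" "path_image c3 = curve (path_edges zs)"
    using theta_of_paths[OF paths _ _ _ hd last sets path_edges_disjoint[OF paths(1,2) sets(1) hd(1) last(1) len(1)]
        path_edges_disjoint[OF paths(1,3) sets(2) hd(1) last(1) len(1)] path_edges_disjoint[OF paths(2,3) sets(3) hd(2) last(2) len(2)]] len
    by auto
  have false: False if gp: "graph_path G as" "3 \<le> length as" "hd as = u" "last as = v"
    and sub: "curve (path_edges as) - {p u, p v} \<subseteq> inside (curve (path_edges bs \<union> path_edges cs))"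
    and gp2: "graph_path G bs" "graph_path G cs" for as bs cs
  proof -
    obtain x where x: "x \<in> set as" "x \<noteq> u" "x \<noteq> v"
      using inner_vertex[of as] gp by (auto simp: graph_path_def)
    have xG: "x \<in> verts G" "u \<in> verts G" "v \<in> verts G"
    proof -
      have "as \<noteq> []" using gp by auto
      then have "hd as \<in> set as" "last as \<in> set as" by auto
      then show "x \<in> verts G" "u \<in> verts G" "v \<in> verts G"
        using gp x by (auto simp: graph_path_def)
    qed
    have "p x \<noteq> p u" "p x \<noteq> p v"
      using drawing x xG by (auto simp: plane_drawing_def inj_on_def)
    moreover have "p x \<in> curve (path_edges as)"
      using x gp set_subset_Union_path_edges[of as]
      by (intro point_in_curve) (auto simp: graph_path_def)
    ultimately have "p x \<in> inside (curve (path_edges bs \<union> path_edges cs))"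
      using sub by blast
    then show False using vertex_not_inside[OF xG(1)] gp2 by (auto simp: graph_path_def)
  qed
  interpret theta_curve c1 c2 c3 "p u" "p v" by (rule th)
  show False
    using some_arc_inside[unfolded im, folded curve_Un]
      false[OF paths(1) len(1) hd(1) last(1) _ paths(2,3)]
      false[OF paths(2) len(2) hd(2) last(2) _ paths(3,1)]
      false[OF paths(3) len(3) hd(3) last(3) _ paths(1,2)]
    by argo
qed

text \<open>The list closes to a cycle on which \<open>hd as\<close>, \<open>last as\<close>,
  \<open>hd bs\<close>, \<open>hd cs\<close> follow in this order, so the two chords have
  alternating ends. The two ways of cutting the cycle at the ends of a chord are \<open>Z1\<close>,
  \<open>Z2\<close> and \<open>Y1\<close>, \<open>Y2\<close>.\<close>

lemma no_K4:
  assumes gp: "graph_path G (as @ bs @ cs)" and len: "2 \<le> length as" "bs \<noteq> []" "cs \<noteq> []"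
    and closing: "{last cs, hd as} \<in> edges G"
    and chords: "{hd as, hd bs} \<in> edges G" "{last as, hd cs} \<in> edges G"
  shows False
proof -
  have as: "as \<noteq> []" using len by auto
  have dist: "distinct (as @ bs @ cs)" and sub: "set (as @ bs @ cs) \<subseteq> verts G"
    and pe: "path_edges (as @ bs @ cs) \<subseteq> edges G"
    using gp by (auto simp: graph_path_def)
  have pe': "path_edges as \<subseteq> edges G" "path_edges bs \<subseteq> edges G" "path_edges cs \<subseteq> edges G"
    "{last as, hd bs} \<in> edges G" "{last bs, hd cs} \<in> edges G"
    using pe as len by (auto simp: path_edges_append)
  define Z1 Z2 Y1 Y2 where "Z1 = as @ [hd bs]" and "Z2 = hd as # rev (bs @ cs)"
    and "Y1 = rev as @ rev cs" and "Y2 = last as # bs @ [hd cs]"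
  note defs = Z1_def Z2_def Y1_def Y2_def
  have in_set: "hd as \<in> set as" "last as \<in> set as" "hd bs \<in> set bs" "last bs \<in> set bs"
    "hd cs \<in> set cs" "last cs \<in> set cs" using as len by auto
  have ne: "hd as \<noteq> last as"
    using dist len as by (cases as) auto
  have dif: "x \<noteq> y" if "x \<in> set as" "y \<in> set bs \<union> set cs" for x y using that dist by auto
  have dif2: "x \<noteq> y" if "x \<in> set bs" "y \<in> set cs" for x y using that dist by auto
  have eZ1: "path_edges Z1 = path_edges as \<union> {{last as, hd bs}}"
    using as by (simp add: defs path_edges_append)
  have eZ2: "path_edges Z2 = {{hd as, last cs}} \<union> path_edges bs \<union> path_edges cs \<union> {{last bs, hd cs}}"
    using path_edges_append[of "[hd as]" "rev (bs @ cs)"] len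
    by (simp only: defs path_edges_rev) (auto simp: path_edges_append path_edges_rev hd_rev)
  have eY1: "path_edges Y1 = path_edges as \<union> path_edges cs \<union> {{hd as, last cs}}"
    using as len by (auto simp: defs path_edges_append path_edges_rev hd_rev last_rev)
  have eY2: "path_edges Y2 = {{last as, hd bs}} \<union> path_edges bs \<union> {{last bs, hd cs}}"
    using path_edges_append[of "[last as]" "bs @ [hd cs]"] len
    by (auto simp: defs path_edges_append)
  have cl: "{hd as, last cs} \<in> edges G" using closing by (simp add: insert_commute)
  have dis: "hd bs \<notin> set as" "hd as \<notin> set bs" "hd as \<notin> set cs" "last as \<notin> set bs" "last as \<notin> set cs"
    "hd cs \<notin> set bs" "hd cs \<notin> set as"
    using in_set dif dif2 by blast+
  have dZ: "distinct Z1" "distinct Z2" "distinct Y1" "distinct Y2"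
    using dist dis in_set by (auto simp: defs)
  have sZ: "set Z1 \<subseteq> verts G" "set Z2 \<subseteq> verts G" "set Y1 \<subseteq> verts G" "set Y2 \<subseteq> verts G"
    using sub in_set by (auto simp: defs)
  have paths: "graph_path G Z1" "graph_path G Z2" "graph_path G Y1" "graph_path G Y2"
    unfolding graph_path_def eZ1 eZ2 eY1 eY2 using pe' dZ sZ cl by simp_all
  have paths': "graph_path G [hd as, hd bs]" "graph_path G [last as, hd cs]"
    unfolding graph_path_def using sub in_set chords dis by auto
  note paths = paths paths'
  have lens: "3 \<le> length Z1" "3 \<le> length Z2" "3 \<le> length Y1" "3 \<le> length Y2"
    using len as by (auto simp: defs Suc_le_eq numeral_3_eq_3 neq_Nil_conv)
  have ends: "hd Z1 = hd as" "hd Z2 = hd as" "last Z1 = hd bs" "last Z2 = hd bs"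
    "hd Y1 = last as" "hd Y2 = last as" "last Y1 = hd cs" "last Y2 = hd cs"
    using as len by (auto simp: defs hd_rev last_rev)
  have sets: "set Z1 \<inter> set Z2 = {hd as, hd bs}" "set Z1 \<inter> set [hd as, hd bs] = {hd as, hd bs}"
    "set Z2 \<inter> set [hd as, hd bs] = {hd as, hd bs}"
    "set Y1 \<inter> set Y2 = {last as, hd cs}" "set Y1 \<inter> set [last as, hd cs] = {last as, hd cs}"
    "set Y2 \<inter> set [last as, hd cs] = {last as, hd cs}"
    using in_set dist unfolding defs set_append set_rev set_simps distinct_append by blast+
  have len2: "2 \<le> length Z1" "2 \<le> length Z2" "2 \<le> length Y1" "2 \<le> length Y2"
    "2 \<le> length [hd as, hd bs]" "2 \<le> length [last as, hd cs]"
    using lens by auto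
  obtain z1 z2 A where Z: "theta_curve z1 z2 A (p (hd as)) (p (hd bs))"
    and Zim: "path_image z1 = curve (path_edges Z1)" "path_image z2 = curve (path_edges Z2)"
    "path_image A = curve (path_edges [hd as, hd bs])"
    using theta_of_paths[OF paths(1,2,5) len2(1,2,5) ends(1,2) _ ends(3,4) _ sets(1-3)
        path_edges_disjoint[OF paths(1,2) sets(1) ends(1,3) lens(1)]
        path_edges_disjoint[OF paths(1,5) sets(2) ends(1,3) lens(1)]
        path_edges_disjoint[OF paths(2,5) sets(3) ends(2,4) lens(2)]] by auto
  obtain y1 y2 B where Y: "theta_curve y1 y2 B (p (last as)) (p (hd cs))"
    and Yim: "path_image y1 = curve (path_edges Y1)" "path_image y2 = curve (path_edges Y2)"
    "path_image B = curve (path_edges [last as, hd cs])"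
    using theta_of_paths[OF paths(3,4,6) len2(3,4,6) ends(5,6) _ ends(7,8) _ sets(4-6)
        path_edges_disjoint[OF paths(3,4) sets(4) ends(5,7) lens(3)]
        path_edges_disjoint[OF paths(3,6) sets(5) ends(5,7) lens(3)]
        path_edges_disjoint[OF paths(4,6) sets(6) ends(6,8) lens(4)]] by auto
  have V: "hd as \<in> verts G" "last as \<in> verts G" "hd bs \<in> verts G" "hd cs \<in> verts G"
    using sub in_set by auto
  have inj: "p x \<noteq> p y" if "x \<in> verts G" "y \<in> verts G" "x \<noteq> y" for x y
    using drawing that by (auto simp: plane_drawing_def inj_on_def)
  have on: "p x \<in> curve (path_edges xs)" if "x \<in> set xs" "graph_path G xs" "2 \<le> length xs" for x xs
    using that set_subset_Union_path_edges[of xs] by (intro point_in_curve) (auto simp: graph_path_def)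
  have vni: "p x \<notin> inside (curve (path_edges xs) \<union> curve (path_edges ys))"
    if "x \<in> verts G" "graph_path G xs" "graph_path G ys" for x xs ys
    using vertex_not_inside[OF that(1), of "path_edges xs \<union> path_edges ys"] that
    by (simp add: curve_Un graph_path_def)
  have AB: "path_image A \<inter> path_image B = {}"
    using curve_meets[of "{{hd as, hd bs}}" "{{last as, hd cs}}"] chords in_set ne dif dif2
    unfolding Zim Yim by (fastforce simp: doubleton_eq_iff)
  have eq: "path_image z1 \<union> path_image z2 = path_image y1 \<union> path_image y2"
    unfolding Zim Yim curve_Un[symmetric] eZ1 eZ2 eY1 eY2 by (rule arg_cong[where f = curve]) auto
  have d: "hd bs \<noteq> hd cs" "hd as \<noteq> hd cs" "last as \<noteq> hd bs" using dif dif2 in_set by auto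
  show False
  proof (rule no_crossing_chords[OF Z Y eq])
    show "p (last as) \<in> path_image z1" "p (hd cs) \<in> path_image z2" "p (hd as) \<in> path_image y1"
      "p (hd bs) \<in> path_image y2"
      unfolding Zim Yim using in_set paths len2 by (auto intro!: on simp: defs)
    show "p (last as) \<noteq> p (hd as)" "p (last as) \<noteq> p (hd bs)" "p (hd cs) \<noteq> p (hd as)"
      "p (hd cs) \<noteq> p (hd bs)"
      using inj V ne d by metis+
    show "path_image A \<inter> path_image B = {}" by (rule AB)
    show "p (last as) \<notin> inside (path_image z2 \<union> path_image A)"
      "p (hd cs) \<notin> inside (path_image z1 \<union> path_image A)"
      "p (hd as) \<notin> inside (path_image y2 \<union> path_image B)"
      "p (hd bs) \<notin> inside (path_image y1 \<union> path_image B)"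
      unfolding Zim Yim by (intro vni V paths)+
  qed
qed

text \<open>The index form needed for a longest path: the first vertex sees positions
  \<open>i\<close> and \<open>j\<close>, the vertex just before \<open>i\<close> sees
  \<open>k\<close> between them, and what follows position \<open>j\<close> is cut off.\<close>

lemma no_K4_nth:
  assumes gp: "graph_path G zs" and ind: "2 \<le> i" "i < k" "k \<le> j" "j < length zs"
    and e: "{zs ! 0, zs ! i} \<in> edges G" "{zs ! (i - 1), zs ! k} \<in> edges G" "{zs ! j, zs ! 0} \<in> edges G"
  shows False
proof -
  define as bs cs ds where "as = take i zs" and "bs = drop i (take k zs)"
    and "cs = drop k (take (Suc j) zs)" and "ds = drop (Suc j) zs"
  have zs: "zs = (as @ bs @ cs) @ ds"
  proof -
    have "as @ bs = take k zs" unfolding as_def bs_def using ind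
      by (metis append_take_drop_id less_or_eq_imp_le min.absorb1 take_take)
    moreover have "take k zs @ cs = take (Suc j) zs" unfolding cs_def using ind
      by (metis append_take_drop_id le_Suc_eq min.absorb1 take_take)
    ultimately show ?thesis unfolding ds_def
      by (metis append.assoc append_take_drop_id)
  qed
  have ne: "2 \<le> length as" "bs \<noteq> []" "cs \<noteq> []" using ind by (auto simp: as_def bs_def cs_def)
  have "graph_path G (as @ bs @ cs)"
  proof (cases "ds = []")
    case False
    have "as @ bs @ cs \<noteq> []" using ne by auto
    from path_edges_append[OF this False] gp show ?thesis
      by (subst (asm) zs) (auto simp: graph_path_def zs)
  qed (use gp zs in simp)
  moreover have "hd as = zs ! 0" "hd bs = zs ! i" "hd cs = zs ! k" "last as = zs ! (i - 1)" "last cs = zs ! j"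
  proof -
    have "zs \<noteq> []" "as \<noteq> []" "length zs \<le> Suc j \<Longrightarrow> length zs - Suc 0 = j" using ind ne by auto
    then show "hd as = zs ! 0" "hd bs = zs ! i" "hd cs = zs ! k" "last as = zs ! (i - 1)" "last cs = zs ! j"
      using ind by (auto simp: as_def bs_def cs_def hd_conv_nth last_conv_nth min_def hd_drop_conv_nth)
  qed
  ultimately show False using no_K4[OF _ ne] e by simp
qed

text \<open>If all degrees were at least three, choose among all longest paths one whose first
  vertex is adjacent to a vertex of smallest index \<open>i\<close>, at least 2. Reversing the first
  \<open>i\<close> vertices gives another longest path with the same \<open>i\<close>, so the
  vertices at 0 and at \<open>i - 1\<close> both have a neighbour beyond \<open>i\<close>. With the
  edge from 0 to \<open>i\<close> this is a subdivision of \<open>K\<^sub>4\<close>.\<close>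

lemma exists_small_degree:
  assumes "verts G \<noteq> {}"
  shows "\<exists>v\<in>verts G. card {u. {v, u} \<in> edges G} \<le> 2"
proof (rule ccontr)
  assume "\<not> ?thesis"
  then have deg: "3 \<le> card {u. {v, u} \<in> edges G}" if "v \<in> verts G" for v using that by force
  have fin: "finite (verts G)" using simple by (simp add: simple_graph_def)
  have bound: "length xs \<le> card (verts G)" if "graph_path G xs" for xs
    using that card_mono[OF fin, of "set xs"] by (simp add: graph_path_def distinct_card)
  obtain v0 where "v0 \<in> verts G" using assms by blast
  then have "graph_path G [v0]" by (simp add: graph_path_def)
  then obtain xs0 where xs0: "graph_path G xs0" "\<And>ys. graph_path G ys \<Longrightarrow> length ys \<le> length xs0"
    using ex_has_greatest_nat[of "graph_path G" "[v0]" length "Suc (card (verts G))"] bound by (metis less_Suc_eq_le)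
  define L where "L = length xs0"
  have noloop: "{x, x} \<notin> edges G" for x using simple by (force simp: simple_graph_def)
  have nbrs: "{u. {xs ! 0, u} \<in> edges G} \<subseteq> set xs" if "graph_path G xs" "length xs = L" "xs \<noteq> []" for xs
  proof
    fix u assume "u \<in> {u. {xs ! 0, u} \<in> edges G}"
    then have u: "{u, xs ! 0} \<in> edges G" by (simp add: insert_commute)
    show "u \<in> set xs"
    proof (rule ccontr)
      assume "u \<notin> set xs"
      then have "graph_path G (u # xs)" using that u edge_subset[OF u]
        by (cases xs) (auto simp: graph_path_def)
      then show False using xs0(2)[of "u # xs"] that by (simp add: L_def)
    qed
  qed
  have L1: "1 \<le> L" using xs0(2)[OF \<open>graph_path G [v0]\<close>] by (simp add: L_def)
  have other: "\<exists>j<L. 2 \<le> j \<and> j \<noteq> i \<and> {xs ! 0, xs ! j} \<in> edges G"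
    if xs: "graph_path G xs" "length xs = L" for xs i
  proof -
    have ne: "xs \<noteq> []" using xs L1 by auto
    have "\<not> {u. {xs ! 0, u} \<in> edges G} \<subseteq> {xs ! 1, xs ! i}"
    proof
      assume "{u. {xs ! 0, u} \<in> edges G} \<subseteq> {xs ! 1, xs ! i}"
      from card_mono[OF _ this] have "card {u. {xs ! 0, u} \<in> edges G} \<le> 2"
        by (simp add: card_insert_if split: if_splits)
      moreover have "xs ! 0 \<in> verts G" using xs ne nth_mem[of 0 xs] by (auto simp: graph_path_def)
      ultimately show False using deg[of "xs ! 0"] by simp
    qed
    then obtain u where u: "{xs ! 0, u} \<in> edges G" "u \<noteq> xs ! 1" "u \<noteq> xs ! i" by blast
    then obtain j where j: "j < L" "u = xs ! j"
      using nbrs[OF xs ne] xs(2) by (metis in_set_conv_nth mem_Collect_eq subsetD)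
    moreover have "j \<noteq> 0" using u j noloop[of "xs ! 0"] by (cases j) auto
    moreover have "j \<noteq> 1" "j \<noteq> i" using u j by auto
    ultimately show ?thesis using u by (intro exI[of _ j]) auto
  qed
  define P where "P xs i \<longleftrightarrow> graph_path G xs \<and> length xs = L \<and> 2 \<le> i \<and> i < L \<and> {xs ! 0, xs ! i} \<in> edges G"
    for xs i
  have "\<exists>i xs. P xs i"
  proof -
    obtain j where "j < L" "2 \<le> j" "{xs0 ! 0, xs0 ! j} \<in> edges G"
      using other[OF xs0(1), of 0] by (auto simp: L_def)
    then have "P xs0 j" using xs0(1) by (simp add: P_def L_def)
    then show ?thesis by blast
  qed
  then obtain i xs where Pi: "P xs i" and min: "\<And>k ys. P ys k \<Longrightarrow> i \<le> k"
    using exists_least_iff[of "\<lambda>i. \<exists>xs. P xs i"] by (metis not_less)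
  have xs: "graph_path G xs" "length xs = L" "2 \<le> i" "i < L" "{xs ! 0, xs ! i} \<in> edges G"
    using Pi by (auto simp: P_def)
  have later: "\<exists>j<L. i < j \<and> {ys ! 0, ys ! j} \<in> edges G" if "P ys i" for ys
    using other[of ys i] min[of ys] that unfolding P_def by (metis le_neq_implies_less)
  \<comment> \<open>The reversal trades the path edge before position \<open>i\<close> for the chord
    from 0 to \<open>i\<close>; the edge given up serves as the chord of \<open>ys\<close>, again to
    position \<open>i\<close>.\<close>
  define ys where "ys = rev (take i xs) @ drop i xs"
  have nth: "ys ! k = xs ! k" if "i \<le> k" "k < L" for k
    using that xs by (auto simp: ys_def nth_append)
  have nth0: "ys ! 0 = xs ! (i - 1)" "ys ! (i - 1) = xs ! 0"
    using xs by (auto simp: ys_def nth_append rev_nth)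
  have tk: "take i xs \<noteq> []" "drop i xs \<noteq> []" using xs by auto
  have ends: "last (take i xs) = xs ! (i - 1)" "hd (drop i xs) = xs ! i" "hd (take i xs) = xs ! 0"
  proof -
    have "xs \<noteq> []" using tk by auto
    then show "last (take i xs) = xs ! (i - 1)" "hd (drop i xs) = xs ! i" "hd (take i xs) = xs ! 0"
      using xs tk by (auto simp: last_conv_nth hd_drop_conv_nth hd_conv_nth min_def)
  qed
  have pe: "path_edges xs = path_edges (take i xs) \<union> {{xs ! (i - 1), xs ! i}} \<union> path_edges (drop i xs)"
    using path_edges_append[OF tk] by (simp add: ends)
  have "path_edges ys = path_edges (take i xs) \<union> {{xs ! 0, xs ! i}} \<union> path_edges (drop i xs)"
    using path_edges_append[of "rev (take i xs)" "drop i xs"] tk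
    by (simp add: ys_def path_edges_rev last_rev ends)
  then have "path_edges ys \<subseteq> edges G" using pe xs by (auto simp: graph_path_def)
  moreover have "set ys = set xs" "distinct ys"
  proof -
    have "set ys = set (take i xs @ drop i xs)" unfolding ys_def by (simp only: set_append set_rev)
    then show "set ys = set xs" by simp
    have "distinct (take i xs @ drop i xs)" using xs by (simp add: graph_path_def)
    then show "distinct ys" unfolding ys_def by (simp only: distinct_append distinct_rev set_rev)
  qed
  ultimately have "P ys i"
    using xs pe nth[of i] nth0 by (auto simp: P_def graph_path_def ys_def)
  from later[OF this] obtain k where k: "k < L" "i < k" "{ys ! 0, ys ! k} \<in> edges G" by blast
  from later[OF Pi] obtain j where j: "j < L" "i < j" "{xs ! 0, xs ! j} \<in> edges G" by blast
  have gy: "graph_path G ys" "length ys = L" "{ys ! 0, ys ! i} \<in> edges G"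
    using \<open>P ys i\<close> by (auto simp: P_def)
  show False
  \<comment> \<open>The cycle must reach the farther of the two neighbours, and it is closed from
    \<open>xs\<close> or from \<open>ys\<close> according to which first vertex sees it.\<close>
  proof (cases "k \<le> j")
    case True
    show False
      by (rule no_K4_nth[OF xs(1), of i k j])
        (use True xs j k nth[of k] nth0 in \<open>auto simp: insert_commute\<close>)
  next
    case False
    show False
      by (rule no_K4_nth[OF gy(1), of i j k])
        (use False xs j k gy nth[of j] nth0 in \<open>auto simp: insert_commute\<close>)
  qed
qed

end

section \<open>Reducing a drawing at a vertex of degree at most two\<close>

definition adj :: "'a graph \<Rightarrow> ('a \<times> 'a) set" where
  "adj G = {(u, v). {u, v} \<in> edges G}"

lemma sym_adj: "sym (adj G)"
  by (auto simp: adj_def sym_def insert_commute)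

lemma frontier_outside_subset:
  assumes "D' \<subseteq> D" "x \<in> D'" "x \<in> frontier (outside D)"
  shows "x \<in> frontier (outside D')"
proof -
  have "x \<in> closure (outside D')"
    using assms(3) closure_mono[OF outside_mono[OF assms(1)]] by (auto simp: frontier_def)
  moreover have "x \<notin> interior (outside D')"
    using assms(2) interior_subset outside_no_overlap[of D'] by blast
  ultimately show ?thesis by (simp add: frontier_def)
qed

lemma outerplanar_iff: "outerplanar G \<longleftrightarrow> (\<exists>p \<gamma>. outer_drawing G p \<gamma>)"
  by (auto simp: outerplanar_def outer_drawing_def)

context outer_drawing
begin

text \<open>A drawing within the point set of the old one can only enlarge the unbounded face, so
  the vertices stay on its frontier.\<close>

lemma outerplanar_redraw:
  assumes "simple_graph H" "verts H \<subseteq> verts G" "plane_drawing H p \<gamma>'"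
    and "\<And>f. f \<in> edges H \<Longrightarrow> path_image (\<gamma>' f) \<subseteq> drawing_points G p \<gamma>"
  shows "outerplanar H"
proof -
  have "p ` verts H \<subseteq> frontier (outside (drawing_points H p \<gamma>'))"
  proof
    fix x assume x: "x \<in> p ` verts H"
    show "x \<in> frontier (outside (drawing_points H p \<gamma>'))"
    proof (rule frontier_outside_subset)
      show "drawing_points H p \<gamma>' \<subseteq> drawing_points G p \<gamma>"
        using assms(2,4) unfolding drawing_points_def by blast
      show "x \<in> drawing_points H p \<gamma>'" using x by (simp add: drawing_points_def)
      show "x \<in> frontier (outside (drawing_points G p \<gamma>))" using x assms(2) exposed by blast
    qed
  qed
  then show ?thesis using assms by (auto simp: outerplanar_def)
qed

lemma edge_drawn:
  assumes "f \<in> edges G"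
  shows "arc (\<gamma> f)" "{pathstart (\<gamma> f), pathfinish (\<gamma> f)} = p ` f" "path_image (\<gamma> f) \<inter> p ` verts G = p ` f"
  using drawing assms unfolding plane_drawing_def by blast+

lemma edges_drawn:
  assumes "f \<in> edges G" "f' \<in> edges G" "f \<noteq> f'"
  shows "path_image (\<gamma> f) \<inter> path_image (\<gamma> f') \<subseteq> p ` (f \<inter> f')"
  using drawing assms unfolding plane_drawing_def by blast

lemma outerplanar_delete: "outerplanar (verts G - {e}, {f \<in> edges G. e \<notin> f})"
proof (rule outerplanar_redraw[of _ \<gamma>])
  let ?H = "(verts G - {e}, {f \<in> edges G. e \<notin> f})"
  show "simple_graph ?H" using simple by (auto simp: simple_graph_def)
  have "path_image (\<gamma> f) \<inter> p ` (verts G - {e}) = p ` f" if "f \<in> edges G" "e \<notin> f" for f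
    using edge_drawn(3)[OF that(1)] edge_subset[OF that(1)] that(2) by blast
  then show "plane_drawing ?H p \<gamma>"
    unfolding plane_drawing_def using drawing edge_drawn edges_drawn
    by (auto simp: plane_drawing_def inj_on_def)
qed (auto simp: drawing_points_def)

text \<open>The two arcs at \<open>e\<close> are joined into a single arc for \<open>{u, v}\<close>;
  when this edge is already present, deleting \<open>e\<close> suffices.\<close>

lemma outerplanar_suppress:
  assumes N: "{x. {e, x} \<in> edges G} = {u, v}" and "u \<noteq> v"
  shows "outerplanar (verts G - {e}, {f \<in> edges G. e \<notin> f} \<union> {{u, v}})"
proof (cases "{u, v} \<in> edges G")
  have e: "{u, e} \<in> edges G" "{e, v} \<in> edges G"
    using N by (auto simp: insert_commute)
  have V: "e \<in> verts G" "u \<in> verts G" "v \<in> verts G" using edge_subset[OF e(1)] edge_subset[OF e(2)] by auto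
  have ne: "e \<noteq> u" "e \<noteq> v" using e simple by (force simp: simple_graph_def)+
  {
    case True
    then have "{f \<in> edges G. e \<notin> f} \<union> {{u, v}} = {f \<in> edges G. e \<notin> f}" using ne by auto
    then show ?thesis using outerplanar_delete by simp
  next
    case False
    let ?H = "(verts G - {e}, {f \<in> edges G. e \<notin> f} \<union> {{u, v}})"
    have gp: "graph_path G [u, e, v]" using V ne e assms by (auto simp: graph_path_def)
    obtain g where g: "arc g" "pathstart g = p u" "pathfinish g = p v"
      and gim: "path_image g = path_image (\<gamma> {u,e}) \<union> path_image (\<gamma> {e,v})"
      using path_arc[OF gp] by (auto simp: curve_def)
    define \<gamma>' where "\<gamma>' = \<gamma>({u,v} := g)"
    have old: "\<gamma>' f = \<gamma> f" if "f \<in> edges G" for f using that False by (auto simp: \<gamma>'_def)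
    have inj: "inj_on p (verts G)" using drawing by (simp add: plane_drawing_def)
    have new: "\<gamma>' {u,v} = g" by (simp add: \<gamma>'_def)
    have pe: "p e \<notin> p ` (verts G - {e})" using inj V by (auto simp: inj_on_def)
    have H1: "path_image (\<gamma>' f) \<inter> p ` (verts G - {e}) = p ` f" if "f \<in> edges G" "e \<notin> f" for f
      using edge_drawn(3)[OF that(1)] edge_subset[OF that(1)] that(2) old[OF that(1)] by auto
    have "path_image g \<inter> p ` verts G = {p u, p e, p v}"
      using edge_drawn(3)[OF e(1)] edge_drawn(3)[OF e(2)] unfolding gim by auto
    moreover have "path_image g \<inter> p ` (verts G - {e}) \<subseteq> path_image g \<inter> p ` verts G - {p e}"
      using pe by blast
    ultimately have "path_image g \<inter> p ` (verts G - {e}) \<subseteq> {p u, p v}" by auto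
    moreover have "{p u, p v} \<subseteq> path_image g \<inter> p ` (verts G - {e})"
      using g V ne pathstart_in_path_image[of g] pathfinish_in_path_image[of g] by auto
    ultimately have H2: "path_image g \<inter> p ` (verts G - {e}) = p ` {u, v}" by auto
    have H3: "path_image g \<inter> path_image (\<gamma> f) \<subseteq> p ` ({u,v} \<inter> f)" if "f \<in> edges G" "e \<notin> f" for f
    proof -
      have "f \<noteq> {u,e}" "f \<noteq> {e,v}" using that by auto
      then have "path_image g \<inter> path_image (\<gamma> f) \<subseteq> p ` ({u,e} \<inter> f) \<union> p ` ({e,v} \<inter> f)"
        using edges_drawn[OF e(1) that(1)] edges_drawn[OF e(2) that(1)] unfolding gim by blast
      then show ?thesis using that(2) by auto
    qed
    show ?thesis
    proof (rule outerplanar_redraw[of _ \<gamma>'])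
      show "simple_graph ?H" using simple V ne assms by (auto simp: simple_graph_def)
      show "path_image (\<gamma>' f) \<subseteq> drawing_points G p \<gamma>" if "f \<in> edges ?H" for f
      proof (cases "f = {u,v}")
        case True
        then show ?thesis using e by (auto simp: new gim drawing_points_def)
      next
        case False
        then show ?thesis using that old[of f] by (auto simp: drawing_points_def)
      qed
      show "plane_drawing ?H p \<gamma>'"
        unfolding plane_drawing_def
      proof (intro conjI ballI impI)
        show "inj_on p (verts ?H)" using inj by (auto simp: inj_on_def)
        fix f assume f: "f \<in> edges ?H"
        show "arc (\<gamma>' f)" using f old edge_drawn(1) new g by (cases "f = {u,v}") auto
        show "{pathstart (\<gamma>' f), pathfinish (\<gamma>' f)} = p ` f"
          using f old edge_drawn(2) new g by (cases "f = {u,v}") auto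
        show "path_image (\<gamma>' f) \<inter> p ` verts ?H = p ` f"
          using f H1[of f] new H2 by (cases "f = {u,v}") auto
        fix f' assume f': "f' \<in> edges ?H" "f \<noteq> f'"
        consider "f = {u,v}" "f' \<in> edges G" "e \<notin> f'" | "f' = {u,v}" "f \<in> edges G" "e \<notin> f"
          | "f \<in> edges G" "f' \<in> edges G"
          using f f' by auto
        then show "path_image (\<gamma>' f) \<inter> path_image (\<gamma>' f') \<subseteq> p ` (f \<inter> f')"
        proof cases
          case 1
          then show ?thesis using H3[of f'] old[of f'] new by simp
        next
          case 2
          then show ?thesis using H3[of f] old[of f] new by (simp add: Int_commute)
        next
          case 3
          then show ?thesis using edges_drawn[of f f'] old[of f] old[of f'] f' by simp
        qed
      qed
    qed simp
  }
qed

end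

text \<open>When a step returns to a vertex of the list, the list is cut off there.\<close>

lemma rtrancl_simple_path:
  assumes "(u, t) \<in> R\<^sup>*"
  shows "\<exists>xs. xs \<noteq> [] \<and> distinct xs \<and> hd xs = u \<and> last xs = t \<and> set xs \<subseteq> insert u (Range R) \<and>
    path_edges xs \<subseteq> {{x, y} |x y. (x, y) \<in> R}"
  using assms
proof (induction rule: rtrancl_induct)
  case base
  show ?case by (rule exI[of _ "[u]"]) simp
next
  case (step y z)
  then obtain xs where xs: "xs \<noteq> []" "distinct xs" "hd xs = u" "last xs = y"
    "set xs \<subseteq> insert u (Range R)" "path_edges xs \<subseteq> {{x, y} |x y. (x, y) \<in> R}" by blast
  show ?case
  proof (cases "z \<in> set xs")
    case True
    then obtain as bs where xs': "xs = (as @ [z]) @ bs" by (metis append.assoc append_Cons append_Nil split_list)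
    have "path_edges (as @ [z]) \<subseteq> path_edges xs"
      using xs' path_edges_append[of "as @ [z]" bs] by (cases "bs = []") auto
    moreover have "hd (as @ [z]) = u" using xs(3) xs' by (cases as) auto
    ultimately show ?thesis using xs xs'
      by (intro exI[of _ "as @ [z]"]) auto
  next
    case False
    have "path_edges (xs @ [z]) = insert {y, z} (path_edges xs)"
      using path_edges_append[of xs "[z]"] xs by simp
    then show ?thesis using xs False step(2)
      by (intro exI[of _ "xs @ [z]"]) auto
  qed
qed

text \<open>For degree two the induction is applied to the graph with \<open>e\<close> suppressed,
  so that \<open>u v\<close> is a chord with two well-defined sides. If \<open>e\<close> fits on
  neither side, \<open>outer_add_ear\<close> fails on both, each side contains a detour from
  \<open>u\<close> to \<open>v\<close>, and the two detours form with \<open>u\<close>,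
  \<open>e\<close>, \<open>v\<close> a forbidden theta.\<close>

theorem outerplanar_imp_outer: "outerplanar G \<Longrightarrow> outer (verts G) (adj G)"
proof (induction "card (verts G)" arbitrary: G rule: less_induct)
  case less
  obtain p \<gamma> where "outer_drawing G p \<gamma>" using less.prems by (auto simp: outerplanar_iff)
  then interpret outer_drawing G p \<gamma> .
  have fin: "finite (verts G)" using simple by (simp add: simple_graph_def)
  have noloop: "{x, x} \<notin> edges G" for x using simple by (force simp: simple_graph_def)
  show ?case
  proof (cases "verts G = {}")
    case True
    then have "edges G = {}" using simple by (auto simp: simple_graph_def)
    then have "ordered_outer (verts G) (adj G) (\<lambda>_. 0)"
      using True by unfold_locales (auto simp: sym_def irrefl_def noncrossing_def adj_def)
    then show ?thesis by (auto simp: outer_def)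
  next
    case False
    then obtain e where e: "e \<in> verts G" "card {u. {e, u} \<in> edges G} \<le> 2"
      using exists_small_degree by blast
    define N where "N = {u. {e, u} \<in> edges G}"
    have "N \<subseteq> verts G" using edge_subset by (auto simp: N_def)
    have "e \<notin> N" using noloop[of e] by (simp add: N_def)
    from \<open>N \<subseteq> verts G\<close> have finN: "finite N" using fin finite_subset by blast
    define H where "H = (verts G - {e}, {f \<in> edges G. e \<notin> f})"
    have small: "card (verts G - {e}) < card (verts G)" using card_Diff1_less[OF fin e(1)] .
    have oH: "outer (verts G - {e}) (adj H)"
      using less.hyps[of H] outerplanar_delete[of e] small by (simp add: H_def)
    have ins: "insert e (verts G - {e}) = verts G" using e by auto
    have adjG: "adj G = adj H \<union> {(x, e) |x. x \<in> N} \<union> {(e, x) |x. x \<in> N}"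
      by (auto simp: adj_def H_def N_def insert_commute)
    consider "N = {}" | u where "N = {u}" | u v where "N = {u, v}" "u \<noteq> v"
      using e(2) finN unfolding N_def[symmetric]
      by (metis card_1_singletonE card_2_iff card_eq_0_iff le_SucE numeral_2_eq_2 One_nat_def le_zero_eq)
    then show ?thesis
    proof cases
      case 1
      then show ?thesis using outer_add_isolated[OF oH, of e] adjG ins by simp
    next
      case 2
      then have "u \<in> verts G - {e}" using \<open>N \<subseteq> verts G\<close> \<open>e \<notin> N\<close> by auto
      then have "outer (verts G) (adj H \<union> {(u, e), (e, u)})" using outer_add_leaf[OF oH, of e u] ins by simp
      then show ?thesis using adjG 2 by (auto intro: back_subst[of "outer (verts G)"])
    next
      case 3
      define H' where "H' = (verts G - {e}, {f \<in> edges G. e \<notin> f} \<union> {{u, v}})"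
      have "outerplanar H'" using outerplanar_suppress[of e u v] 3 by (simp add: H'_def N_def)
      then have "outer (verts G - {e}) (adj H')"
        using less.hyps[of H'] small by (simp add: H'_def)
      then obtain q0 where "ordered_outer (verts G - {e}) (adj H') q0" by (auto simp: outer_def)
      then interpret q0: ordered_outer "verts G - {e}" "adj H'" q0 .
      have adjH': "adj H' = adj H \<union> {(u, v), (v, u)}" by (auto simp: adj_def H'_def H_def doubleton_eq_iff)
      have uv: "u \<in> verts G - {e}" "v \<in> verts G - {e}" using \<open>N \<subseteq> verts G\<close> \<open>e \<notin> N\<close> 3 by auto
      obtain q where q: "ordered_outer (verts G - {e}) (adj H') q"
        and qroot: "\<forall>x\<in>verts G - {e}. x \<noteq> u \<longrightarrow> q u < q x"
        using q0.rotate[OF uv(1)] by blast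
      interpret q: ordered_outer "verts G - {e}" "adj H'" q by (rule q)
      \<comment> \<open>After rotation to \<open>v\<close> the other side of the chord is again an
        initial interval, the one between \<open>v\<close> and \<open>u\<close>.\<close>
      obtain r where r: "ordered_outer (verts G - {e}) (adj H') r"
        and rroot: "\<forall>x\<in>verts G - {e}. x \<noteq> v \<longrightarrow> r v < r x"
        and rless: "\<And>x y. x \<in> verts G - {e} \<Longrightarrow> y \<in> verts G - {e} \<Longrightarrow> r x < r y \<longleftrightarrow>
          (if q x < q v \<longleftrightarrow> q y < q v then q x < q y else q y < q v)"
        using q.rotate[OF uv(2)] by blast
      interpret r: ordered_outer "verts G - {e}" "adj H'" r by (rule r)
      have finish: "outer (verts G) (adj G)"
        if "outer (insert e (verts G - {e})) (adj H' \<union> {(u, e), (e, u), (v, e), (e, v)})"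
      proof (rule outer_subset[OF that])
        show "adj G \<subseteq> (adj H' \<union> {(u, e), (e, u), (v, e), (e, v)}) \<inter> verts G \<times> verts G"
        proof (rule Int_greatest)
          show "adj G \<subseteq> adj H' \<union> {(u, e), (e, u), (v, e), (e, v)}" using adjG adjH' 3(1) by auto
          show "adj G \<subseteq> verts G \<times> verts G" using edge_subset by (force simp: adj_def)
        qed
      qed (use ins in simp, rule sym_adj)
      have swap: "{(v, e), (e, v), (u, e), (e, u)} = {(u, e), (e, u), (v, e), (e, v)}" by auto
      have finish': "outer (verts G) (adj G)"
        if "outer (insert e (verts G - {e})) (adj H' \<union> {(v, e), (e, v), (u, e), (e, u)})"
        using finish that unfolding swap .
      define X Y where "X = {x \<in> verts G - {e}. q u < q x \<and> q x < q v}"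
        and "Y = {x \<in> verts G - {e}. r v < r x \<and> r x < r u}"
      have quv: "q u < q v" using qroot uv 3 by auto
      have XY: "X \<inter> Y = {}" "u \<notin> X" "u \<notin> Y" "v \<notin> X" "v \<notin> Y"
        using rless uv quv by (auto simp: X_def Y_def)
      show ?thesis
      proof (rule ccontr)
        assume neg: "\<not> ?thesis"
        have E: "(u, v) \<in> adj H'" "(v, u) \<in> adj H'" by (auto simp: adjH')
        obtain t where t: "(u, t) \<in> (adj H' \<inter> (insert u X) \<times> (insert u X))\<^sup>*" "(t, v) \<in> adj H'" "t \<noteq> u"
          using q.outer_add_ear[OF qroot E(1) _ X_def] finish neg by blast
        obtain s where s: "(v, s) \<in> (adj H' \<inter> (insert v Y) \<times> (insert v Y))\<^sup>*" "(s, u) \<in> adj H'" "s \<noteq> v"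
          using r.outer_add_ear[OF rroot E(2) _ Y_def] finish' neg by blast
        obtain xs where xs: "xs \<noteq> []" "distinct xs" "hd xs = u" "last xs = t"
          "set xs \<subseteq> insert u X" "path_edges xs \<subseteq> {{x, y} |x y. (x, y) \<in> adj H' \<inter> (insert u X) \<times> (insert u X)}"
          using rtrancl_simple_path[OF t(1)] by blast
        obtain ys where ys: "ys \<noteq> []" "distinct ys" "hd ys = v" "last ys = s"
          "set ys \<subseteq> insert v Y" "path_edges ys \<subseteq> {{x, y} |x y. (x, y) \<in> adj H' \<inter> (insert v Y) \<times> (insert v Y)}"
          using rtrancl_simple_path[OF s(1)] by blast
        \<comment> \<open>The detours must be paths of \<open>G\<close>, and the only edge that
          suppression may have added is \<open>u v\<close>.\<close>
        have HG: "{x, y} \<in> edges G" if "(x, y) \<in> adj H'" "{x, y} \<noteq> {u, v}" for x y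
          using that by (auto simp: adj_def H'_def)
        have pxs: "path_edges xs \<subseteq> edges G"
        proof
          fix f assume "f \<in> path_edges xs"
          then obtain x y where xy: "f = {x, y}" "(x, y) \<in> adj H'" "x \<in> insert u X" "y \<in> insert u X" using xs(6) by blast
          have "v \<notin> insert u X" using XY 3 by simp
          then have "v \<noteq> x" "v \<noteq> y" using xy by metis+
          then have "{x, y} \<noteq> {u, v}" by auto
          then show "f \<in> edges G" using HG xy by simp
        qed
        have pys: "path_edges ys \<subseteq> edges G"
        proof
          fix f assume "f \<in> path_edges ys"
          then obtain x y where xy: "f = {x, y}" "(x, y) \<in> adj H'" "x \<in> insert v Y" "y \<in> insert v Y" using ys(6) by blast
          have "u \<notin> insert v Y" using XY 3 by simp
          then have "u \<noteq> x" "u \<noteq> y" using xy by metis+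
          then have "{x, y} \<noteq> {u, v}" by auto
          then show "f \<in> edges G" using HG xy by simp
        qed
        have tX: "t \<in> X" using xs t(3) last_in_set[OF xs(1)] by auto
        have sY: "s \<in> Y" using ys s(3) last_in_set[OF ys(1)] by auto
        have tv: "{t, v} \<in> edges G" using HG[OF t(2)] tX XY t(3) by (auto simp: doubleton_eq_iff)
        have su: "{s, u} \<in> edges G" using HG[OF s(2)] sY XY s(3) by (auto simp: doubleton_eq_iff)
        have Vs: "X \<subseteq> verts G" "Y \<subseteq> verts G" "e \<notin> X" "e \<notin> Y" by (auto simp: X_def Y_def)
        have g1: "graph_path G (xs @ [v])"
          using xs(2,5) pxs path_edges_append[OF xs(1), of "[v]"] xs(4) tv uv Vs XY 3 by (auto simp: graph_path_def)
        have "graph_path G (ys @ [u])"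
          using ys(2,5) pys path_edges_append[OF ys(1), of "[u]"] ys(4) su uv Vs XY 3 by (auto simp: graph_path_def)
        then have g2: "graph_path G (rev (ys @ [u]))"
          unfolding graph_path_def path_edges_rev by simp
        have g3: "graph_path G [u, e, v]"
          using uv e 3 by (auto simp: graph_path_def N_def insert_commute)
        have "2 \<le> length xs" using xs(1,3,4) t(3) by (cases xs rule: path_edges.cases) auto
        moreover have "2 \<le> length ys" using ys(1,3,4) s(3) by (cases ys rule: path_edges.cases) auto
        ultimately show False
        proof (intro no_theta[OF g1 g2 g3, of u v])
          show "hd (xs @ [v]) = u" "hd (rev (ys @ [u])) = u" "hd [u, e, v] = u" "last (xs @ [v]) = v"
            "last (rev (ys @ [u])) = v" "last [u, e, v] = v"
            using xs ys by (auto simp: hd_append last_rev)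
          have in_sets: "u \<in> set xs" "v \<in> set ys" using xs ys hd_in_set by metis+
          have eN: "e \<notin> set xs" "e \<notin> set ys" using xs(5) ys(5) Vs uv by auto
          show "set (xs @ [v]) \<inter> set (rev (ys @ [u])) = {u, v}"
            using in_sets xs(5) ys(5) XY by auto
          show "set (xs @ [v]) \<inter> set [u, e, v] = {u, v}" using in_sets eN uv by auto
          show "set (rev (ys @ [u])) \<inter> set [u, e, v] = {u, v}" using in_sets eN uv by auto
        qed auto
      qed
    qed
  qed
qed

section \<open>From noncrossing orders to plane drawings\<close>

definition parab :: "nat \<Rightarrow> complex" where "parab i = Complex (real i) ((real i)\<^sup>2)"

definition chord :: "nat set \<Rightarrow> real \<Rightarrow> complex" where
  "chord e = linepath (parab (Min e)) (parab (Max e))"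

text \<open>A chord exceeds the parabola by a product that vanishes exactly at its two ends, which
  turns intersections of chords into polynomial equations in the real part.\<close>

lemma parab_segment:
  assumes "z \<in> closed_segment (parab i) (parab j)" "i < j"
  shows "real i \<le> Re z" "Re z \<le> real j" "Im z = (Re z)\<^sup>2 + (Re z - real i) * (real j - Re z)"
proof -
  obtain t where t: "0 \<le> t" "t \<le> 1" "z = (1 - t) *\<^sub>R parab i + t *\<^sub>R parab j"
    using assms(1) by (auto simp: in_segment)
  have re: "Re z = real i + t * (real j - real i)" and im: "Im z = (real i)\<^sup>2 + t * ((real j)\<^sup>2 - (real i)\<^sup>2)"
    unfolding t(3) by (simp_all add: parab_def algebra_simps)
  show "real i \<le> Re z" using re t assms(2) by simp
  have "t * (real j - real i) \<le> 1 * (real j - real i)" using t assms(2) by (intro mult_right_mono) auto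
  then show "Re z \<le> real j" using re by simp
  show "Im z = (Re z)\<^sup>2 + (Re z - real i) * (real j - Re z)"
    unfolding re im by (simp add: power2_eq_square algebra_simps)
qed

lemma convex_epigraph_square: "convex {z. (Re z)\<^sup>2 \<le> Im z}"
proof (rule convexI)
  fix x y :: complex and u v :: real
  assume x: "x \<in> {z. (Re z)\<^sup>2 \<le> Im z}" and y: "y \<in> {z. (Re z)\<^sup>2 \<le> Im z}" and uv: "0 \<le> u" "0 \<le> v" "u + v = 1"
  have "(u * Re x + v * Re y)\<^sup>2 + u * v * (Re x - Re y)\<^sup>2 = (u + v) * (u * (Re x)\<^sup>2 + v * (Re y)\<^sup>2)"
    by (simp add: power2_eq_square algebra_simps)
  moreover have "0 \<le> u * v * (Re x - Re y)\<^sup>2" using uv by simp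
  ultimately have "(u * Re x + v * Re y)\<^sup>2 \<le> u * (Re x)\<^sup>2 + v * (Re y)\<^sup>2" unfolding uv(3) mult_1 by linarith
  also have "\<dots> \<le> u * Im x + v * Im y" using x y uv by (intro add_mono mult_left_mono) auto
  finally show "u *\<^sub>R x + v *\<^sub>R y \<in> {z. (Re z)\<^sup>2 \<le> Im z}" by simp
qed

text \<open>Points just below the parabola are outside every subset of the convex epigraph, and they
  converge to the given point.\<close>

lemma parab_in_frontier:
  assumes "D \<subseteq> {z. (Re z)\<^sup>2 \<le> Im z}" "parab k \<in> D"
  shows "parab k \<in> frontier (outside D)"
proof -
  define f where "f m = Complex (real k) ((real k)\<^sup>2 - inverse (real (Suc m)))" for m
  have "f m \<in> outside D" for m
  proof -
    have "f m \<notin> {z. (Re z)\<^sup>2 \<le> Im z}" by (simp add: f_def)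
    then have "f m \<in> outside {z. (Re z)\<^sup>2 \<le> Im z}" using convex_in_outside[OF convex_epigraph_square] by blast
    then show ?thesis using outside_mono[OF assms(1)] by blast
  qed
  moreover have "f \<longlonglongrightarrow> parab k"
  proof -
    have "(\<lambda>m. Complex (real k) ((real k)\<^sup>2 - inverse (real (Suc m)))) \<longlonglongrightarrow> Complex (real k) ((real k)\<^sup>2 - 0)"
      by (intro tendsto_Complex tendsto_intros LIMSEQ_inverse_real_of_nat)
    then show ?thesis unfolding f_def[abs_def] parab_def by (simp only: diff_0_right)
  qed
  ultimately have "parab k \<in> closure (outside D)"
    unfolding closure_sequential by blast
  moreover have "parab k \<notin> interior (outside D)"
    using assms(2) outside_no_overlap[of D] interior_subset by blast
  ultimately show ?thesis by (simp add: frontier_def)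
qed

lemma noncrossing_imp_outerplanar:
  fixes G :: "nat graph"
  assumes simple: "simple_graph G" and nc: "noncrossing id (adj G)"
  shows "outerplanar G"
proof -
  have edge: "\<exists>i j. i < j \<and> e = {i, j} \<and> path_image (chord e) = closed_segment (parab i) (parab j) \<and>
      chord e = linepath (parab i) (parab j)" if "e \<in> edges G" for e
  proof -
    have "card e = 2" using simple that by (auto simp: simple_graph_def)
    then obtain a b where ab: "e = {a, b}" "a \<noteq> b" by (auto simp: card_2_iff)
    then consider "a < b" | "b < a" by linarith
    then show ?thesis
    proof cases
      case 1
      then show ?thesis using ab by - (rule exI[of _ a], rule exI[of _ b], auto simp: chord_def)
    next
      case 2
      then show ?thesis using ab by - (rule exI[of _ b], rule exI[of _ a], auto simp: chord_def)
    qed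
  qed
  have inj: "inj parab" by (auto simp: inj_def parab_def)
  have ncr: False if "{i, j} \<in> edges G" "{k, l} \<in> edges G" "i < k" "k < j" "j < l" for i j k l
    using nc that by (auto simp: noncrossing_def adj_def)
  \<comment> \<open>For nested chords the difference in height is a sum of two nonnegative products;
    at a common point both vanish, which leaves only common ends.\<close>
  have nested: "z \<in> parab ` ({i, j} \<inter> {k, l})"
    if z: "z \<in> closed_segment (parab i) (parab j)" "z \<in> closed_segment (parab k) (parab l)"
      and lt: "i < j" "k < l" "i \<le> k" "l \<le> j" "{i, j} \<noteq> {k, l}" for i j k l z
  proof -
    define x where "x = Re z"
    note s = parab_segment[OF z(1) lt(1)] and t = parab_segment[OF z(2) lt(2)]
    have eq: "(x - real i) * (real j - x) = (x - real k) * (real l - x)" using s(3) t(3) by (simp add: x_def)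
    have "(x - real i) * (real j - x) - (x - real k) * (real l - x) = (real k - real i) * (real j - x) + (x - real k) * (real j - real l)"
      by (simp add: algebra_simps)
    moreover have nn: "0 \<le> (real k - real i) * (real j - x)" "0 \<le> (x - real k) * (real j - real l)"
      using s t lt by (auto simp: x_def)
    ultimately have "(real k - real i) * (real j - x) = 0" "(x - real k) * (real j - real l) = 0" using eq by linarith+
    then consider "k = i" "x = real k" | "k = i" "j = l" | "x = real j" "x = real k" | "x = real j" "j = l" by auto
    moreover have zeq: "z = parab m" if "x = real m" "m \<in> {i, j}" for m
      using that s(3) by (auto simp: complex_eq_iff parab_def x_def)
    ultimately show ?thesis
    proof cases
      case 1 then show ?thesis using zeq[of i] by auto
    next
      case 2 then show ?thesis using lt by auto
    next
      case 3 then show ?thesis using t lt by (auto simp: x_def)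
    next
      case 4 then show ?thesis using zeq[of j] by auto
    qed
  qed
  have apart: "z \<in> parab ` ({i, j} \<inter> {k, l})"
    if z: "z \<in> closed_segment (parab i) (parab j)" "z \<in> closed_segment (parab k) (parab l)"
      and lt: "i < j" "k < l" "j \<le> k" for i j k l z
  proof -
    note s = parab_segment[OF z(1) lt(1)] and t = parab_segment[OF z(2) lt(2)]
    have "Re z = real j" "j = k" using s t lt by linarith+
    then have "z = parab j" using s(3) by (auto simp: complex_eq_iff parab_def)
    then show ?thesis using \<open>j = k\<close> by auto
  qed
  have meet: "path_image (chord e) \<inter> path_image (chord e') \<subseteq> parab ` (e \<inter> e')"
    if e: "e \<in> edges G" "e' \<in> edges G" "e \<noteq> e'" for e e'
  proof
    fix z assume z: "z \<in> path_image (chord e) \<inter> path_image (chord e')"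
    obtain i j where ij: "i < j" "e = {i, j}" "path_image (chord e) = closed_segment (parab i) (parab j)" using edge[OF e(1)] by blast
    obtain k l where kl: "k < l" "e' = {k, l}" "path_image (chord e') = closed_segment (parab k) (parab l)" using edge[OF e(2)] by blast
    have z': "z \<in> closed_segment (parab i) (parab j)" "z \<in> closed_segment (parab k) (parab l)" using z ij kl by auto
    have "\<not> (i < k \<and> k < j \<and> j < l)" "\<not> (k < i \<and> i < l \<and> l < j)" using ncr[of i j k l] ncr[of k l i j] e ij kl by auto
    then consider "j \<le> k" | "l \<le> i" | "i \<le> k" "l \<le> j" | "k \<le> i" "j \<le> l" by linarith
    then show "z \<in> parab ` (e \<inter> e')"
    proof cases
      case 1 then show ?thesis using apart[OF z' ij(1) kl(1)] ij kl by simp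
    next
      case 2 then show ?thesis using apart[OF z'(2,1) kl(1) ij(1)] ij kl by (simp add: Int_commute)
    next
      case 3 then show ?thesis using nested[OF z' ij(1) kl(1)] ij kl e(3) by simp
    next
      case 4 then show ?thesis using nested[OF z'(2,1) kl(1) ij(1)] ij kl e(3) by (auto simp: Int_commute)
    qed
  qed
  have ends: "path_image (chord e) \<inter> parab ` verts G = parab ` e" if e: "e \<in> edges G" for e
  proof
    obtain i j where ij: "i < j" "e = {i, j}" "path_image (chord e) = closed_segment (parab i) (parab j)" using edge[OF e] by blast
    have "e \<subseteq> verts G" using simple e by (auto simp: simple_graph_def)
    then show "parab ` e \<subseteq> path_image (chord e) \<inter> parab ` verts G" using ij by auto
    show "path_image (chord e) \<inter> parab ` verts G \<subseteq> parab ` e"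
    proof
      fix z assume "z \<in> path_image (chord e) \<inter> parab ` verts G"
      then obtain k where k: "z = parab k" "z \<in> closed_segment (parab i) (parab j)" using ij by auto
      from parab_segment(3)[OF k(2) ij(1)] have "(real k - real i) * (real j - real k) = 0" by (simp add: k(1) parab_def)
      then show "z \<in> parab ` e" using k(1) ij(2) by auto
    qed
  qed
  have "plane_drawing G parab chord"
    unfolding plane_drawing_def
  proof (intro conjI ballI impI)
    show "inj_on parab (verts G)" using inj inj_on_subset by blast
    fix e assume e: "e \<in> edges G"
    obtain i j where ij: "i < j" "e = {i, j}" "chord e = linepath (parab i) (parab j)" using edge[OF e] by blast
    have "parab i \<noteq> parab j" using ij(1) inj by (auto simp: inj_def)
    then show "arc (chord e)" using ij(3) by (simp add: arc_linepath)
    show "{pathstart (chord e), pathfinish (chord e)} = parab ` e" using ij by simp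
    show "path_image (chord e) \<inter> parab ` verts G = parab ` e" by (rule ends[OF e])
    show "path_image (chord e) \<inter> path_image (chord e') \<subseteq> parab ` (e \<inter> e')" if "e' \<in> edges G" "e \<noteq> e'" for e'
      by (rule meet[OF e that])
  qed
  moreover have "parab ` verts G \<subseteq> frontier (outside (drawing_points G parab chord))"
  proof -
    have "drawing_points G parab chord \<subseteq> {z. (Re z)\<^sup>2 \<le> Im z}"
    proof
      fix z assume "z \<in> drawing_points G parab chord"
      then consider k where "z = parab k" | e where "e \<in> edges G" "z \<in> path_image (chord e)" by (auto simp: drawing_points_def)
      then show "z \<in> {z. (Re z)\<^sup>2 \<le> Im z}"
      proof cases
        case 1 then show ?thesis by (simp add: parab_def)
      next
        case 2
        then obtain i j where ij: "i < j" "z \<in> closed_segment (parab i) (parab j)" using edge[OF 2(1)] by auto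
        note s = parab_segment[OF ij(2,1)]
        have "0 \<le> (Re z - real i) * (real j - Re z)" using s(1,2) by simp
        then show ?thesis using s(3) by simp
      qed
    qed
    then show ?thesis using parab_in_frontier by (auto simp: drawing_points_def)
  qed
  ultimately show ?thesis using simple by (auto simp: outerplanar_def)
qed

section \<open>The extremal construction\<close>

text \<open>The hub \<open>0\<close> is joined to all odd vertices and to all vertices beyond \<open>2k\<close>, each even vertex up to
  \<open>2k\<close> is an ear on its two odd neighbours.  Taking \<open>k = n/4\<close> leaves the hub with degree about \<open>3n/4\<close>.\<close>

definition fan :: "nat \<Rightarrow> nat \<Rightarrow> nat \<Rightarrow> bool" where
  "fan k i j \<longleftrightarrow> i < j \<and> (i = 0 \<and> (odd j \<or> 2 * k < j) \<or> 0 < i \<and> j = i + 1 \<or> odd i \<and> i < 2 * k \<and> j = i + 2)"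

definition fan_rel :: "nat \<Rightarrow> nat \<Rightarrow> (nat \<times> nat) set" where
  "fan_rel k n = {(i, j). i < n \<and> j < n \<and> (fan k i j \<or> fan k j i)}"

text \<open>Apart from the edges at the first vertex, the only edges passing over a vertex go from
  an odd \<open>a\<close> to \<open>a + 2\<close>. They cover the ear \<open>a + 1\<close>, which
  has no neighbours besides \<open>a\<close> and \<open>a + 2\<close>.\<close>

lemma noncrossing_fan_rel: "noncrossing id (fan_rel k n)"
  unfolding noncrossing_def
proof (intro allI impI notI, elim conjE)
  fix i j a b
  assume "(i, j) \<in> fan_rel k n" "(a, b) \<in> fan_rel k n" and lt: "id i < id a" "id a < id j" "id j < id b"
  then have f: "fan k i j" "fan k a b" by (auto simp: fan_rel_def fan_def)
  have "0 < a" using lt by simp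
  then have ab: "b = a + 2" "odd a" "a < 2 * k" "j = a + 1" using f(2) lt by (auto simp: fan_def)
  then have "i = 0 \<or> i + 2 = j" using f(1) lt by (auto simp: fan_def)
  then show False using f(1) ab lt by (auto simp: fan_def)
qed

lemma sgraph_fan_rel: "sgraph {..<n} (fan_rel k n)"
  by unfold_locales (auto simp: fan_rel_def fan_def sym_def irrefl_def)

lemma card_Sigma_const:
  assumes "finite A" "\<And>x. x \<in> A \<Longrightarrow> card (B x) = m" "0 < m"
  shows "card (Sigma A B) = card A * m"
proof -
  have "\<And>x. x \<in> A \<Longrightarrow> finite (B x)" using assms(2,3) card_ge_0_finite by metis
  then show ?thesis using assms by (simp add: card_SigmaI)
qed

locale fan_graph =
  fixes k n :: nat
  assumes k: "4 * k \<le> n" "n < 4 * k + 4" and n: "40 \<le> n"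
begin

abbreviation E where "E \<equiv> fan_rel k n"

text \<open>The margins keep the walks listed below within one part of the graph: from
  \<open>odds\<close> and \<open>odds'\<close> they stay between 1 and \<open>2 * k + 1\<close>,
  from \<open>rim\<close> and \<open>rim'\<close> above \<open>2 * k\<close>. This costs only
  constants.\<close>

definition rim where "rim = {2 * k + 2..n - 2}"
definition rim' where "rim' = {2 * k + 3..n - 3}"
definition odds where "odds = (\<lambda>i. 2 * i + 3) ` {..<k - 1}"
definition odds' where "odds' = (\<lambda>i. 2 * i + 5) ` {..<k - 3}"

text \<open>Explicit families of walks from the hub. An odd \<open>y\<close> has four continuations
  by one step and eight by two steps, against two each on the rim; up to constants this attains the
  upper bounds 2d + 2 |out| and 2d + 6 |out| with |out| = k.\<close>

definition w2 :: "(nat \<times> nat) set" where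
  "w2 = (SIGMA y:rim. {y - 1, y + 1}) \<union> (SIGMA y:odds. {y - 2, y - 1, y + 1, y + 2})"

definition w3 :: "(nat \<times> nat \<times> nat) set" where
  "w3 = (SIGMA y:rim'. {(y + 1, y + 2), (y - 1, y - 2)}) \<union>
    (SIGMA y:odds'. {(y + 2, y + 4), (y + 2, y + 3), (y + 2, y + 1), (y + 1, y + 2),
                     (y - 2, y - 4), (y - 2, y - 3), (y - 2, y - 1), (y - 1, y - 2)})"

lemma in_odds: "y \<in> odds \<Longrightarrow> odd y \<and> 3 \<le> y \<and> y \<le> 2 * k - 1"
  by (auto simp: odds_def)

lemma in_odds': "y \<in> odds' \<Longrightarrow> odd y \<and> 5 \<le> y \<and> y \<le> 2 * k - 3"
  by (auto simp: odds'_def)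

lemma finite_w [simp]: "finite w2" "finite w3"
  by (auto simp: w2_def w3_def rim_def rim'_def odds_def odds'_def)

lemma card_w2: "card w2 = 2 * n - 10"
proof -
  have "card (SIGMA y:rim. {y - 1, y + 1}) = card rim * 2"
    by (rule card_Sigma_const) (auto simp: rim_def card_insert_if)
  moreover have "card (SIGMA y:odds. {y - 2, y - 1, y + 1, y + 2}) = card odds * 4"
    by (rule card_Sigma_const) (auto simp: odds_def card_insert_if)
  moreover have "card rim = n - 2 * k - 3" using k n by (simp add: rim_def)
  moreover have "card odds = k - 1" by (simp add: odds_def card_image inj_on_def)
  moreover have "card w2 = card (SIGMA y:rim. {y - 1, y + 1}) + card (SIGMA y:odds. {y - 2, y - 1, y + 1, y + 2})"
    unfolding w2_def by (rule card_Un_disjoint) (auto simp: rim_def odds_def)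
  ultimately show ?thesis using k n by simp
qed

lemma card_w3: "card w3 = 2 * n + 4 * k - 34"
proof -
  have "card (SIGMA y:rim'. {(y + 1, y + 2), (y - 1, y - 2)}) = card rim' * 2"
    by (rule card_Sigma_const) (auto simp: rim'_def card_insert_if)
  moreover have "card (SIGMA y:odds'. {(y + 2, y + 4), (y + 2, y + 3), (y + 2, y + 1), (y + 1, y + 2),
      (y - 2, y - 4), (y - 2, y - 3), (y - 2, y - 1), (y - 1, y - 2)}) = card odds' * 8"
  proof (rule card_Sigma_const)
    fix y assume "y \<in> odds'"
    then obtain i where "y = 2 * i + 5" by (auto simp: odds'_def)
    then show "card {(y + 2, y + 4), (y + 2, y + 3), (y + 2, y + 1), (y + 1, y + 2),
      (y - 2, y - 4), (y - 2, y - 3), (y - 2, y - 1), (y - 1, y - 2)} = 8" by simp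
  qed (auto simp: odds'_def)
  moreover have "card rim' = n - 2 * k - 5" using k n by (simp add: rim'_def)
  moreover have "card odds' = k - 3" by (simp add: odds'_def card_image inj_on_def)
  moreover have "card w3 = card (SIGMA y:rim'. {(y + 1, y + 2), (y - 1, y - 2)}) +
      card (SIGMA y:odds'. {(y + 2, y + 4), (y + 2, y + 3), (y + 2, y + 1), (y + 1, y + 2),
        (y - 2, y - 4), (y - 2, y - 3), (y - 2, y - 1), (y - 1, y - 2)})"
    unfolding w3_def by (rule card_Un_disjoint) (auto simp: rim'_def odds'_def)
  ultimately show ?thesis using k n by simp
qed

lemma w2_walk:
  assumes "(y, z) \<in> w2"
  shows "(0, y) \<in> E" "(y, z) \<in> E" "0 < y" "0 < z" "y \<noteq> z" "y \<le> z + 2" "z \<le> y + 2"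
proof -
  consider "2 * k + 2 \<le> y" "y \<le> n - 2" "z = y - 1 \<or> z = y + 1"
    | "odd y" "3 \<le> y" "y \<le> 2 * k - 1" "z = y - 2 \<or> z = y - 1 \<or> z = y + 1 \<or> z = y + 2"
    using assms in_odds by (auto simp: w2_def rim_def)
  note c = this
  show "0 < y" using c by cases auto
  show "0 < z" using c by cases auto
  show "y \<noteq> z" using c by cases auto
  show "y \<le> z + 2" using c by cases auto
  show "z \<le> y + 2" using c by cases auto
  show "(0, y) \<in> E" using c
    by cases (use k n in \<open>auto simp: fan_rel_def fan_def\<close>)
  show "(y, z) \<in> E" using c
  proof cases
    case 1
    then show ?thesis using k n by (auto simp: fan_rel_def fan_def)
  next
    case 2
    then show ?thesis using k n by (auto simp: fan_rel_def fan_def)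
  qed
qed

lemma w3_walk:
  assumes "(y, b, z) \<in> w3"
  shows "(0, y) \<in> E" "(y, b) \<in> E" "(b, z) \<in> E" "distinct [0, y, b, z]"
proof -
  consider "2 * k + 3 \<le> y" "y \<le> n - 3" "(b, z) = (y + 1, y + 2) \<or> (b, z) = (y - 1, y - 2)"
    | "odd y" "5 \<le> y" "y \<le> 2 * k - 3" "(b, z) \<in> {(y + 2, y + 4), (y + 2, y + 3), (y + 2, y + 1), (y + 1, y + 2),
        (y - 2, y - 4), (y - 2, y - 3), (y - 2, y - 1), (y - 1, y - 2)}"
  proof -
    have "(y \<in> rim' \<and> (b, z) \<in> {(y + 1, y + 2), (y - 1, y - 2)}) \<or> (y \<in> odds' \<and> (b, z) \<in> {(y + 2, y + 4), (y + 2, y + 3),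
        (y + 2, y + 1), (y + 1, y + 2), (y - 2, y - 4), (y - 2, y - 3), (y - 2, y - 1), (y - 1, y - 2)})"
      using assms unfolding w3_def Un_iff mem_Sigma_iff .
    then show thesis using that in_odds'[of y] unfolding rim'_def by auto
  qed
  note c = this
  have "(0, y) \<in> E \<and> (y, b) \<in> E \<and> (b, z) \<in> E \<and> distinct [0, y, b, z]" using c
  proof cases
    case 1
    define i where "i = y - 2"
    have y: "y = i + 2" and i: "2 * k < i" "i + 5 \<le> n" using 1(1,2) n by (auto simp: i_def)
    have rim: "(m, m + 1) \<in> E" "(m + 1, m) \<in> E" if "0 < m" "m < i + 4" for m
      using that i by (auto simp: fan_rel_def fan_def)
    have "(0, y) \<in> E" using y i by (simp add: fan_rel_def fan_def)
    then show ?thesis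
      using 1(3) i(1) rim[of i] rim[of "i + 1"] rim[of "i + 2"] rim[of "i + 3"]
      unfolding y by - (elim disjE; simp add: numeral_eq_Suc)
  next
    case 2
    from 2(1) obtain m where m: "y = 2 * m + 1" by (rule oddE)
    define i where "i = m - 2"
    have y: "y = 2 * i + 5" using 2(2) by (simp add: m i_def)
    then have i: "2 * i + 8 \<le> 2 * k" using 2(3) by linarith
    have rim: "(m, m + 1) \<in> E" "(m + 1, m) \<in> E" if "0 < m" "m < 2 * i + 9" for m
      using that i k by (auto simp: fan_rel_def fan_def)
    have skip: "(2 * m + 1, 2 * m + 3) \<in> E" "(2 * m + 3, 2 * m + 1) \<in> E" if "m < i + 4" for m
      using that i k by (auto simp: fan_rel_def fan_def)
    have "(0, y) \<in> E" using y i k by (simp add: fan_rel_def fan_def)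
    then show ?thesis
      using 2(4) skip[of i] skip[of "i + 1"] skip[of "i + 2"] skip[of "i + 3"]
        rim[of "2 * i + 1"] rim[of "2 * i + 2"] rim[of "2 * i + 3"] rim[of "2 * i + 4"] rim[of "2 * i + 5"]
        rim[of "2 * i + 6"] rim[of "2 * i + 7"] rim[of "2 * i + 8"]
      unfolding y by - (elim insertE emptyE; simp add: numeral_eq_Suc)
  qed
  then show "(0, y) \<in> E" "(y, b) \<in> E" "(b, z) \<in> E" "distinct [0, y, b, z]" by blast+
qed

lemma hub_sym: "(x, y) \<in> E \<Longrightarrow> (y, x) \<in> E" by (auto simp: fan_rel_def)

text \<open>A step changes the label by at most two, so walks whose first vertices differ by more
  than four are disjoint. At most 9 * 4 walks are too close to a given one, whence 2n - 10 -
  36.\<close>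

lemma hub_middle:
  "(2 * n - 10) * (2 * n - 46) \<le> card {t \<in> paths5 E. fst (snd (snd t)) = 0}"
proof -
  define far where "far w = {(y', z') \<in> w2. fst w + 4 < y' \<or> y' + 4 < fst w}" for w :: "nat \<times> nat"
  have "2 * n - 46 \<le> card (far w)" for w
  proof -
    obtain y z where w: "w = (y, z)" by (cases w)
    have "w2 - far w \<subseteq> (SIGMA y':{y - 4..y + 4}. {y' - 2, y' - 1, y' + 1, y' + 2})"
      by (auto simp: far_def w w2_def)
    moreover have "card (SIGMA y':{y - 4..y + 4}. {y' - 2, y' - 1, y' + 1, y' + 2}) \<le> 9 * 4"
      by (rule card_Sigma_le) (auto simp: card_insert_if)
    ultimately have "card (w2 - far w) \<le> 36"
      using card_mono[of "SIGMA y':{y - 4..y + 4}. {y' - 2, y' - 1, y' + 1, y' + 2}" "w2 - far w"] by simp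
    moreover have "far w \<subseteq> w2" by (auto simp: far_def)
    ultimately show ?thesis
      using card_w2 card_Diff_subset[of "far w" w2] finite_subset[of "far w" w2] by simp
  qed
  then have "card w2 * (2 * n - 46) \<le> (\<Sum>w\<in>w2. card (far w))"
    using sum_bounded_below[of w2 "2 * n - 46" "\<lambda>w. card (far w)"] by simp
  also have "\<dots> = card (Sigma w2 far)"
    by (rule card_SigmaI[symmetric]) (auto simp: far_def intro: finite_subset[of _ w2])
  also have "\<dots> \<le> card {t \<in> paths5 E. fst (snd (snd t)) = 0}"
  proof (rule card_inj_on_le)
    let ?f = "\<lambda>((y, z), (y', z')). (z, y, 0 :: nat, y', z') :: nat \<times> nat \<times> nat \<times> nat \<times> nat"
    show "inj_on ?f (Sigma w2 far)" by (auto simp: inj_on_def)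
    show "?f ` Sigma w2 far \<subseteq> {t \<in> paths5 E. fst (snd (snd t)) = 0}"
    proof (clarsimp simp: far_def)
      fix y z y' z'
      assume w: "(y, z) \<in> w2" "(y', z') \<in> w2" and d: "y + 4 < y' \<or> y' + 4 < y"
      note a = w2_walk[OF w(1)] and b = w2_walk[OF w(2)]
      have "distinct [z, y, 0, y', z']" using a(3-7) b(3-7) d by auto
      then show "(z, y, 0, y', z') \<in> paths5 E"
        using a(1,2) b(1,2) hub_sym unfolding paths5_def by blast
    qed
    show "finite {t \<in> paths5 E. fst (snd (snd t)) = 0}"
      using sgraph.finite_paths5[OF sgraph_fan_rel] by simp
  qed
  finally show ?thesis by (simp add: card_w2)
qed

text \<open>The parameter \<open>g\<close>, identity or reversal, treats the second and the fourth
  place together. The hub has at least n - k - 1 neighbours, at most three of which are on the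
  walk.\<close>

lemma hub_second:
  fixes g :: "nat \<times> nat \<times> nat \<times> nat \<times> nat \<Rightarrow> nat \<times> nat \<times> nat \<times> nat \<times> nat"
  assumes g: "g = id \<or> g = (\<lambda>(a, b, c, d, e). (e, d, c, b, a))"
  shows "(2 * n + 4 * k - 34) * (n - k - 4) \<le> card {t \<in> paths5 E. fst (snd (g t)) = 0}"
proof -
  define free where "free w = nb E 0 - (case w of (y, b, z) \<Rightarrow> {y, b, z})" for w :: "nat \<times> nat \<times> nat"
  have fin: "finite (nb E 0)" by (rule finite_subset[of _ "{..<n}"]) (auto simp: fan_rel_def)
  have "n - k - 1 \<le> card (nb E 0)"
  proof -
    have "card ((\<lambda>i. 2 * i + 1) ` {..<k} \<union> {2 * k + 1..<n}) = card ((\<lambda>i::nat. 2 * i + 1) ` {..<k}) + card {2 * k + 1..<n}"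
      by (rule card_Un_disjoint) auto
    moreover have "card ((\<lambda>i::nat. 2 * i + 1) ` {..<k}) = k" by (simp add: card_image inj_on_def)
    moreover have "(\<lambda>i. 2 * i + 1) ` {..<k} \<union> {2 * k + 1..<n} \<subseteq> nb E 0"
      using k n by (auto simp: fan_rel_def fan_def)
    ultimately show ?thesis
      using card_mono[OF fin, of "(\<lambda>i. 2 * i + 1) ` {..<k} \<union> {2 * k + 1..<n}"] k n by simp
  qed
  then have "n - k - 4 \<le> card (free w)" for w
  proof -
    obtain y b z where w: "w = (y, b, z)" by (cases w)
    have "card {y, b, z} \<le> 3" by (simp add: card_insert_if)
    then show ?thesis using \<open>n - k - 1 \<le> card (nb E 0)\<close> diff_card_le_card_Diff[of "{y, b, z}" "nb E 0"]
      by (simp add: free_def w)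
  qed
  then have "card w3 * (n - k - 4) \<le> (\<Sum>w\<in>w3. card (free w))"
    using sum_bounded_below[of w3 "n - k - 4" "\<lambda>w. card (free w)"] by simp
  also have "\<dots> = card (Sigma w3 free)"
    by (rule card_SigmaI[symmetric]) (auto simp: free_def fin)
  also have "\<dots> \<le> card {t \<in> paths5 E. fst (snd (g t)) = 0}"
  proof (rule card_inj_on_le)
    let ?f = "\<lambda>((y, b, z), x). g (x, 0, y, b, z)"
    show "inj_on ?f (Sigma w3 free)" using g by (auto simp: inj_on_def)
    show "?f ` Sigma w3 free \<subseteq> {t \<in> paths5 E. fst (snd (g t)) = 0}"
    proof (rule image_subsetI)
      fix v assume "v \<in> Sigma w3 free"
      then obtain y b z x where v: "v = ((y, b, z), x)" and w: "(y, b, z) \<in> w3" and x: "x \<in> free (y, b, z)"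
        by (cases v) auto
      note a = w3_walk[OF w]
      have "(0, x) \<in> E" "distinct [x, y, b, z]" using x a(4) by (auto simp: free_def)
      moreover have "x \<noteq> 0" using \<open>(0, x) \<in> E\<close> by (auto simp: fan_rel_def fan_def)
      ultimately have "(x, 0, y, b, z) \<in> paths5 E"
        using a hub_sym by (auto simp: paths5_def)
      moreover from this have "(z, b, y, 0, x) \<in> paths5 E" by (rule sgraph.paths5_rev[OF sgraph_fan_rel])
      ultimately show "?f v \<in> {t \<in> paths5 E. fst (snd (g t)) = 0}"
        using g by (auto simp: v)
    qed
    show "finite {t \<in> paths5 E. fst (snd (g t)) = 0}"
      using sgraph.finite_paths5[OF sgraph_fan_rel] by simp
  qed
  finally show ?thesis by (simp add: card_w3)
qed

lemma card_paths5_fan: "17 / 2 * (real n)\<^sup>2 - 200 * real n \<le> real (card (paths5 E))"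
proof -
  let ?r = "\<lambda>(a, b, c, d, e). (e, d, c, b, a) :: nat \<times> nat \<times> nat \<times> nat \<times> nat"
  let ?A = "{t \<in> paths5 E. fst (snd (snd t)) = 0}" and ?B = "{t \<in> paths5 E. fst (snd (id t)) = 0}"
    and ?C = "{t \<in> paths5 E. fst (snd (?r t)) = 0}"
  have fin: "finite (paths5 E)" by (rule sgraph.finite_paths5[OF sgraph_fan_rel])
  have "card ?A + card ?B + card ?C = card (?A \<union> ?B \<union> ?C)"
    using fin by (subst card_Un_disjoint; (subst card_Un_disjoint)?) (auto simp: paths5_def)
  also have "\<dots> \<le> card (paths5 E)" using fin by (intro card_mono) auto
  finally have "(2 * n - 10) * (2 * n - 46) + 2 * ((2 * n + 4 * k - 34) * (n - k - 4)) \<le> card (paths5 E)"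
    using hub_middle hub_second[of id] hub_second[of ?r] by simp
  then have "real ((2 * n - 10) * (2 * n - 46) + 2 * ((2 * n + 4 * k - 34) * (n - k - 4))) \<le> real (card (paths5 E))"
    by (rule of_nat_mono)
  moreover have "real ((2 * n - 10) * (2 * n - 46) + 2 * ((2 * n + 4 * k - 34) * (n - k - 4))) =
      (2 * real n - 10) * (2 * real n - 46) + 2 * ((2 * real n + 4 * real k - 34) * (real n - real k - 4))"
    using k n by (simp add: of_nat_diff)
  \<comment> \<open>The rounding in k = n div 4 enters through 4k >= n - 3 in the first factor and k
    <= n / 4 in the second.\<close>
  moreover have "(3 * real n - 37) * (3 / 4 * real n - 4) \<le> (2 * real n + 4 * real k - 34) * (real n - real k - 4)"
    using k n by (intro mult_mono) linarith+
  moreover have "(2 * real n - 10) * (2 * real n - 46) + 2 * ((3 * real n - 37) * (3 / 4 * real n - 4)) =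
     17 / 2 * (real n)\<^sup>2 - 383 / 2 * real n + 756"
    by (simp add: power2_eq_square algebra_simps)
  ultimately show ?thesis by linarith
qed

end

section \<open>Copies of the path\<close>

definition tuple_graph :: "'a \<times> 'a \<times> 'a \<times> 'a \<times> 'a \<Rightarrow> 'a graph" where
  "tuple_graph = (\<lambda>(a, b, c, d, e). ({a, b, c, d, e}, {{a, b}, {b, c}, {c, d}, {d, e}}))"

lemma path_graph_5: "path_graph 5 = ({0, 1, 2, 3, 4}, {{0, 1}, {1, 2}, {2, 3}, {3, 4}})"
proof -
  have "{{i, Suc i} |i. Suc i < 5} = (\<lambda>i. {i, Suc i}) ` {..<4}" by auto
  also have "{..<4::nat} = {0, 1, 2, 3}" by auto
  finally have "{{i, Suc i} |i. Suc i < 5} = {{0, 1}, {1, 2}, {2, 3}, {3, 4::nat}}" by (simp add: numeral_eq_Suc)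
  moreover have "{..<5::nat} = {0, 1, 2, 3, 4}" by auto
  ultimately show ?thesis by (simp add: path_graph_def)
qed

text \<open>The inverse of an isomorphism lists the vertices of a copy in path order; conversely the
  place in the tuple is an isomorphism.\<close>

lemma copies_eq_image:
  fixes G :: "'a graph"
  assumes G: "simple_graph G"
  shows "{S. subgraph S G \<and> graph_iso S (path_graph 5)} = tuple_graph ` paths5 (adj G)"
proof (intro set_eqI iffI)
  fix S assume "S \<in> {S. subgraph S G \<and> graph_iso S (path_graph 5)}"
  then have sub: "subgraph S G" and "graph_iso S (path_graph 5)" by auto
  then obtain f where f: "bij_betw f (verts S) {0, 1, 2, 3, 4::nat}"
    and fe: "\<And>u v. u \<in> verts S \<Longrightarrow> v \<in> verts S \<Longrightarrow> {u, v} \<in> edges S \<longleftrightarrow> {f u, f v} \<in> {{0, 1}, {1, 2}, {2, 3}, {3, 4}}"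
    by (auto simp: graph_iso_def path_graph_5)
  define h where "h = inv_into (verts S) f"
  have h: "bij_betw h {0, 1, 2, 3, 4} (verts S)" unfolding h_def by (rule bij_betw_inv_into[OF f])
  then have V: "verts S = {h 0, h 1, h 2, h 3, h 4}" by (auto simp: bij_betw_def)
  have fh: "f (h i) = i" if "i \<in> {0, 1, 2, 3, 4}" for i
    unfolding h_def by (rule bij_betw_inv_into_right[OF f that])
  have dist: "distinct [h 0, h 1, h 2, h 3, h 4]"
    using h unfolding bij_betw_def inj_on_def by simp
  have hv: "h i \<in> verts S" if "i \<in> {0, 1, 2, 3, 4}" for i using that V by auto
  have he: "{h i, h j} \<in> edges S \<longleftrightarrow> {i, j} \<in> {{0, 1}, {1, 2}, {2, 3}, {3, 4}}"
    if "i \<in> {0, 1, 2, 3, 4}" "j \<in> {0, 1, 2, 3, 4}" for i j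
    using fe[OF hv[OF that(1)] hv[OF that(2)]] fh[OF that(1)] fh[OF that(2)] by simp
  have "edges S = {{h 0, h 1}, {h 1, h 2}, {h 2, h 3}, {h 3, h 4}}"
  proof
    show "edges S \<subseteq> {{h 0, h 1}, {h 1, h 2}, {h 2, h 3}, {h 3, h 4}}"
    proof
      fix x assume x: "x \<in> edges S"
      then have "x \<subseteq> verts S" "card x = 2" using sub by (auto simp: subgraph_def simple_graph_def)
      then obtain u v where uv: "x = {u, v}" "u \<in> verts S" "v \<in> verts S" by (auto simp: card_2_iff)
      have "verts S = h ` {0, 1, 2, 3, 4}" using h by (simp add: bij_betw_def)
      then obtain i j where ij: "u = h i" "v = h j" "i \<in> {0, 1, 2, 3, 4}" "j \<in> {0, 1, 2, 3, 4}" using uv(2,3) by blast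
      have "{i, j} \<in> {{0, 1}, {1, 2}, {2, 3}, {3, 4}}" using he[OF ij(3,4)] x uv(1) ij(1,2) by simp
      then have "h ` {i, j} \<in> (`) h ` {{0, 1}, {1, 2}, {2, 3}, {3, 4}}" by (rule imageI)
      then show "x \<in> {{h 0, h 1}, {h 1, h 2}, {h 2, h 3}, {h 3, h 4}}" using uv(1) ij(1,2) by simp
    qed
    show "{{h 0, h 1}, {h 1, h 2}, {h 2, h 3}, {h 3, h 4}} \<subseteq> edges S"
      using he[of 0 1] he[of 1 2] he[of 2 3] he[of 3 4] by simp
  qed
  then have "S = tuple_graph (h 0, h 1, h 2, h 3, h 4)" using V by (simp add: tuple_graph_def prod_eq_iff)
  moreover have "edges S \<subseteq> edges G" using sub by (simp add: subgraph_def)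
  then have "(h 0, h 1, h 2, h 3, h 4) \<in> paths5 (adj G)"
    using dist unfolding \<open>edges S = _\<close> by (simp add: paths5_def adj_def)
  ultimately show "S \<in> tuple_graph ` paths5 (adj G)" by blast
next
  fix S assume "S \<in> tuple_graph ` paths5 (adj G)"
  then obtain t where t: "S = tuple_graph t" "t \<in> paths5 (adj G)" by (rule imageE)
  obtain a b c d e where abcde: "t = (a, b, c, d, e)" by (cases t)
  have S: "S = ({a, b, c, d, e}, {{a, b}, {b, c}, {c, d}, {d, e}})"
    and E: "{a, b} \<in> edges G" "{b, c} \<in> edges G" "{c, d} \<in> edges G" "{d, e} \<in> edges G"
    and dist: "distinct [a, b, c, d, e]"
    using t by (simp_all add: abcde tuple_graph_def paths5_def adj_def)
  have sub: "x \<subseteq> verts G" if "x \<in> edges G" for x using G that by (auto simp: simple_graph_def)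
  have "simple_graph S" using dist by (simp add: simple_graph_def S)
  then have "subgraph S G" using E sub[OF E(1)] sub[OF E(2)] sub[OF E(3)] sub[OF E(4)] by (simp add: subgraph_def S)
  moreover have "graph_iso S (path_graph 5)"
  proof -
    define f :: "'a \<Rightarrow> nat" where "f x = (if x = a then 0 else if x = b then 1 else if x = c then 2 else if x = d then 3 else 4)" for x
    have fv: "f a = 0" "f b = 1" "f c = 2" "f d = 3" "f e = 4" using dist by (auto simp: f_def)
    have im: "f ` {a, b, c, d, e} = {0, 1, 2, 3, 4}" by (simp add: fv)
    have inj: "inj_on f {a, b, c, d, e}" using dist by (auto simp: inj_on_def fv)
    have imE: "(`) f ` {{a, b}, {b, c}, {c, d}, {d, e}} = {{0, 1}, {1, 2}, {2, 3}, {3, 4}}" by (simp add: fv)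
    have edge: "{u, v} \<in> {{a, b}, {b, c}, {c, d}, {d, e}} \<longleftrightarrow> {f u, f v} \<in> {{0, 1}, {1, 2}, {2, 3}, {3, 4}}"
      if uv: "u \<in> {a, b, c, d, e}" "v \<in> {a, b, c, d, e}" for u v
    proof
      assume "{u, v} \<in> {{a, b}, {b, c}, {c, d}, {d, e}}"
      then have "f ` {u, v} \<in> (`) f ` {{a, b}, {b, c}, {c, d}, {d, e}}" by (rule imageI)
      then show "{f u, f v} \<in> {{0, 1}, {1, 2}, {2, 3}, {3, 4}}" unfolding imE by simp
    next
      assume "{f u, f v} \<in> {{0, 1}, {1, 2}, {2, 3}, {3, 4}}"
      then have "{f u, f v} \<in> (`) f ` {{a, b}, {b, c}, {c, d}, {d, e}}" unfolding imE .
      then obtain x where x: "{f u, f v} = f ` x" "x \<in> {{a, b}, {b, c}, {c, d}, {d, e}}" by (rule imageE)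
      have 1: "{u, v} \<subseteq> {a, b, c, d, e}" using uv by simp
      have 2: "x \<subseteq> {a, b, c, d, e}" using x(2) by (elim insertE emptyE) simp_all
      have "{u, v} = x" using inj_on_image_eq_iff[OF inj 1 2] x(1) by simp
      then show "{u, v} \<in> {{a, b}, {b, c}, {c, d}, {d, e}}" using x(2) by simp
    qed
    have "bij_betw f {a, b, c, d, e} {0, 1, 2, 3, 4}" unfolding bij_betw_def using inj im by (rule conjI)
    then show ?thesis
      unfolding graph_iso_def path_graph_5 S fst_conv snd_conv by (intro exI[of _ f] conjI ballI edge)
  qed
  ultimately show "S \<in> {S. subgraph S G \<and> graph_iso S (path_graph 5)}" by blast
qed

text \<open>The first vertex has a single neighbour, so it is one of the two ends of the other
  tuple; from there the neighbourhoods determine the remaining vertices one by one.\<close>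

lemma tuple_graph_eq_iff:
  assumes v: "distinct [a, b, c, d, e]" and w: "distinct [a', b', c', d', e']"
  shows "tuple_graph (a, b, c, d, e) = tuple_graph (a', b', c', d', e') \<longleftrightarrow>
    (a', b', c', d', e') = (a, b, c, d, e) \<or> (a', b', c', d', e') = (e, d, c, b, a)"
proof
  assume eq: "tuple_graph (a, b, c, d, e) = tuple_graph (a', b', c', d', e')"
  then have V: "{a, b, c, d, e} = {a', b', c', d', e'}" by (simp add: tuple_graph_def)
  define A where "A = {(x, y). {x, y} \<in> {{a, b}, {b, c}, {c, d}, {d, e}}}"
  have A': "A = {(x, y). {x, y} \<in> {{a', b'}, {b', c'}, {c', d'}, {d', e'}}}"
    using eq by (simp add: A_def tuple_graph_def)
  have N: "A `` {a} = {b}" "A `` {b} = {a, c}" "A `` {c} = {b, d}" "A `` {d} = {c, e}" "A `` {e} = {d}"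
    using v by (auto simp: A_def doubleton_eq_iff)
  have N': "A `` {a'} = {b'}" "A `` {b'} = {a', c'}" "A `` {c'} = {b', d'}" "A `` {d'} = {c', e'}" "A `` {e'} = {d'}"
    using w by (auto simp: A' doubleton_eq_iff)
  have "a' \<in> {a, b, c, d, e}" using V by simp
  moreover have "a' \<noteq> b" "a' \<noteq> c" "a' \<noteq> d" using N N'(1) v by auto
  ultimately consider "a' = a" | "a' = e" by auto
  then show "(a', b', c', d', e') = (a, b, c, d, e) \<or> (a', b', c', d', e') = (e, d, c, b, a)"
  proof cases
    case 1
    then have b: "b' = b" using N(1) N'(1) by auto
    have c: "c' = c" using N(2) N'(2) v w unfolding 1 b by (auto simp: doubleton_eq_iff)
    have d: "d' = d" using N(3) N'(3) v w unfolding b c by (auto simp: doubleton_eq_iff)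
    have "e' = e" using N(4) N'(4) v w unfolding c d by (auto simp: doubleton_eq_iff)
    then show ?thesis using 1 b c d by simp
  next
    case 2
    then have b: "b' = d" using N(5) N'(1) by auto
    have c: "c' = c" using N(4) N'(2) v w unfolding 2 b by (auto simp: doubleton_eq_iff)
    have d: "d' = b" using N(3) N'(3) v w unfolding b c by (auto simp: doubleton_eq_iff)
    have "e' = a" using N(2) N'(4) v w unfolding c d by (auto simp: doubleton_eq_iff)
    then show ?thesis using 2 b c d by simp
  qed
qed (auto simp: tuple_graph_def insert_commute)

lemma num_copies_path_graph_5:
  assumes G: "simple_graph G"
  shows "2 * num_copies (path_graph 5) G = card (paths5 (adj G))"
proof -
  let ?P = "paths5 (adj G)"
  have "?P \<subseteq> verts G \<times> verts G \<times> verts G \<times> verts G \<times> verts G"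
    using G by (auto simp: paths5_def adj_def simple_graph_def)
  then have fin: "finite ?P" by (rule finite_subset) (use G in \<open>simp add: simple_graph_def\<close>)
  have "card {t \<in> ?P. tuple_graph t = S} = 2" if S: "S \<in> tuple_graph ` ?P" for S
  proof -
    obtain a b c d e where t: "(a, b, c, d, e) \<in> ?P" "S = tuple_graph (a, b, c, d, e)" using S by auto
    then have dist: "distinct [a, b, c, d, e]" by (simp add: paths5_def)
    have rev: "(e, d, c, b, a) \<in> ?P" using t(1) by (auto simp: paths5_def adj_def insert_commute)
    have "{t \<in> ?P. tuple_graph t = S} = {(a, b, c, d, e), (e, d, c, b, a)}"
    proof
      show "{t \<in> ?P. tuple_graph t = S} \<subseteq> {(a, b, c, d, e), (e, d, c, b, a)}"
      proof
        fix s assume s: "s \<in> {t \<in> ?P. tuple_graph t = S}"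
        obtain a' b' c' d' e' where s': "s = (a', b', c', d', e')" by (cases s)
        have "distinct [a', b', c', d', e']" using s by (simp add: s' paths5_def)
        from tuple_graph_eq_iff[OF dist this] show "s \<in> {(a, b, c, d, e), (e, d, c, b, a)}"
          using s unfolding s' t(2) by auto
      qed
      show "{(a, b, c, d, e), (e, d, c, b, a)} \<subseteq> {t \<in> ?P. tuple_graph t = S}"
        using t rev by (auto simp: tuple_graph_def insert_commute)
    qed
    then show ?thesis using dist by simp
  qed
  then have "card ?P = (\<Sum>S\<in>tuple_graph ` ?P. 2)"
    using sum.image_gen[OF fin, of "\<lambda>_. 1::nat" tuple_graph] by simp
  then show ?thesis by (simp add: num_copies_def copies_eq_image[OF G])
qed

lemma fan_copies:
  assumes n: "40 \<le> n"
  shows "\<exists>G :: nat graph. outerplanar G \<and> card (verts G) = n \<and>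
    17 / 4 * (real n)\<^sup>2 - 100 * real n \<le> real (num_copies (path_graph 5) G)"
proof -
  define k where "k = n div 4"
  interpret fan_graph k n by unfold_locales (use n in \<open>auto simp: k_def\<close>)
  interpret sgraph "{..<n}" E by (rule sgraph_fan_rel)
  define G :: "nat graph" where "G = ({..<n}, {{i, j} |i j. (i, j) \<in> E})"
  have adj: "adj G = E"
    using E_sym by (fastforce simp: adj_def G_def doubleton_eq_iff)
  have "e \<subseteq> {..<n} \<and> card e = 2" if "e \<in> edges G" for e
  proof -
    from that obtain i j where e: "e = {i, j}" "(i, j) \<in> E" by (auto simp: G_def)
    then have "i \<noteq> j" using E_irrefl by auto
    then show ?thesis using e E_V[OF e(2)] by simp
  qed
  then have simple: "simple_graph G" by (simp add: simple_graph_def G_def)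
  moreover have "outerplanar G"
    by (rule noncrossing_imp_outerplanar[OF simple]) (simp add: adj noncrossing_fan_rel)
  moreover have "real (2 * num_copies (path_graph 5) G) = real (card (paths5 E))"
    using num_copies_path_graph_5[OF simple] unfolding adj by (rule arg_cong)
  then have "17 / 4 * (real n)\<^sup>2 - 100 * real n \<le> real (num_copies (path_graph 5) G)"
    using card_paths5_fan by simp
  ultimately show ?thesis by (intro exI[of _ G]) (simp add: G_def)
qed

lemma outerplanar_copies_le:
  assumes "outerplanar G"
  shows "real (num_copies (path_graph 5) G) \<le>
    17 / 4 * (real (card (verts G)))\<^sup>2 - 1 / 2 * real (card (verts G)) + paths5_const / 2"
proof -
  have "simple_graph G" using assms by (simp add: outerplanar_def)
  then have "real (2 * num_copies (path_graph 5) G) = real (card (paths5 (adj G)))"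
    by (intro arg_cong[of _ _ real] num_copies_path_graph_5)
  then show ?thesis using outer_paths5_bound[OF outerplanar_imp_outer[OF assms]] by simp
qed

theorem theorem4:
  shows "(\<lambda>n. real (outerplanar_turan n (path_graph 5)) - 17 / 4 * (real n)\<^sup>2) \<in> \<Theta>(\<lambda>n. real n)"
proof -
  define g where "g n = real (outerplanar_turan n (path_graph 5)) - 17 / 4 * (real n)\<^sup>2" for n
  let ?S = "\<lambda>n. {num_copies (path_graph 5) G |G :: nat graph. outerplanar G \<and> card (verts G) = n}"
  have upper: "g n \<le> - (1 / 2) * real n + paths5_const / 2" for n
  proof -
    have "outerplanar_turan n (path_graph 5) \<in> ?S n"
      unfolding outerplanar_turan_def
      by (rule Max_in[OF finite_num_copies_outerplanar num_copies_outerplanar_nonempty])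
    then obtain G :: "nat graph" where "outerplanar G" "card (verts G) = n"
      "outerplanar_turan n (path_graph 5) = num_copies (path_graph 5) G" by blast
    then show ?thesis using outerplanar_copies_le[of G] by (simp add: g_def)
  qed
  have lower: "- 100 * real n \<le> g n" if n: "40 \<le> n" for n
  proof -
    obtain G :: "nat graph" where G: "outerplanar G" "card (verts G) = n"
      "17 / 4 * (real n)\<^sup>2 - 100 * real n \<le> real (num_copies (path_graph 5) G)" using fan_copies[OF n] by blast
    then have "num_copies (path_graph 5) G \<le> outerplanar_turan n (path_graph 5)"
      unfolding outerplanar_turan_def by (intro Max_ge[OF finite_num_copies_outerplanar]) blast
    then show ?thesis using G(3) by (simp add: g_def)
  qed
  \<comment> \<open>From 2 * \<open>paths5_const\<close> on, the constant
    \<open>paths5_const / 2\<close> uses up at most half of the term - n/2, so \<open>g n\<close> is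
    at most - n/4; the summand 40 makes the construction available.\<close>
  define N where "N = nat \<lceil>2 * paths5_const\<rceil> + 40"
  have N: "1 / 4 * real n \<le> \<bar>g n\<bar> \<and> \<bar>g n\<bar> \<le> 100 * real n" if "N \<le> n" for n
  proof -
    have "2 * paths5_const \<le> real (nat \<lceil>2 * paths5_const\<rceil>)" by (rule real_nat_ceiling_ge)
    then have "2 * paths5_const \<le> real n" "40 \<le> n" using that by (auto simp: N_def)
    then show ?thesis using upper[of n] lower[of n] by linarith
  qed
  have "g \<in> O(\<lambda>n. real n)"
    by (rule landau_o.bigI[of 100]) (use N in \<open>auto simp: eventually_at_top_linorder intro!: exI[of _ N]\<close>)
  moreover have "g \<in> \<Omega>(\<lambda>n. real n)"
    by (rule landau_omega.bigI[of "1 / 4"]) (use N in \<open>auto simp: eventually_at_top_linorder intro!: exI[of _ N]\<close>)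
  ultimately show ?thesis unfolding g_def[abs_def] by (rule bigthetaI)
qed

end
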